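(* Let $X$ be a finitely primitive countable Markov shift and let $\phi\colon X\to\mathbb R$ be a summable function with summable variations satisfying $\beta_\infty(\phi)<1$. As $n\to\infty$, the Borel probability measure on $X$ defined by $$\left(\sum_{x\in{\rm Per}_n(\sigma|_X)}\exp S_n\phi(x)\right)^{-1}\sum_{x\in{\rm Per}_n(\sigma|_X)}\exp S_n\phi(x)\,\delta_x^n$$ converges in the weak*-topology to the equilibrium state for the potential $\phi$.
   Context: Markov shifts. Let $S$ be a countably infinite set, let $\mathbb N$ be the set of non-negative integers, and give $S^{\mathbb N}$ the product of the discrete topologies. Let $T=(t_{ij})_{S\times S}$ be a matrix of zeros and ones with no row or column made only of zeros. The countable Markov shift generated by $T$ is $X=\{x\in S^{\mathbb N}: t_{x_ix_{i+1}}=1\ \forall i\in\mathbb N\}$; $\sigma$ is the left shift, $(\sigma x)_i=x_{i+1}$, and $\sigma|_X$ its restriction to $X$. A string $\omega_0\cdots\omega_{n-1}$ of elements of $S$ is admissible if $n=1$, or $n\ge2$ and $t_{\omega_i\omega_{i+1}}=1$ for $0\le i\le n-2$. $E^n$ is the set of admissible strings of length $n$, $E^*=\bigcup_{n\ge1}E^n$. $X$ is finitely irreducible if there is a finite set $\Lambda\subset E^*$ such that for all $\omega,\omega'\in E^*$ there is $\lambda\in\Lambda$ with the concatenation $\omega\lambda\omega'\in E^*$; it is finitely primitive if moreover $\Lambda$ can be taken to consist of strings of the same length $N$ (for the full shift, where all $t_{ij}=1$, one may also use the empty string, $N=0$). For $\omega=\omega_0\cdots\omega_{n-1}\in E^n$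 the $n$-cylinder is $[\omega]=\{x\in X: x_i=\omega_i,\ 0\le i\le n-1\}$. Potentials. $S_n\phi=\sum_{i=0}^{n-1}\phi\circ\sigma^i$ and $Z_n(\phi)=\sum_{\omega\in E^n}\sup_{[\omega]}\exp S_n\phi$. $\phi\colon X\to\mathbb R$ is summable if $Z_1(\phi)<\infty$. For summable $\phi$, $\beta_\infty(\phi)=\inf\{\beta\in\mathbb R:\beta\phi\text{ is summable}\}$. $\phi$ has summable variations if $\sum_{n=1}^\infty\sup_{\omega\in E^n}\sup_{x,y\in[\omega]}(\phi(x)-\phi(y))<\infty$. Measures. Weak*-convergence of Borel probability measures on $X$ means convergence of integrals of all bounded continuous functions. $\mathcal M(\sigma|_X)$ is the set of shift-invariant Borel probability measures on $X$, $h(\mu)$ the Kolmogorov–Sinai entropy of $\mu\in\mathcal M(\sigma|_X)$, $\mathcal M_\phi(\sigma|_X)=\{\mu\in\mathcal M(\sigma|_X):\int\phi\,d\mu>-\infty\}$, and $P(\phi)=\sup\{h(\mu)+\int\phi\,d\mu:\mu\in\mathcal M_\phi(\sigma|_X)\}$. Equilibrium states for $\phi$ are the measures in $\mathcal M_\phi(\sigma|_X)$ attaining this supremum (the terminology is used when $P(\phi)<\infty$ and $P(\phi)=\lim_n\frac1n\log Z_n(\phi)$); under the hypotheses of the statement the equilibrium state exists and is unique. Periodic points. ${\rm Per}_n(\sigma|_X)=\{x\in X:\sigma^nx=x\}$, and $\delta_x^n$ is the uniform probability distribution on $\{x,\sigma x,\ldots,\sigma^{n-1}x\}$, i.e. $\delta_x^n=\frac1n\sum_{i=0}^{n-1}\delta_{\sigma^ix}$.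 The measures are considered for all $n$ large enough that ${\rm Per}_n(\sigma|_X)\neq\emptyset$. *)

theory Defs
  imports "HOL-Probability.Probability"
begin

section \<open>Countable Markov shifts\<close>

text \<open>
  The alphabet is a type of class \<open>countable\<close> and \<open>discrete_topology\<close>, so the
  topology of \<open>nat \<Rightarrow> 'a\<close> is the product of the discrete topologies. A matrix of zeros
  and ones is given by the set of its entries equal to one, as a relation \<open>t\<close>.
\<close>

definition transition_matrix :: "('a \<Rightarrow> 'a \<Rightarrow> bool) \<Rightarrow> bool" where
  "transition_matrix t \<longleftrightarrow> (\<forall>i. \<exists>j. t i j) \<and> (\<forall>j. \<exists>i. t i j)"

definition markov_shift :: "('a \<Rightarrow> 'a \<Rightarrow> bool) \<Rightarrow> (nat \<Rightarrow> 'a) set" where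
  "markov_shift t = {x. \<forall>i. t (x i) (x (Suc i))}"

definition left_shift :: "(nat \<Rightarrow> 'a) \<Rightarrow> (nat \<Rightarrow> 'a)" where
  "left_shift x = (\<lambda>i. x (Suc i))"

definition admissible :: "('a \<Rightarrow> 'a \<Rightarrow> bool) \<Rightarrow> 'a list \<Rightarrow> bool" where
  "admissible t w \<longleftrightarrow> w \<noteq> [] \<and> (\<forall>i. Suc i < length w \<longrightarrow> t (w ! i) (w ! Suc i))"

definition words :: "('a \<Rightarrow> 'a \<Rightarrow> bool) \<Rightarrow> nat \<Rightarrow> 'a list set" where
  "words t n = {w. admissible t w \<and> length w = n}"

definition cylinder :: "('a \<Rightarrow> 'a \<Rightarrow> bool) \<Rightarrow> 'a list \<Rightarrow> (nat \<Rightarrow> 'a) set" where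
  "cylinder t w = {x \<in> markov_shift t. \<forall>i < length w. x i = w ! i}"

text \<open>
  For the full shift the connecting strings may also be chosen empty (\<open>N = 0\<close>).
\<close>

definition finitely_primitive :: "('a \<Rightarrow> 'a \<Rightarrow> bool) \<Rightarrow> bool" where
  "finitely_primitive t \<longleftrightarrow>
    (\<exists>\<Lambda> N. finite \<Lambda>
      \<and> (\<Lambda> \<subseteq> words t N \<or> (N = 0 \<and> (\<forall>i j. t i j) \<and> \<Lambda> \<subseteq> {[]}))
      \<and> (\<forall>w w'. admissible t w \<longrightarrow> admissible t w' \<longrightarrow>
            (\<exists>l\<in>\<Lambda>. admissible t (w @ l @ w'))))"


section \<open>Potentials\<close>

text \<open>
  A potential is a function on the whole sequence space of which only the values on
  \<open>markov_shift t\<close> are used. Quantities that may be infinite are \<open>ennreal\<close> or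
  \<open>ereal\<close> valued.
\<close>

definition birkhoff_sum :: "((nat \<Rightarrow> 'a) \<Rightarrow> real) \<Rightarrow> nat \<Rightarrow> (nat \<Rightarrow> 'a) \<Rightarrow> real" where
  "birkhoff_sum \<phi> n x = (\<Sum>i<n. \<phi> ((left_shift ^^ i) x))"

definition partition_function ::
    "('a \<Rightarrow> 'a \<Rightarrow> bool) \<Rightarrow> ((nat \<Rightarrow> 'a) \<Rightarrow> real) \<Rightarrow> nat \<Rightarrow> ennreal" where
  "partition_function t \<phi> n =
    (\<Sum>\<^sub>\<infinity>w\<in>words t n. SUP x\<in>cylinder t w. ennreal (exp (birkhoff_sum \<phi> n x)))"

definition summable_potential ::
    "('a \<Rightarrow> 'a \<Rightarrow> bool) \<Rightarrow> ((nat \<Rightarrow> 'a) \<Rightarrow> real) \<Rightarrow> bool" where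
  "summable_potential t \<phi> \<longleftrightarrow> partition_function t \<phi> 1 < \<infinity>"

definition beta_infinity ::
    "('a \<Rightarrow> 'a \<Rightarrow> bool) \<Rightarrow> ((nat \<Rightarrow> 'a) \<Rightarrow> real) \<Rightarrow> ereal" where
  "beta_infinity t \<phi> =
    (INF \<beta>\<in>{\<beta>::real. summable_potential t (\<lambda>x. \<beta> * \<phi> x)}. ereal \<beta>)"

text \<open>
  Here \<open>ennreal\<close> truncates negative differences to \<open>0\<close>. This does not change the
  suprema, since \<open>x = y\<close> already contributes \<open>0\<close>.
\<close>

definition summable_variations ::
    "('a \<Rightarrow> 'a \<Rightarrow> bool) \<Rightarrow> ((nat \<Rightarrow> 'a) \<Rightarrow> real) \<Rightarrow> bool" where
  "summable_variations t \<phi> \<longleftrightarrow>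
    (\<Sum>n. SUP w\<in>words t (Suc n). SUP x\<in>cylinder t w. SUP y\<in>cylinder t w.
        ennreal (\<phi> x - \<phi> y)) < \<infinity>"


section \<open>Measures\<close>

definition shift_borel ::
    "('a::discrete_topology \<Rightarrow> 'a \<Rightarrow> bool) \<Rightarrow> (nat \<Rightarrow> 'a) measure" where
  "shift_borel t = restrict_space borel (markov_shift t)"

definition weak_star_converges ::
    "('a::discrete_topology \<Rightarrow> 'a \<Rightarrow> bool) \<Rightarrow>
      (nat \<Rightarrow> (nat \<Rightarrow> 'a) measure) \<Rightarrow> (nat \<Rightarrow> 'a) measure \<Rightarrow> bool" where
  "weak_star_converges t \<mu>s \<mu> \<longleftrightarrow>
    (\<forall>f :: (nat \<Rightarrow> 'a) \<Rightarrow> real.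
      continuous_on (markov_shift t) f \<longrightarrow> bounded (f ` markov_shift t) \<longrightarrow>
      (\<lambda>n. \<integral>x. f x \<partial>\<mu>s n) \<longlonglongrightarrow> (\<integral>x. f x \<partial>\<mu>))"

definition invariant_measures ::
    "('a::discrete_topology \<Rightarrow> 'a \<Rightarrow> bool) \<Rightarrow> (nat \<Rightarrow> 'a) measure set" where
  "invariant_measures t =
    {\<mu>. sets \<mu> = sets (shift_borel t) \<and> prob_space \<mu> \<and>
        (\<forall>A\<in>sets \<mu>. emeasure \<mu> (left_shift -` A \<inter> space \<mu>) = emeasure \<mu> A)}"


subsection \<open>Kolmogorov--Sinai entropy\<close>

definition partition_entropy :: "'b measure \<Rightarrow> 'b set set \<Rightarrow> real" where
  "partition_entropy M P = - (\<Sum>A\<in>P. measure M A * ln (measure M A))"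

text \<open>
  \<open>refined_partition M f P n\<close> is the join of the pullbacks of \<open>P\<close> under
  \<open>f ^^ i\<close>, \<open>i < n\<close>. It may contain the empty set, which does not contribute to
  \<open>partition_entropy\<close> because \<open>0 * ln 0 = 0\<close>.
\<close>

primrec refined_partition ::
    "'b measure \<Rightarrow> ('b \<Rightarrow> 'b) \<Rightarrow> 'b set set \<Rightarrow> nat \<Rightarrow> 'b set set" where
  "refined_partition M f P 0 = {space M}"
| "refined_partition M f P (Suc n) =
    {A \<inter> ((f ^^ n) -` B \<inter> space M) | A B. A \<in> refined_partition M f P n \<and> B \<in> P}"

definition ks_entropy :: "'b measure \<Rightarrow> ('b \<Rightarrow> 'b) \<Rightarrow> ereal" where
  "ks_entropy M f =
    (SUP P\<in>{P. finite P \<and> P \<subseteq> sets M \<and> partition_on (space M) P}.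
      ereal (lim (\<lambda>n. partition_entropy M (refined_partition M f P n) / real n)))"


subsection \<open>Pressure and equilibrium states\<close>

text \<open>
  The integral of a function whose integral may be infinite. It is meaningful unless
  both parts are infinite. A summable potential is bounded above on the shift space,
  so its integral is then well defined and less than \<open>\<infinity>\<close>.
\<close>

definition ereal_integral :: "'b measure \<Rightarrow> ('b \<Rightarrow> real) \<Rightarrow> ereal" where
  "ereal_integral M f =
    enn2ereal (\<integral>\<^sup>+x. ennreal (f x) \<partial>M) - enn2ereal (\<integral>\<^sup>+x. ennreal (- f x) \<partial>M)"

definition invariant_measures_for ::
    "('a::discrete_topology \<Rightarrow> 'a \<Rightarrow> bool) \<Rightarrow> ((nat \<Rightarrow> 'a) \<Rightarrow> real) \<Rightarrow>
      (nat \<Rightarrow> 'a) measure set" where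
  "invariant_measures_for t \<phi> =
    {\<mu> \<in> invariant_measures t. ereal_integral \<mu> \<phi> > -\<infinity>}"

definition pressure ::
    "('a::discrete_topology \<Rightarrow> 'a \<Rightarrow> bool) \<Rightarrow> ((nat \<Rightarrow> 'a) \<Rightarrow> real) \<Rightarrow> ereal" where
  "pressure t \<phi> =
    (SUP \<mu>\<in>invariant_measures_for t \<phi>. ks_entropy \<mu> left_shift + ereal_integral \<mu> \<phi>)"

definition ennreal_log :: "ennreal \<Rightarrow> ereal" where
  "ennreal_log z =
    (if z = 0 then -\<infinity> else if z = \<infinity> then \<infinity> else ereal (ln (enn2real z)))"

text \<open>
  Equilibrium states are only spoken of when the pressure is finite and equals the
  exponential growth rate of the partition functions. This proviso is part of the
  definition.
\<close>

definition equilibrium_state ::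
    "('a::discrete_topology \<Rightarrow> 'a \<Rightarrow> bool) \<Rightarrow> ((nat \<Rightarrow> 'a) \<Rightarrow> real) \<Rightarrow>
      (nat \<Rightarrow> 'a) measure \<Rightarrow> bool" where
  "equilibrium_state t \<phi> \<mu> \<longleftrightarrow>
    pressure t \<phi> < \<infinity> \<and>
    (\<lambda>n. ennreal_log (partition_function t \<phi> n) / ereal (real n)) \<longlonglongrightarrow> pressure t \<phi> \<and>
    \<mu> \<in> invariant_measures_for t \<phi> \<and>
    ks_entropy \<mu> left_shift + ereal_integral \<mu> \<phi> = pressure t \<phi>"


subsection \<open>Measures on periodic points\<close>

definition periodic_points :: "('a \<Rightarrow> 'a \<Rightarrow> bool) \<Rightarrow> nat \<Rightarrow> (nat \<Rightarrow> 'a) set" where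
  "periodic_points t n = {x \<in> markov_shift t. (left_shift ^^ n) x = x}"

definition orbit_measure ::
    "('a::discrete_topology \<Rightarrow> 'a \<Rightarrow> bool) \<Rightarrow> nat \<Rightarrow> (nat \<Rightarrow> 'a) \<Rightarrow> (nat \<Rightarrow> 'a) measure" where
  "orbit_measure t n x =
    measure_of (markov_shift t) (sets (shift_borel t))
      (\<lambda>A. (\<Sum>i<n. emeasure (return (shift_borel t) ((left_shift ^^ i) x)) A) / of_nat n)"

text \<open>
  If there are no points of period \<open>n\<close>, the following is the zero measure. In a
  finitely primitive shift this happens for finitely many \<open>n\<close> only.
\<close>

definition periodic_measure ::
    "('a::discrete_topology \<Rightarrow> 'a \<Rightarrow> bool) \<Rightarrow> ((nat \<Rightarrow> 'a) \<Rightarrow> real) \<Rightarrow> nat \<Rightarrow>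
      (nat \<Rightarrow> 'a) measure" where
  "periodic_measure t \<phi> n =
    measure_of (markov_shift t) (sets (shift_borel t))
      (\<lambda>A. (\<Sum>\<^sub>\<infinity>x\<in>periodic_points t n.
              ennreal (exp (birkhoff_sum \<phi> n x)) * emeasure (orbit_measure t n x) A)
           / (\<Sum>\<^sub>\<infinity>x\<in>periodic_points t n. ennreal (exp (birkhoff_sum \<phi> n x))))"

end

theory Submission
  imports Defs "HOL-Library.Diagonal_Subsequence"
begin

text \<open>
  For a word \<open>w\<close> of length \<open>n\<close> let \<open>rho w\<close> be the supremum over the cylinder of \<open>w\<close> of
  \<open>exp (S\<^sub>n \<phi> - n p)\<close>, where \<open>p\<close> is the growth rate of the partition functions. Summable variations
  and finite primitivity make \<open>rho\<close> multiplicative up to constants, so its sums over the words of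
  a given length stay bounded away from \<open>0\<close> and \<open>\<infinity>\<close>. Hence the periodic measures give every
  cylinder a mass comparable to \<open>rho w\<close>, uniformly in the period. These bounds are summable over
  the alphabet, so no mass escapes and every subsequence has a limit point, which is an invariant
  measure with the same (Gibbs) bounds.

  Let \<open>\<mu>\<close> be such a Gibbs measure. It is ergodic, and comparing the entropy of an invariant \<open>\<nu>\<close> on
  cylinders with the masses under \<open>\<mu>\<close> gives \<open>h(\<nu>) + \<integral>\<phi> d\<nu> \<le> p\<close>. If equality holds, the relative
  entropies of \<open>\<nu>\<close> with respect to \<open>\<mu>\<close> on the cylinder algebras are bounded. Therefore \<open>\<nu>\<close> is
  absolutely continuous, and by ergodicity \<open>\<nu> = \<mu>\<close>. Conversely \<open>\<beta>\<^sub>\<infinity> < 1\<close> makes \<open>\<phi>\<close> integrable for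
  \<open>\<mu>\<close>, and then \<open>\<mu>\<close> attains \<open>p\<close>. So all limit points of the periodic measures coincide with the
  unique equilibrium state.
\<close>

section \<open>Subadditive sequences\<close>

text \<open>An infinite alphabet causes two difficulties: the shift space need not be compact, and a
  generating partition may have infinite entropy. Entropy is therefore computed through finite
  codings that merge all but finitely many letters. Merging enlarges the cells, so their masses
  under \<open>\<mu>\<close> keep the lower Gibbs bound, which is what bounding h(\<nu>) from above
  requires. The upper Gibbs bound for cells fails, so the lower bound for h(\<mu>) needs a limit in
  the truncation level that is uniform in the word length.

  Fekete's lemma enters with both of its conclusions. Applied to ln Z_n and, up to a constant, to
  -ln Z_n, it shows that Z_n differs from exp(n p) by a bounded factor only, which is why the sums
  of \<open>rho\<close> stay bounded. Applied to entropies H_n, it gives n h \<le> H_n at every n.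
  So for a measure attaining p the gap between n (p - \<integral>\<phi> d\<nu>) + ln C and H_n is at
  most ln C + 1 at a fine enough coding, uniformly in n. This is the boundedness of relative entropy
  that replaces any use of transfer operators.\<close>

lemma fekete:
  fixes a :: "nat \<Rightarrow> real"
  assumes sub: "\<And>m n. a (m + n) \<le> a m + a n" and lb: "\<And>n. c * real n \<le> a n"
  obtains L where "(\<lambda>n. a n / real n) \<longlonglongrightarrow> L" "\<And>n. real n * L \<le> a n"
proof -
  \<comment> \<open>The limit is the infimum, so the second conclusion holds at every index and not
    only asymptotically. The linear lower bound \<open>lb\<close> makes the infimum finite.\<close>
  define L where "L = (INF n\<in>{1..}. a n / real n)"
  have bdd: "bdd_below ((\<lambda>n. a n / real n) ` {1..})"
    by (rule bdd_belowI[of _ c]) (auto simp: pos_le_divide_eq lb)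
  have L_le: "L \<le> a n / real n" if "n \<ge> 1" for n
    unfolding L_def using bdd that by (intro cINF_lower) auto
  have a0: "0 \<le> a 0" using sub[of 0 0] by simp
  have nL: "real n * L \<le> a n" for n
    using L_le[of n] a0 by (cases "n = 0") (auto simp: pos_le_divide_eq mult.commute)
  have mult: "a (q * m) \<le> real q * a m + a 0" for q m
  proof (induction q)
    case (Suc q)
    have "a (Suc q * m) \<le> a m + a (q * m)" using sub[of m "q * m"] by simp
    then show ?case using Suc by (simp add: algebra_simps)
  qed simp
  have "(\<lambda>n. a n / real n) \<longlonglongrightarrow> L"
  proof (rule LIMSEQ_I)
    fix r :: real assume r: "r > 0"
    have "\<exists>x\<in>(\<lambda>n. a n / real n) ` {1..}. x < L + r/2"
      unfolding L_def using cInf_lessD[of "(\<lambda>n. a n / real n) ` {1..}" "L + r/2"] r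
      by (auto simp: L_def)
    then obtain m where m: "m \<ge> 1" "a m / real m < L + r/2" by auto
    \<comment> \<open>Collects everything that does not grow with \<open>n\<close> after division by
      \<open>m\<close> with remainder \<open>i\<close>: the values \<open>a i\<close> and
      \<open>a 0\<close>, and \<open>real i * (L + r/2)\<close>, whose sign is unknown.\<close>
    define B where "B = (\<Sum>i<m. \<bar>a i\<bar>) + \<bar>a 0\<bar> + \<bar>real m * (L + r/2)\<bar> + 1"
    have B: "\<bar>a i\<bar> + \<bar>a 0\<bar> + \<bar>real m * (L + r/2)\<bar> \<le> B" if "i < m" for i
      using member_le_sum[of i "{..<m}" "\<lambda>i. \<bar>a i\<bar>"] that unfolding B_def by auto
    obtain n0 where n0: "real n0 > 2 * B / r" using reals_Archimedean2 by blast
    show "\<exists>no. \<forall>n\<ge>no. norm (a n / real n - L) < r"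
    proof (intro exI allI impI)
      fix n assume n: "max 1 n0 \<le> n"
      define q i where "q = n div m" and "i = n mod m"
      have i: "i < m" and nq: "n = q * m + i" using m unfolding q_def i_def by auto
      have "a n \<le> a (q * m) + a i" using sub nq by simp
      also have "\<dots> \<le> real q * a m + a 0 + a i" using mult by simp
      also have "real q * a m \<le> real q * (real m * (L + r/2))"
        using m by (intro mult_left_mono) (auto simp: field_simps)
      also have "real q * (real m * (L + r/2)) = real n * (L + r/2) - real i * (L + r/2)"
        using nq by (simp add: algebra_simps)
      finally have le: "a n \<le> real n * (L + r/2) - real i * (L + r/2) + a 0 + a i" by simp
      have "- (real i * (L + r/2)) \<le> \<bar>real m * (L + r/2)\<bar>"
      proof -
        have "\<bar>real i * (L + r/2)\<bar> \<le> \<bar>real m * (L + r/2)\<bar>"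
          using i by (auto simp: abs_mult intro!: mult_right_mono)
        then show ?thesis by linarith
      qed
      then have "a n \<le> real n * (L + r/2) + B" using B[OF i] le by linarith
      moreover have "B < real n * (r/2)"
      proof -
        have "B < real n0 * (r/2)" using n0 r by (simp add: field_simps)
        also have "\<dots> \<le> real n * (r/2)" using n r by (intro mult_right_mono) auto
        finally show ?thesis .
      qed
      ultimately have "a n < real n * (L + r)" by (simp add: algebra_simps)
      then have "a n / real n < L + r" using n by (simp add: field_simps)
      moreover have "L \<le> a n / real n" using n L_le by simp
      ultimately show "norm (a n / real n - L) < r" by simp
    qed
  qed
  then show ?thesis using nL that by blast
qed

section \<open>Entropy of finite-valued random variables\<close>

definition eta :: "real \<Rightarrow> real" where "eta x = - (x * ln x)"

lemma eta_0 [simp]: "eta 0 = 0" by (simp add: eta_def)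

lemma eta_nonneg: "0 \<le> x \<Longrightarrow> x \<le> 1 \<Longrightarrow> 0 \<le> eta x"
  by (cases "x = 0") (auto simp: eta_def mult_le_0_iff)

text \<open>Two uses of \<open>ln y \<le> y - 1\<close>, at \<open>e / x\<close> and at
  \<open>1 / e\<close>. A majorant that is affine in \<open>x\<close> is wanted because it can be
  averaged over the atoms of a partition, where only the total mass and the total error
  remain.\<close>

lemma eta_le_near_0:
  assumes "0 \<le> x" "0 < e" shows "eta x \<le> e + x / e"
proof (cases "x = 0")
  case False
  then have x: "x > 0" using assms by simp
  have "ln (e / x) \<le> e / x - 1" using x assms by (intro ln_le_minus_one) auto
  moreover have "ln (e / x) = ln e - ln x" using x assms by (simp add: ln_div)
  ultimately have "x * (ln e - ln x) \<le> x * (e / x - 1)" using x by (intro mult_left_mono) auto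
  then have "- (x * ln x) \<le> e - x - x * ln e" using x by (simp add: algebra_simps)
  moreover have "- ln e \<le> 1 / e - 1" using assms ln_le_minus_one[of "1/e"] by (simp add: ln_div)
  then have "x * (- ln e) \<le> x * (1 / e - 1)" using x by (intro mult_left_mono) auto
  ultimately show ?thesis using x unfolding eta_def by (simp add: algebra_simps)
qed (use assms in auto)

lemma eta_le_near_1:
  assumes "0 \<le> x" "x \<le> 1" "0 < e" "e \<le> 1" shows "eta x \<le> e + (1 - x) / e"
proof -
  have "eta x \<le> 1 - x"
  proof (cases "x = 0")
    case False
    then have x: "x > 0" using assms by simp
    have "- ln x \<le> 1 / x - 1" using x ln_le_minus_one[of "1/x"] by (simp add: ln_div)
    then have "x * (- ln x) \<le> x * (1 / x - 1)" using x by (intro mult_left_mono) auto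
    then show ?thesis using x by (simp add: eta_def algebra_simps)
  qed (use assms in auto)
  also have "1 - x \<le> (1 - x) / e" using assms
    by (simp add: pos_le_divide_eq mult_left_le)
  finally show ?thesis using assms by simp
qed

text \<open>Shannon entropy of the partition into level sets. With random variables in place of
  partitions, a join is a pair and a coarsening is composition with a function, so no set algebra is
  needed in entropy estimates.\<close>

definition ent :: "'b measure \<Rightarrow> ('b \<Rightarrow> 'c) \<Rightarrow> real" where
  "ent M X = (\<Sum>v\<in>X ` space M. eta (measure M (X -` {v} \<inter> space M)))"

context prob_space
begin

abbreviation pr :: "('a \<Rightarrow> 'c) \<Rightarrow> 'c \<Rightarrow> real" where "pr X v \<equiv> prob (X -` {v} \<inter> space M)"

lemma simple_sets: "simple_function M X \<Longrightarrow> X -` A \<inter> space M \<in> events"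
  using measurable_sets[OF measurable_simple_function, of M X A] by simp

lemma prob_sum_fibres:
  assumes W: "simple_function M W" and A: "A \<in> events"
  shows "prob A = (\<Sum>w\<in>W ` space M. prob (A \<inter> (W -` {w} \<inter> space M)))"
proof -
  have "prob (\<Union>w\<in>W ` space M. A \<inter> (W -` {w} \<inter> space M)) = (\<Sum>w\<in>W ` space M. prob (A \<inter> (W -` {w} \<inter> space M)))"
    using W A by (intro finite_measure_finite_Union)
      (auto simp: simple_function_def disjoint_family_on_def)
  moreover have "(\<Union>w\<in>W ` space M. A \<inter> (W -` {w} \<inter> space M)) = A"
    using sets.sets_into_space[OF A] by auto
  ultimately show ?thesis by simp
qed

lemma pr_sum:
  assumes W: "simple_function M W"
  shows "prob ((g \<circ> W) -` A \<inter> space M) = (\<Sum>w\<in>{w\<in>W ` space M. g w \<in> A}. pr W w)"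
proof -
  have fin: "finite (W ` space M)" using W by (simp add: simple_function_def)
  have "prob ((g \<circ> W) -` A \<inter> space M) =
      (\<Sum>w\<in>W ` space M. prob ((g \<circ> W) -` A \<inter> space M \<inter> (W -` {w} \<inter> space M)))"
    using simple_sets[OF W, of "g -` A"] by (intro prob_sum_fibres[OF W]) (simp add: vimage_comp)
  also have "\<dots> = (\<Sum>w\<in>W ` space M. if g w \<in> A then pr W w else 0)"
  proof (intro sum.cong refl)
    fix w
    have "(g \<circ> W) -` A \<inter> space M \<inter> (W -` {w} \<inter> space M) = (if g w \<in> A then W -` {w} \<inter> space M else {})" by auto
    then show "prob ((g \<circ> W) -` A \<inter> space M \<inter> (W -` {w} \<inter> space M)) = (if g w \<in> A then pr W w else 0)" by simp
  qed
  also have "\<dots> = (\<Sum>w\<in>{w\<in>W ` space M. g w \<in> A}. pr W w)"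
    using fin by (simp add: sum.inter_filter)
  finally show ?thesis .
qed

lemma sum_pr: "simple_function M W \<Longrightarrow> (\<Sum>w\<in>W ` space M. pr W w) = 1"
  using pr_sum[of W id UNIV] by (simp add: prob_space)

lemma ent_nonneg: "0 \<le> ent M X"
  unfolding ent_def by (intro sum_nonneg eta_nonneg) auto

text \<open>Grouping the values of \<open>W\<close> by their image spreads each term of the coarser
  entropy over the finer values. Entropies of several functions of one variable can then be compared
  term by term over a common index set.\<close>

lemma ent_comp:
  assumes W: "simple_function M W"
  shows "ent M (\<lambda>x. g (W x)) = (\<Sum>w\<in>W ` space M. - (pr W w * ln (pr (\<lambda>x. g (W x)) (g w))))"
proof -
  have fin: "finite (W ` space M)" using W by (simp add: simple_function_def)
  have "ent M (\<lambda>x. g (W x)) = (\<Sum>v\<in>g ` (W ` space M). - (pr (g \<circ> W) v * ln (pr (g \<circ> W) v)))"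
    unfolding ent_def eta_def comp_def by (simp add: image_image)
  also have "\<dots> = (\<Sum>v\<in>g ` (W ` space M). (\<Sum>w\<in>{w\<in>W ` space M. g w = v}. - (pr W w * ln (pr (g \<circ> W) (g w)))))"
  proof (intro sum.cong refl)
    fix v
    have "pr (g \<circ> W) v = (\<Sum>w\<in>{w\<in>W ` space M. g w = v}. pr W w)"
      using pr_sum[OF W, of g "{v}"] by simp
    moreover have "(\<Sum>w\<in>{w\<in>W ` space M. g w = v}. - (pr W w * ln c)) = - ((\<Sum>w\<in>{w\<in>W ` space M. g w = v}. pr W w) * ln c)" for c
      by (simp add: sum_negf sum_distrib_right)
    ultimately have "- (pr (g \<circ> W) v * ln (pr (g \<circ> W) v)) = (\<Sum>w\<in>{w\<in>W ` space M. g w = v}. - (pr W w * ln (pr (g \<circ> W) v)))"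
      by metis
    then show "- (pr (g \<circ> W) v * ln (pr (g \<circ> W) v)) = (\<Sum>w\<in>{w\<in>W ` space M. g w = v}. - (pr W w * ln (pr (g \<circ> W) (g w))))"
      by simp
  qed
  also have "\<dots> = (\<Sum>w\<in>W ` space M. - (pr W w * ln (pr (g \<circ> W) (g w))))"
    by (rule sum.image_gen[OF fin, symmetric])
  finally show ?thesis by (simp add: comp_def)
qed

lemma pr_comp_ge:
  assumes W: "simple_function M W" shows "pr W w \<le> pr (\<lambda>x. g (W x)) (g w)"
  using simple_sets[OF W, of "g -` {g w}"]
  by (intro finite_measure_mono) (auto simp: vimage_comp vimage_def)

lemma ent_comp_le:
  assumes W: "simple_function M W" shows "ent M (\<lambda>x. g (W x)) \<le> ent M W"
proof -
  have "- (pr W w * ln (pr (\<lambda>x. g (W x)) (g w))) \<le> - (pr W w * ln (pr W w))" for w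
  proof (cases "pr W w = 0")
    case False
    then have "pr W w > 0" by (simp add: zero_less_measure_iff)
    then have "ln (pr W w) \<le> ln (pr (\<lambda>x. g (W x)) (g w))"
      using pr_comp_ge[OF W, of w g] by simp
    then show ?thesis by (simp add: mult_left_mono)
  qed simp
  then show ?thesis unfolding ent_comp[OF W] by (simp add: ent_def eta_def sum_mono)
qed

lemma ent_mono:
  assumes W: "simple_function M W" and X: "\<And>x. x \<in> space M \<Longrightarrow> X x = g (W x)"
  shows "ent M X \<le> ent M W"
proof -
  have "X -` {v} \<inter> space M = (\<lambda>x. g (W x)) -` {v} \<inter> space M" for v using X by auto
  moreover have "X ` space M = (\<lambda>x. g (W x)) ` space M" using X by (auto intro!: image_cong)
  ultimately have "ent M X = ent M (\<lambda>x. g (W x))" unfolding ent_def by simp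
  then show ?thesis using ent_comp_le[OF W] by simp
qed

text \<open>This is nonnegativity of the conditional mutual information of \<open>X\<close> and
  \<open>Y\<close> given \<open>Z\<close>. The joint law is compared, by
  \<open>ln y \<le> y - 1\<close>, with the law that has the same pair marginals but makes
  \<open>X\<close> and \<open>Y\<close> conditionally independent.\<close>

lemma ent_strong_subadditive:
  assumes X: "simple_function M X" and Y: "simple_function M Y" and Z: "simple_function M Z"
  shows "ent M (\<lambda>x. (X x, Y x, Z x)) + ent M Z \<le> ent M (\<lambda>x. (X x, Z x)) + ent M (\<lambda>x. (Y x, Z x))"
proof -
  let ?W = "\<lambda>x. (X x, Y x, Z x)"
  have W: "simple_function M ?W" using X Y Z by (intro simple_function_Pair)
  let ?XZ = "\<lambda>x. (X x, Z x)" and ?YZ = "\<lambda>x. (Y x, Z x)"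
  have XZ: "simple_function M ?XZ" and YZ: "simple_function M ?YZ" using X Y Z by (auto intro!: simple_function_Pair)
  have fin: "finite (X ` space M)" "finite (Y ` space M)" "finite (Z ` space M)"
    using X Y Z by (auto simp: simple_function_def)
  \<comment> \<open>The conditionally independent coupling over \<open>Z\<close>. Where
    \<open>pr Z z = 0\<close> the quotient is 0 by convention, which is the right value since the
    numerators vanish as well.\<close>
  define q where "q = (\<lambda>(x,y,z). pr ?XZ (x,z) * pr ?YZ (y,z) / pr Z z)"
  define S where "S = X ` space M \<times> Y ` space M \<times> Z ` space M"
  have sub: "?W ` space M \<subseteq> S" unfolding S_def by auto
  have finS: "finite S" unfolding S_def using fin by simp
  have q0: "q w \<ge> 0" for w unfolding q_def by (auto split: prod.split)
  have mXZ: "(\<Sum>x\<in>X ` space M. pr ?XZ (x,z)) = pr Z z" for z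
  proof -
    have "pr Z z = (\<Sum>w\<in>X ` space M. prob ((Z -` {z} \<inter> space M) \<inter> (X -` {w} \<inter> space M)))"
      by (rule prob_sum_fibres[OF X simple_sets[OF Z]])
    also have "\<dots> = (\<Sum>x\<in>X ` space M. pr ?XZ (x,z))"
      by (intro sum.cong refl arg_cong[where f=prob]) auto
    finally show ?thesis by simp
  qed
  have mYZ: "(\<Sum>x\<in>Y ` space M. pr ?YZ (x,z)) = pr Z z" for z
  proof -
    have "pr Z z = (\<Sum>w\<in>Y ` space M. prob ((Z -` {z} \<inter> space M) \<inter> (Y -` {w} \<inter> space M)))"
      by (rule prob_sum_fibres[OF Y simple_sets[OF Z]])
    also have "\<dots> = (\<Sum>x\<in>Y ` space M. pr ?YZ (x,z))"
      by (intro sum.cong refl arg_cong[where f=prob]) auto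
    finally show ?thesis by simp
  qed
  have "(\<Sum>w\<in>?W ` space M. q w) \<le> (\<Sum>w\<in>S. q w)"
    using sub finS q0 by (intro sum_mono2) auto
  also have "\<dots> = (\<Sum>x\<in>X ` space M. \<Sum>y\<in>Y ` space M. \<Sum>z\<in>Z ` space M. q (x,y,z))"
    unfolding S_def by (simp add: sum.cartesian_product)
  also have "\<dots> = (\<Sum>z\<in>Z ` space M. \<Sum>x\<in>X ` space M. \<Sum>y\<in>Y ` space M. q (x,y,z))"
    by (subst (2) sum.swap, subst sum.swap) simp
  also have "\<dots> = (\<Sum>z\<in>Z ` space M. pr Z z)"
  proof (intro sum.cong refl)
    fix z
    have "(\<Sum>x\<in>X ` space M. \<Sum>y\<in>Y ` space M. q (x,y,z)) = (\<Sum>x\<in>X ` space M. pr ?XZ (x,z)) * (\<Sum>y\<in>Y ` space M. pr ?YZ (y,z)) / pr Z z"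
      unfolding q_def by (simp add: sum_product sum_divide_distrib)
    then show "(\<Sum>x\<in>X ` space M. \<Sum>y\<in>Y ` space M. q (x,y,z)) = pr Z z"
      unfolding mXZ mYZ by simp
  qed
  also have "\<dots> = 1" by (rule sum_pr[OF Z])
  finally have qs: "(\<Sum>w\<in>?W ` space M. q w) \<le> 1" .
  have e1: "ent M ?W = (\<Sum>w\<in>?W ` space M. - (pr ?W w * ln (pr ?W w)))" unfolding ent_def eta_def ..
  have e2: "ent M Z = (\<Sum>w\<in>?W ` space M. - (pr ?W w * ln (pr Z (snd (snd w)))))"
    using ent_comp[OF W, of "\<lambda>w. snd (snd w)"] by simp
  have e3: "ent M ?XZ = (\<Sum>w\<in>?W ` space M. - (pr ?W w * ln (pr ?XZ (fst w, snd (snd w)))))"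
    using ent_comp[OF W, of "\<lambda>w. (fst w, snd (snd w))"] by simp
  have e4: "ent M ?YZ = (\<Sum>w\<in>?W ` space M. - (pr ?W w * ln (pr ?YZ (snd w))))"
    using ent_comp[OF W, of "\<lambda>w. snd w"] by simp
  \<comment> \<open>The pointwise Gibbs inequality \<open>pr * ln (q / pr) \<le> q - pr\<close>;
    summing it gives the claim because \<open>q\<close> has total mass at most 1 on the values of
    \<open>?W\<close>.\<close>
  have key: "pr ?W w - q w \<le> - (pr ?W w * ln (pr ?XZ (fst w, snd (snd w)))) + - (pr ?W w * ln (pr ?YZ (snd w)))
      - (- (pr ?W w * ln (pr ?W w)) + - (pr ?W w * ln (pr Z (snd (snd w)))))" for w
  proof (cases "pr ?W w = 0")
    case True then show ?thesis using q0 by simp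
  next
    case False
    then have p: "pr ?W w > 0" by (simp add: zero_less_measure_iff)
    have a: "pr ?XZ (fst w, snd (snd w)) > 0"
      using p pr_comp_ge[OF W, of w "\<lambda>w. (fst w, snd (snd w))"] by simp
    have b: "pr ?YZ (snd w) > 0"
      using p pr_comp_ge[OF W, of w "\<lambda>w. snd w"] by simp
    have c: "pr Z (snd (snd w)) > 0"
      using p pr_comp_ge[OF W, of w "\<lambda>w. snd (snd w)"] by simp
    have qw: "q w = pr ?XZ (fst w, snd (snd w)) * pr ?YZ (snd w) / pr Z (snd (snd w))"
      unfolding q_def by (cases w) auto
    then have qp: "q w > 0" using a b c by simp
    have "ln (q w / pr ?W w) \<le> q w / pr ?W w - 1" using qp p by (intro ln_le_minus_one) simp
    then have "pr ?W w * ln (q w / pr ?W w) \<le> pr ?W w * (q w / pr ?W w - 1)" using p by (intro mult_left_mono) auto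
    also have "\<dots> = q w - pr ?W w" using p by (simp add: algebra_simps)
    finally have "pr ?W w * ln (q w / pr ?W w) \<le> q w - pr ?W w" .
    moreover have "ln (q w / pr ?W w) = ln (pr ?XZ (fst w, snd (snd w))) + ln (pr ?YZ (snd w)) - ln (pr Z (snd (snd w))) - ln (pr ?W w)"
      unfolding qw using a b c p by (simp add: ln_div ln_mult)
    ultimately show ?thesis by (simp add: algebra_simps)
  qed
  have "0 \<le> (\<Sum>w\<in>?W ` space M. pr ?W w - q w)"
    using qs sum_pr[OF W] by (simp add: sum_subtractf)
  also have "\<dots> \<le> (ent M ?XZ + ent M ?YZ) - (ent M ?W + ent M Z)"
    unfolding e1 e2 e3 e4 sum.distrib[symmetric] sum_subtractf[symmetric]
    by (intro sum_mono key)
  finally show ?thesis by simp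
qed

text \<open>Strong subadditivity over the trivial variable with values in \<open>unit\<close>, whose
  entropy is 0.\<close>

lemma ent_subadditive:
  assumes X: "simple_function M X" and Y: "simple_function M Y"
  shows "ent M (\<lambda>x. (X x, Y x)) \<le> ent M X + ent M Y"
proof -
  have "ent M (\<lambda>x. ()) = 0"
    unfolding ent_def eta_def using not_empty by (simp add: prob_space)
  moreover have "ent M (\<lambda>x. (X x, Y x, ())) + ent M (\<lambda>x. ()) \<le> ent M (\<lambda>x. (X x, ())) + ent M (\<lambda>x. (Y x, ()))"
    using X Y by (intro ent_strong_subadditive) auto
  moreover have "ent M (\<lambda>x. (X x, Y x)) \<le> ent M (\<lambda>x. (X x, Y x, ()))"
    using X Y by (intro ent_mono[where g="\<lambda>(a,b,c). (a,b)"] simple_function_Pair) auto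
  moreover have "ent M (\<lambda>x. (X x, ())) \<le> ent M X" "ent M (\<lambda>x. (Y x, ())) \<le> ent M Y"
    using X Y by (intro ent_mono[where g="\<lambda>a. (a,())"]; simp)+
  ultimately show ?thesis by linarith
qed

text \<open>The set \<open>P -` B q\<close> approximates the event \<open>Q = q\<close>; \<open>d\<close> bounds the error for each \<open>q\<close>.\<close>

lemma conditional_ent_le:
  assumes Q: "simple_function M Q" and P: "simple_function M P"
    and e: "0 < e" "e \<le> 1"
    and D: "\<And>q. q \<in> Q ` space M \<Longrightarrow>
      prob ((Q -` {q} \<inter> space M) - (P -` B q \<inter> space M)) + prob ((P -` B q \<inter> space M) - (Q -` {q} \<inter> space M)) \<le> d"
  shows "ent M (\<lambda>x. (Q x, P x)) - ent M P \<le> real (card (Q ` space M)) * (e + d / e)"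
proof -
  let ?W = "\<lambda>x. (Q x, P x)"
  have W: "simple_function M ?W" using Q P by (intro simple_function_Pair)
  have fin: "finite (Q ` space M)" "finite (P ` space M)" using Q P by (auto simp: simple_function_def)
  have e1: "ent M ?W = (\<Sum>w\<in>?W ` space M. - (pr ?W w * ln (pr ?W w)))" unfolding ent_def eta_def ..
  have e2: "ent M P = (\<Sum>w\<in>?W ` space M. - (pr ?W w * ln (pr P (snd w))))"
    using ent_comp[OF W, of snd] by simp
  \<comment> \<open>The contribution of the pair \<open>(q, a)\<close> to the conditional entropy of
    \<open>Q\<close> given \<open>P\<close>: the mass of the atom \<open>a\<close> times
    \<open>eta\<close> of the conditional probability of \<open>q\<close> on it.\<close>
  define F where "F = (\<lambda>(q,a). pr P a * eta (pr ?W (q,a) / pr P a))"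
  have le: "pr ?W (q,a) \<le> pr P a" for q a using pr_comp_ge[OF W, of "(q,a)" snd] by simp
  have F0: "F w \<ge> 0" for w unfolding F_def using le
    by (auto split: prod.split intro!: mult_nonneg_nonneg eta_nonneg simp: divide_le_eq_1 zero_less_measure_iff)
  have "ent M ?W - ent M P = (\<Sum>w\<in>?W ` space M. F w)"
    unfolding e1 e2 sum_subtractf[symmetric]
  proof (intro sum.cong refl)
    fix w assume "w \<in> ?W ` space M"
    then obtain q a where w: "w = (q,a)" by force
    show "- (pr ?W w * ln (pr ?W w)) - - (pr ?W w * ln (pr P (snd w))) = F w"
    proof (cases "pr ?W w = 0")
      case True then show ?thesis by (simp add: F_def w)
    next
      case False
      then have p: "pr ?W w > 0" by (simp add: zero_less_measure_iff)
      moreover then have "pr P a > 0" using le[of q a] w by simp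
      ultimately show ?thesis by (simp add: F_def w eta_def ln_div algebra_simps)
    qed
  qed
  also have "\<dots> \<le> (\<Sum>w\<in>Q ` space M \<times> P ` space M. F w)"
    using fin F0 by (intro sum_mono2) auto
  also have "\<dots> = (\<Sum>q\<in>Q ` space M. \<Sum>a\<in>P ` space M. F (q,a))"
    by (simp add: sum.cartesian_product)
  also have "\<dots> \<le> (\<Sum>q\<in>Q ` space M. e + d / e)"
  proof (intro sum_mono)
    fix q assume q: "q \<in> Q ` space M"
    let ?A = "Q -` {q} \<inter> space M" and ?R = "P -` B q \<inter> space M"
    let ?d = "\<lambda>a. prob ((?A - ?R) \<inter> (P -` {a} \<inter> space M)) + prob ((?R - ?A) \<inter> (P -` {a} \<inter> space M))"
    have ev[measurable]: "?A \<in> events" "?R \<in> events" "P -` {a} \<inter> space M \<in> events" for a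
      using simple_sets[OF Q, of "{q}"] simple_sets[OF P] by auto
    \<comment> \<open>On an atom inside the approximating set the conditional probability of
      \<open>q\<close> should be near 1, on the others near 0. In both cases the defect is the part
      of the symmetric difference that lies in this atom, so summing over atoms recovers the full
      error.\<close>
    have "F (q,a) \<le> e * pr P a + ?d a / e" for a
    proof (cases "pr P a = 0")
      case True then show ?thesis using e by (simp add: F_def)
    next
      case False
      then have p: "pr P a > 0" by (simp add: zero_less_measure_iff)
      define x where "x = pr ?W (q,a) / pr P a"
      have x: "0 \<le> x" "x \<le> 1" using le[of q a] p by (auto simp: x_def)
      have px: "pr P a * x = pr ?W (q,a)" using p by (simp add: x_def)
      show ?thesis
      proof (cases "a \<in> B q")
        case True
        have "(?A - ?R) \<inter> (P -` {a} \<inter> space M) = {}" using True by auto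
        moreover have "(?R - ?A) \<inter> (P -` {a} \<inter> space M) = (P -` {a} \<inter> space M) - (?W -` {(q,a)} \<inter> space M)" using True by auto
        moreover have "prob ((P -` {a} \<inter> space M) - (?W -` {(q,a)} \<inter> space M)) = pr P a - pr ?W (q,a)"
          using simple_sets[OF W, of "{(q,a)}"] by (intro finite_measure_Diff) auto
        ultimately have d: "?d a = pr P a - pr ?W (q,a)" by simp
        have "pr P a * eta x \<le> pr P a * (e + (1 - x) / e)"
          using p e x by (intro mult_left_mono eta_le_near_1) auto
        also have "\<dots> = e * pr P a + (pr P a - pr P a * x) / e" by (simp add: algebra_simps)
        finally show ?thesis unfolding d px by (simp add: F_def x_def)
      next
        case False
        have "(?A - ?R) \<inter> (P -` {a} \<inter> space M) = ?W -` {(q,a)} \<inter> space M" using False by auto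
        then have "pr ?W (q,a) \<le> ?d a" by simp
        then have d: "pr ?W (q,a) / e \<le> ?d a / e" using e by (intro divide_right_mono) auto
        have "pr P a * eta x \<le> pr P a * (e + x / e)"
          using p e x by (intro mult_left_mono eta_le_near_0) auto
        also have "\<dots> = e * pr P a + (pr P a * x) / e" by (simp add: algebra_simps)
        finally show ?thesis using d unfolding px by (simp add: F_def x_def)
      qed
    qed
    then have "(\<Sum>a\<in>P ` space M. F (q,a)) \<le> (\<Sum>a\<in>P ` space M. e * pr P a + ?d a / e)"
      by (intro sum_mono)
    also have "\<dots> = e * (\<Sum>a\<in>P ` space M. pr P a) + (\<Sum>a\<in>P ` space M. ?d a) / e"
      by (simp only: sum.distrib[of "\<lambda>a. e * pr P a" "\<lambda>a. ?d a / e"] sum_distrib_left sum_divide_distrib)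
    also have "(\<Sum>a\<in>P ` space M. ?d a) = prob (?A - ?R) + prob (?R - ?A)"
      unfolding sum.distrib using prob_sum_fibres[OF P, of "?A - ?R"] prob_sum_fibres[OF P, of "?R - ?A"] by simp
    also have "(\<Sum>a\<in>P ` space M. pr P a) = 1" by (rule sum_pr[OF P])
    finally have "(\<Sum>a\<in>P ` space M. F (q,a)) \<le> e + (prob (?A - ?R) + prob (?R - ?A)) / e" by simp
    also have "\<dots> \<le> e + d / e" using D[OF q] e by (intro add_left_mono divide_right_mono) auto
    finally show "(\<Sum>a\<in>P ` space M. F (q,a)) \<le> e + d / e" .
  qed
  finally show ?thesis by simp
qed

end

section \<open>Entropy of measure preserving maps\<close>

definition itin :: "('b \<Rightarrow> 'b) \<Rightarrow> ('b \<Rightarrow> 'c) \<Rightarrow> nat \<Rightarrow> 'b \<Rightarrow> 'c list" where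
  "itin T X n x = map (\<lambda>i. X ((T ^^ i) x)) [0..<n]"

definition ent_rate :: "'b measure \<Rightarrow> ('b \<Rightarrow> 'b) \<Rightarrow> ('b \<Rightarrow> 'c) \<Rightarrow> real" where
  "ent_rate M T X = lim (\<lambda>n. ent M (itin T X n) / real n)"

lemma itin_0 [simp]: "itin T X 0 = (\<lambda>x. [])" by (simp add: itin_def[abs_def])

lemma length_itin [simp]: "length (itin T X n x) = n" by (simp add: itin_def)

lemma itin_Suc: "itin T X (Suc n) x = itin T X n x @ [X ((T ^^ n) x)]"
  by (simp add: itin_def)

lemma itin_add: "itin T X (m + n) x = itin T X m x @ itin T X n ((T ^^ m) x)"
  by (induction n) (simp_all add: itin_Suc funpow_add add.commute flip: funpow_swap1)

lemma nth_itin: "i < n \<Longrightarrow> itin T X n x ! i = X ((T ^^ i) x)"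
  by (simp add: itin_def)

text \<open>The blocks of length \<open>k\<close> are the sliding windows of one longer itinerary,
  so passing to blocks adds only \<open>k\<close> further coordinates.\<close>

lemma itin_itin: "itin T (itin T X k) n x = map (\<lambda>i. take k (drop i (itin T X (n + k) x))) [0..<n]"
proof -
  have "(T ^^ a) ((T ^^ b) x) = (T ^^ b) ((T ^^ a) x)" for a b
    by (metis add.commute comp_apply funpow_add)
  then show ?thesis by (auto simp: list_eq_iff_nth_eq nth_itin funpow_add)
qed

locale measure_preserving = prob_space M for M :: "'b measure" +
  fixes T :: "'b \<Rightarrow> 'b"
  assumes T_measurable [measurable]: "T \<in> measurable M M"
    and T_invariant: "A \<in> sets M \<Longrightarrow> prob (T -` A \<inter> space M) = prob A"
begin

lemma Tn_measurable [measurable]: "T ^^ n \<in> measurable M M"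
  by (induction n) (simp_all add: measurable_comp[OF _ T_measurable])

lemma Tn_space: "x \<in> space M \<Longrightarrow> (T ^^ n) x \<in> space M"
  using measurable_space[OF Tn_measurable] .

lemma Tn_invariant: "A \<in> sets M \<Longrightarrow> prob ((T ^^ n) -` A \<inter> space M) = prob A"
proof (induction n arbitrary: A)
  case 0 then show ?case by (simp add: sets.Int_space_eq2)
next
  case (Suc n)
  have "(T ^^ Suc n) -` A \<inter> space M = (T ^^ n) -` (T -` A \<inter> space M) \<inter> space M"
    using Tn_space by auto
  then show ?case using Suc.IH[of "T -` A \<inter> space M"] Suc.prems T_invariant[OF Suc.prems]
    by (simp del: funpow.simps vimage_Int)
qed

lemma simple_shifted: "simple_function M X \<Longrightarrow> simple_function M (\<lambda>x. X ((T ^^ n) x))"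
  by (rule simple_function_comp[OF Tn_measurable])

lemma simple_itin: "simple_function M X \<Longrightarrow> simple_function M (itin T X n)"
proof (induction n)
  case 0 then show ?case by (simp add: itin_def[abs_def])
next
  case (Suc n)
  have "simple_function M (\<lambda>x. (\<lambda>a b. a @ [b]) (itin T X n x) (X ((T ^^ n) x)))"
    by (rule simple_function_compose2[OF Suc.IH[OF Suc.prems] simple_shifted[OF Suc.prems]])
  then show ?case by (simp add: itin_Suc[abs_def])
qed

lemma ent_shifted:
  assumes X: "simple_function M X"
  shows "ent M (\<lambda>x. X ((T ^^ n) x)) = ent M X"
proof -
  have eq: "pr (\<lambda>x. X ((T ^^ n) x)) v = pr X v" for v
  proof -
    have "(\<lambda>x. X ((T ^^ n) x)) -` {v} \<inter> space M = (T ^^ n) -` (X -` {v} \<inter> space M) \<inter> space M"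
      using Tn_space by auto
    then show ?thesis using Tn_invariant[OF simple_sets[OF X, of "{v}"]] by simp
  qed
  have "ent M (\<lambda>x. X ((T ^^ n) x)) = (\<Sum>v\<in>X ` space M. eta (pr X v))"
    unfolding ent_def eq
  proof (rule sum.mono_neutral_left)
    show "finite (X ` space M)" using X by (simp add: simple_function_def)
    \<comment> \<open>The transformation need not be onto, so the shifted variable may miss values
      of \<open>X\<close>. By invariance these have mass 0 and contribute nothing.\<close>
    show "\<forall>v\<in>X ` space M - (\<lambda>x. X ((T ^^ n) x)) ` space M. eta (pr X v) = 0"
    proof
      fix v assume "v \<in> X ` space M - (\<lambda>x. X ((T ^^ n) x)) ` space M"
      then have "(\<lambda>x. X ((T ^^ n) x)) -` {v} \<inter> space M = {}" by (force simp: image_iff)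
      then have "pr X v = 0" using eq[of v] by (metis measure_empty)
      then show "eta (pr X v) = 0" by simp
    qed
  qed (use Tn_space in auto)
  then show ?thesis by (simp add: ent_def)
qed

lemma ent_itin_add_le:
  assumes X: "simple_function M X"
  shows "ent M (itin T X (m + n)) \<le> ent M (itin T X m) + ent M (itin T X n)"
proof -
  let ?Y = "\<lambda>x. itin T X n ((T ^^ m) x)"
  have "ent M (itin T X (m + n)) \<le> ent M (\<lambda>x. (itin T X m x, ?Y x))"
    using simple_itin[OF X] simple_shifted[OF simple_itin[OF X]]
    by (intro ent_mono[where g="\<lambda>(a,b). a @ b"] simple_function_Pair) (auto simp: itin_add)
  also have "\<dots> \<le> ent M (itin T X m) + ent M ?Y"
    using simple_itin[OF X] simple_shifted[OF simple_itin[OF X]] by (intro ent_subadditive)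
  finally show ?thesis using ent_shifted[OF simple_itin[OF X]] by simp
qed

text \<open>Entropies of itineraries are subadditive by invariance, so Fekete's lemma applies. The
  bound at every finite \<open>n\<close> is needed as much as the limit: it turns a nearly maximal
  entropy rate into a lower bound for the entropy at one given length.\<close>

lemma
  assumes X: "simple_function M X"
  shows ent_rate_LIMSEQ: "(\<lambda>n. ent M (itin T X n) / real n) \<longlonglongrightarrow> ent_rate M T X"
    and ent_rate_le: "real n * ent_rate M T X \<le> ent M (itin T X n)"
proof -
  obtain L where L: "(\<lambda>n. ent M (itin T X n) / real n) \<longlonglongrightarrow> L" "\<And>n. real n * L \<le> ent M (itin T X n)"
    by (rule fekete[of "\<lambda>n. ent M (itin T X n)" 0]) (use ent_itin_add_le[OF X] ent_nonneg in auto)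
  then have "ent_rate M T X = L" unfolding ent_rate_def by (simp add: limI)
  then show "(\<lambda>n. ent M (itin T X n) / real n) \<longlonglongrightarrow> ent_rate M T X" "real n * ent_rate M T X \<le> ent M (itin T X n)"
    using L by auto
qed

text \<open>A chain rule: each new coordinate of \<open>Q\<close> costs at most its conditional
  entropy given the coordinate of \<open>P\<close> at the same time, since conditioning on the other
  coordinates of \<open>P\<close> can only lower it.\<close>

lemma ent_itin_Pair_le:
  assumes Q: "simple_function M Q" and P: "simple_function M P"
  shows "ent M (\<lambda>x. (itin T Q n x, itin T P n x)) \<le> ent M (itin T P n) + real n * (ent M (\<lambda>x. (Q x, P x)) - ent M P)"
proof (induction n)
  case 0
  have "ent M (\<lambda>x. (itin T Q 0 x, itin T P 0 x)) \<le> ent M (itin T P 0)"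
    using simple_itin[OF P] by (intro ent_mono[where g="\<lambda>a. ([], a)"]) auto
  then show ?case by simp
next
  case (Suc n)
  let ?U = "itin T Q n" and ?V = "itin T P n" and ?q = "\<lambda>x. Q ((T ^^ n) x)" and ?p = "\<lambda>x. P ((T ^^ n) x)"
  note s = simple_itin[OF Q, of n] simple_itin[OF P, of n] simple_shifted[OF Q, of n] simple_shifted[OF P, of n]
  note pair = simple_function_Pair
  have "ent M (\<lambda>x. (itin T Q (Suc n) x, itin T P (Suc n) x)) \<le> ent M (\<lambda>x. (?U x, ?q x, ?V x, ?p x))"
    using s by (intro ent_mono[where g="\<lambda>(u,q,v,p). (u @ [q], v @ [p])"] pair) (auto simp: itin_Suc)
  \<comment> \<open>Strong subadditivity is used three times. This use separates the old and new
    \<open>Q\<close>-coordinates given all \<open>P\<close>-coordinates; the next one drops the new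
    \<open>P\<close>-coordinate from the conditioning of the old part; the last one drops the old
    \<open>P\<close>-coordinates from the conditioning of the new part.\<close>
  moreover have "ent M (\<lambda>x. (?U x, ?q x, ?V x, ?p x)) + ent M (\<lambda>x. (?V x, ?p x)) \<le>
      ent M (\<lambda>x. (?U x, ?V x, ?p x)) + ent M (\<lambda>x. (?q x, ?V x, ?p x))"
    using s by (intro ent_strong_subadditive pair)
  moreover have "ent M (\<lambda>x. (?U x, ?V x, ?p x)) \<le> ent M (\<lambda>x. (?U x, ?p x, ?V x))"
    using s by (intro ent_mono[where g="\<lambda>(a,b,c). (a,c,b)"] pair) auto
  moreover have "ent M (\<lambda>x. (?U x, ?p x, ?V x)) + ent M ?V \<le> ent M (\<lambda>x. (?U x, ?V x)) + ent M (\<lambda>x. (?p x, ?V x))"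
    using s by (intro ent_strong_subadditive)
  moreover have "ent M (\<lambda>x. (?p x, ?V x)) \<le> ent M (\<lambda>x. (itin T P (Suc n) x))"
    by (rule ent_mono[where g="\<lambda>l. (last l, butlast l)", OF simple_itin[OF P]]) (auto simp: itin_Suc)
  moreover have "ent M (\<lambda>x. (?q x, ?V x, ?p x)) + ent M ?p \<le> ent M (\<lambda>x. (?q x, ?p x)) + ent M (\<lambda>x. (?V x, ?p x))"
    using s by (intro ent_strong_subadditive)
  moreover have "ent M (\<lambda>x. (?q x, ?p x)) = ent M (\<lambda>x. (Q x, P x))"
    using ent_shifted[OF pair[OF Q P], of n] by simp
  moreover have "ent M ?p = ent M P" by (rule ent_shifted[OF P])
  ultimately have "ent M (\<lambda>x. (itin T Q (Suc n) x, itin T P (Suc n) x)) \<le>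
     ent M (\<lambda>x. (?U x, ?V x)) - ent M ?V + ent M (itin T P (Suc n)) + (ent M (\<lambda>x. (Q x, P x)) - ent M P)"
    by linarith
  then show ?case using Suc by (simp add: algebra_simps)
qed

text \<open>Continuity of the entropy rate in the partition. A finite partition that is nearly
  determined by another one has no essentially larger rate, which reduces all finite partitions to a
  generating family.\<close>

lemma ent_rate_le_conditional:
  assumes Q: "simple_function M Q" and P: "simple_function M P"
  shows "ent_rate M T Q \<le> ent_rate M T P + (ent M (\<lambda>x. (Q x, P x)) - ent M P)"
proof (rule LIMSEQ_le[OF ent_rate_LIMSEQ[OF Q]])
  show "(\<lambda>n. ent M (itin T P n) / real n + (ent M (\<lambda>x. (Q x, P x)) - ent M P)) \<longlonglongrightarrow>
      ent_rate M T P + (ent M (\<lambda>x. (Q x, P x)) - ent M P)"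
    by (intro tendsto_add ent_rate_LIMSEQ[OF P] tendsto_const)
  have "ent M (itin T Q n) / real n \<le> ent M (itin T P n) / real n + (ent M (\<lambda>x. (Q x, P x)) - ent M P)" if "n \<ge> 1" for n
  proof -
    have "ent M (itin T Q n) \<le> ent M (\<lambda>x. (itin T Q n x, itin T P n x))"
      using simple_itin[OF Q] simple_itin[OF P] by (intro ent_mono[where g=fst] simple_function_Pair) auto
    then have "ent M (itin T Q n) \<le> ent M (itin T P n) + real n * (ent M (\<lambda>x. (Q x, P x)) - ent M P)"
      using ent_itin_Pair_le[OF Q P, of n] by linarith
    then show ?thesis using that by (simp add: field_simps)
  qed
  then show "\<exists>N. \<forall>n\<ge>N. ent M (itin T Q n) / real n \<le> ent M (itin T P n) / real n + (ent M (\<lambda>x. (Q x, P x)) - ent M P)"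
    by blast
qed

text \<open>Windows of length \<open>k\<close> along \<open>n\<close> steps see \<open>n + k\<close>
  coordinates; the surplus entropy is bounded independently of \<open>n\<close> and disappears after
  division by \<open>n\<close>.\<close>

lemma ent_rate_itin_le:
  assumes P: "simple_function M P"
  shows "ent_rate M T (itin T P k) \<le> ent_rate M T P"
proof (rule LIMSEQ_le[OF ent_rate_LIMSEQ[OF simple_itin[OF P]]])
  show "(\<lambda>n. ent M (itin T P n) / real n + ent M (itin T P k) / real n) \<longlonglongrightarrow> ent_rate M T P"
    using tendsto_add[OF ent_rate_LIMSEQ[OF P] lim_const_over_n] by simp
  have "ent M (itin T (itin T P k) n) / real n \<le> ent M (itin T P n) / real n + ent M (itin T P k) / real n" for n
  proof -
    have "ent M (itin T (itin T P k) n) \<le> ent M (itin T P (n + k))"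
      using simple_itin[OF P]
      by (intro ent_mono[where g="\<lambda>l. map (\<lambda>i. take k (drop i l)) [0..<n]"]) (auto simp: itin_itin)
    also have "\<dots> \<le> ent M (itin T P n) + ent M (itin T P k)" by (rule ent_itin_add_le[OF P])
    finally show ?thesis by (simp add: add_divide_distrib[symmetric] divide_right_mono)
  qed
  then show "\<exists>N. \<forall>n\<ge>N. ent M (itin T (itin T P k) n) / real n \<le> ent M (itin T P n) / real n + ent M (itin T P k) / real n"
    by blast
qed

end

subsection \<open>Finite partitions as finite-valued random variables\<close>

lemma partition_entropy_fibres:
  assumes "finite \<Q>" and "\<Q> - {{}} = {{y \<in> space M. X y = X x} | x. x \<in> space M}"
  shows "partition_entropy M \<Q> = ent M X"
proof -
  have "partition_entropy M \<Q> = (\<Sum>A\<in>\<Q> - {{}}. eta (measure M A))"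
    unfolding partition_entropy_def eta_def sum_negf[symmetric]
    using assms(1) by (intro sum.mono_neutral_right) auto
  also have "\<Q> - {{}} = (\<lambda>v. X -` {v} \<inter> space M) ` (X ` space M)"
    unfolding assms(2) by auto
  also have "(\<Sum>A\<in>(\<lambda>v. X -` {v} \<inter> space M) ` (X ` space M). eta (measure M A)) = ent M X"
    unfolding ent_def by (subst sum.reindex) (auto simp: inj_on_def)
  finally show ?thesis .
qed

text \<open>Level sets of an itinerary are never empty, whereas intersections in the join may be.
  Removing \<open>{}\<close> makes the two families equal, and it changes no entropy.\<close>

lemma refined_partition_fibres:
  assumes T: "\<And>x. x \<in> space M \<Longrightarrow> T x \<in> space M"
    and P: "finite P" "P = {{y \<in> space M. X y = X x} | x. x \<in> space M}"
  shows "finite (refined_partition M T P n) \<and>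
    refined_partition M T P n - {{}} = {{y \<in> space M. itin T X n y = itin T X n x} | x. x \<in> space M}"
proof (induction n)
  case 0 then show ?case by auto
next
  case (Suc n)
  let ?R = "refined_partition M T P n"
  have Tn: "x \<in> space M \<Longrightarrow> (T ^^ n) x \<in> space M" for x
    by (induction n) (auto intro: T)
  have eq: "refined_partition M T P (Suc n) = (\<lambda>(A,B). A \<inter> ((T ^^ n) -` B \<inter> space M)) ` (?R \<times> P)" by auto
  have "finite (refined_partition M T P (Suc n))" unfolding eq using Suc P by auto
  moreover have "refined_partition M T P (Suc n) - {{}} = {{y \<in> space M. itin T X (Suc n) y = itin T X (Suc n) x} | x. x \<in> space M}"
  proof (intro set_eqI iffI)
    fix C assume "C \<in> refined_partition M T P (Suc n) - {{}}"
    then obtain A B z where AB: "A \<in> ?R" "B \<in> P" "C = A \<inter> ((T ^^ n) -` B \<inter> space M)" "z \<in> C" by auto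
    then have "A \<in> ?R - {{}}" by auto
    then obtain x where x: "A = {y \<in> space M. itin T X n y = itin T X n x}" using Suc by auto
    obtain b where b: "B = {y \<in> space M. X y = X b}" using AB P by auto
    have z: "z \<in> space M" "itin T X n z = itin T X n x" "X ((T ^^ n) z) = X b" using AB x b by auto
    have "C = {y \<in> space M. itin T X (Suc n) y = itin T X (Suc n) z}"
      using z Tn unfolding AB x b by (auto simp: itin_Suc)
    then show "C \<in> {{y \<in> space M. itin T X (Suc n) y = itin T X (Suc n) x} | x. x \<in> space M}" using z by auto
  next
    fix C assume "C \<in> {{y \<in> space M. itin T X (Suc n) y = itin T X (Suc n) x} | x. x \<in> space M}"
    then obtain x where x: "x \<in> space M" "C = {y \<in> space M. itin T X (Suc n) y = itin T X (Suc n) x}" by auto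
    define A where "A = {y \<in> space M. itin T X n y = itin T X n x}"
    define B where "B = {y \<in> space M. X y = X ((T ^^ n) x)}"
    have "A \<in> ?R - {{}}" using Suc x A_def by auto
    moreover have "B \<in> P" using P Tn x B_def by auto
    moreover have "C = A \<inter> ((T ^^ n) -` B \<inter> space M)" using Tn unfolding A_def B_def x by (auto simp: itin_Suc)
    moreover have "x \<in> C" using x by auto
    ultimately show "C \<in> refined_partition M T P (Suc n) - {{}}" by auto
  qed
  ultimately show ?case by simp
qed

context measure_preserving
begin

lemma lim_partition_entropy:
  assumes "finite P" "P = {{y \<in> space M. X y = X x} | x. x \<in> space M}"
  shows "lim (\<lambda>n. partition_entropy M (refined_partition M T P n) / real n) = ent_rate M T X"
proof -
  have "partition_entropy M (refined_partition M T P n) = ent M (itin T X n)" for n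
    using refined_partition_fibres[where n=n, OF measurable_space[OF T_measurable] assms]
    by (intro partition_entropy_fibres) auto
  then show ?thesis by (simp add: ent_rate_def)
qed

lemma ks_entropy_ge:
  assumes X: "simple_function M X"
  shows "ereal (ent_rate M T X) \<le> ks_entropy M T"
proof -
  define P where "P = {{y \<in> space M. X y = X x} | x. x \<in> space M}"
  have P': "P = (\<lambda>v. X -` {v} \<inter> space M) ` (X ` space M)" unfolding P_def by auto
  have fin: "finite P" unfolding P' using X by (simp add: simple_function_def)
  have "P \<subseteq> sets M" unfolding P' using simple_sets[OF X] by auto
  moreover have "partition_on (space M) P" unfolding P_def by (rule partition_onI) (auto simp: disjnt_iff)
  ultimately have "ereal (lim (\<lambda>n. partition_entropy M (refined_partition M T P n) / real n)) \<le> ks_entropy M T"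
    unfolding ks_entropy_def using fin by (intro SUP_upper) auto
  then show ?thesis using lim_partition_entropy[OF fin P_def] by simp
qed

text \<open>A finite partition is the family of level sets of the map sending a point to its atom.
  Variables with values in \<open>'b set\<close> therefore cover all partitions, which fixes the
  type in the hypothesis.\<close>

lemma ks_entropy_le:
  assumes "\<And>X :: 'b \<Rightarrow> 'b set. simple_function M X \<Longrightarrow> ereal (ent_rate M T X) \<le> c"
  shows "ks_entropy M T \<le> c"
  unfolding ks_entropy_def
proof (intro SUP_least)
  fix P assume "P \<in> {P. finite P \<and> P \<subseteq> sets M \<and> partition_on (space M) P}"
  then have P: "finite P" "P \<subseteq> sets M" "partition_on (space M) P" by auto
  define X where "X x = (THE A. A \<in> P \<and> x \<in> A)" for x
  have X: "X x = A" if "A \<in> P" "x \<in> A" for x A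
    unfolding X_def using that P(3) by (intro the_equality) (auto simp: partition_on_def disjoint_def)
  have un: "\<Union>P = space M" "{} \<notin> P" using P(3) by (auto simp: partition_on_def)
  have ex: "\<exists>A\<in>P. x \<in> A" if "x \<in> space M" for x using that un by auto
  have fib: "{y \<in> space M. X y = A} = A" if "A \<in> P" for A
  proof (intro set_eqI iffI)
    fix y assume "y \<in> {y \<in> space M. X y = A}"
    then have y: "y \<in> space M" "X y = A" by auto
    obtain B where "B \<in> P" "y \<in> B" using ex[OF y(1)] by blast
    then show "y \<in> A" using X[of B y] y by simp
  next
    fix y assume "y \<in> A"
    then show "y \<in> {y \<in> space M. X y = A}" using X[OF that] that un by auto
  qed
  have PX: "P = {{y \<in> space M. X y = X x} | x. x \<in> space M}"
  proof (intro set_eqI iffI)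
    fix A assume A: "A \<in> P"
    then obtain x where "x \<in> A" using un by fastforce
    then have "X x = A" "x \<in> space M" using X[OF A] A un by auto
    then show "A \<in> {{y \<in> space M. X y = X x} | x. x \<in> space M}" using fib[OF A]
      by (intro CollectI exI[of _ x]) simp
  next
    fix A assume "A \<in> {{y \<in> space M. X y = X x} | x. x \<in> space M}"
    then obtain x where x: "x \<in> space M" "A = {y \<in> space M. X y = X x}" by auto
    obtain B where "B \<in> P" "x \<in> B" using ex[OF x(1)] by blast
    then have "X x \<in> P" using X[of B x] by simp
    then show "A \<in> P" using trans[OF x(2) fib] by simp
  qed
  have "simple_function M X" unfolding simple_function_def
  proof
    have img: "X ` space M \<subseteq> P" using ex X by fastforce
    then show "finite (X ` space M)" using P(1) finite_subset by blast
    show "\<forall>v\<in>X ` space M. X -` {v} \<inter> space M \<in> sets M"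
    proof
      fix v assume "v \<in> X ` space M"
      then have "v \<in> P" using img by auto
      moreover have "X -` {v} \<inter> space M = {y \<in> space M. X y = v}" by auto
      ultimately show "X -` {v} \<inter> space M \<in> sets M" using fib P(2) by auto
    qed
  qed
  then show "ereal (lim (\<lambda>n. partition_entropy M (refined_partition M T P n) / real n)) \<le> c"
    using assms lim_partition_entropy[OF P(1) PX] by simp
qed

end

section \<open>Sums over words\<close>

lemma nn_integral_count_space_Times:
  "(\<integral>\<^sup>+x. \<integral>\<^sup>+y. f (x, y) \<partial>count_space B \<partial>count_space A) = (\<integral>\<^sup>+z. f z \<partial>count_space (A \<times> B))"
proof -
  have "(\<integral>\<^sup>+z. f z \<partial>count_space (A \<times> B)) = (\<integral>\<^sup>+z. f z * indicator (A \<times> B) z \<partial>count_space UNIV)"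
    by (rule nn_integral_count_space_indicator) simp
  also have "\<dots> = (\<integral>\<^sup>+x. \<integral>\<^sup>+y. f (x, y) * indicator (A \<times> B) (x, y) \<partial>count_space UNIV \<partial>count_space UNIV)"
    by (rule nn_integral_fst_count_space[symmetric])
  also have "\<dots> = (\<integral>\<^sup>+x. (\<integral>\<^sup>+y. f (x, y) * indicator B y \<partial>count_space UNIV) * indicator A x \<partial>count_space UNIV)"
    by (intro nn_integral_cong, subst nn_integral_multc[symmetric])
      (auto simp: indicator_times mult_ac)
  also have "\<dots> = (\<integral>\<^sup>+x. \<integral>\<^sup>+y. f (x, y) \<partial>count_space B \<partial>count_space A)"
    by (simp add: nn_integral_count_space_indicator)
  finally show ?thesis ..
qed

text \<open>Both sides are the supremum of finite partial sums. The bridge makes exchange of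
  summation and dominated convergence available for the sums occurring in the definitions.\<close>

lemma infsum_eq_nn_integral:
  fixes f :: "'b \<Rightarrow> ennreal"
  assumes "countable A"
  shows "(\<Sum>\<^sub>\<infinity>x\<in>A. f x) = (\<integral>\<^sup>+x. f x \<partial>count_space A)"
proof (cases "finite A")
  case True
  then show ?thesis by (simp add: nn_integral_count_space_finite)
next
  case False
  let ?e = "from_nat_into A"
  have e: "bij_betw ?e UNIV A" using assms False by (rule bij_betw_from_nat_into)
  have sup: "(\<Sum>\<^sub>\<infinity>x\<in>A. f x) = (SUP F\<in>{F. finite F \<and> F \<subseteq> A}. sum f F)"
    by (rule nonneg_infsum_complete) auto
  have "(\<integral>\<^sup>+x. f x \<partial>count_space A) = (\<Sum>i. f (?e i))"
    using nn_integral_bij_count_space[OF e, of f] by (simp add: nn_integral_count_space_nat)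
  also have "\<dots> = (SUP n. \<Sum>i<n. f (?e i))" by (rule suminf_eq_SUP)
  also have "\<dots> \<le> (SUP F\<in>{F. finite F \<and> F \<subseteq> A}. sum f F)"
  proof (rule SUP_least)
    fix n
    have "(\<Sum>i<n. f (?e i)) = sum f (?e ` {..<n})"
      using e by (subst sum.reindex) (auto simp: bij_betw_def intro: inj_on_subset)
    also have "\<dots> \<le> (SUP F\<in>{F. finite F \<and> F \<subseteq> A}. sum f F)"
      using e by (intro SUP_upper) (auto simp: bij_betw_def)
    finally show "(\<Sum>i<n. f (?e i)) \<le> (SUP F\<in>{F. finite F \<and> F \<subseteq> A}. sum f F)" .
  qed
  finally have le: "(\<integral>\<^sup>+x. f x \<partial>count_space A) \<le> (SUP F\<in>{F. finite F \<and> F \<subseteq> A}. sum f F)" .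
  have "sum f F \<le> (\<integral>\<^sup>+x. f x \<partial>count_space A)" if "finite F" "F \<subseteq> A" for F
  proof -
    have "sum f F = (\<integral>\<^sup>+x. f x * indicator F x \<partial>count_space UNIV)"
      using that by (simp add: nn_integral_count_space_finite nn_integral_count_space_indicator[symmetric])
    also have "\<dots> \<le> (\<integral>\<^sup>+x. f x * indicator A x \<partial>count_space UNIV)"
      using that by (intro nn_integral_mono mult_left_mono) (auto split: split_indicator)
    finally show ?thesis by (simp add: nn_integral_count_space_indicator)
  qed
  then have "(SUP F\<in>{F. finite F \<and> F \<subseteq> A}. sum f F) \<le> (\<integral>\<^sup>+x. f x \<partial>count_space A)"
    by (intro SUP_least) auto
  with le show ?thesis unfolding sup by (rule antisym[rotated])
qed

lemma nn_integral_count_space_inj_le: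
  assumes "inj_on g A" "g ` A \<subseteq> B"
  shows "(\<integral>\<^sup>+x. f (g x) \<partial>count_space A) \<le> (\<integral>\<^sup>+y. f y \<partial>count_space B)"
proof -
  have "(\<integral>\<^sup>+x. f (g x) \<partial>count_space A) = (\<integral>\<^sup>+y. f y \<partial>count_space (g ` A))"
    using assms by (intro nn_integral_bij_count_space inj_on_imp_bij_betw)
  also have "\<dots> \<le> (\<integral>\<^sup>+y. f y \<partial>count_space B)"
  proof -
    have "indicator (g ` A) y \<le> (indicator B y :: ennreal)" for y
      using assms(2) by (auto split: split_indicator)
    then show ?thesis by (simp add: nn_integral_count_space_indicator nn_integral_mono mult_left_mono)
  qed
  finally show ?thesis .
qed

abbreviation lists_of_length :: "nat \<Rightarrow> 'a list set" where
  "lists_of_length n \<equiv> {w. length w = n}"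

lemma nn_integral_lists_add:
  "(\<integral>\<^sup>+w. f w \<partial>count_space (lists_of_length (m + n))) =
    (\<integral>\<^sup>+u. \<integral>\<^sup>+v. f (u @ v) \<partial>count_space (lists_of_length n) \<partial>count_space (lists_of_length m))"
proof -
  have "bij_betw (\<lambda>(u, v). u @ v) (lists_of_length m \<times> lists_of_length n) (lists_of_length (m + n))"
  proof (rule bij_betwI[where g="\<lambda>w. (take m w, drop m w)"])
  qed auto
  from nn_integral_bij_count_space[OF this, of f]
    nn_integral_count_space_Times[where f="\<lambda>(u, v). f (u @ v)" and A="lists_of_length m" and B="lists_of_length n"]
  show ?thesis by (simp add: case_prod_beta')
qed

section \<open>The Markov shift\<close>

abbreviation shift_pow :: "nat \<Rightarrow> (nat \<Rightarrow> 'a) \<Rightarrow> nat \<Rightarrow> 'a" where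
  "shift_pow n \<equiv> left_shift ^^ n"

abbreviation prefix_of :: "nat \<Rightarrow> (nat \<Rightarrow> 'a) \<Rightarrow> 'a list" where
  "prefix_of n x \<equiv> map x [0..<n]"

lemma shift_pow_apply: "shift_pow n x i = x (n + i)"
  by (induction n arbitrary: i) (auto simp: left_shift_def)

lemma shift_pow_shift_pow: "shift_pow m (shift_pow n x) = shift_pow (n + m) x"
  by (auto simp: fun_eq_iff shift_pow_apply add.assoc)

lemma shift_pow_in: "x \<in> markov_shift t \<Longrightarrow> shift_pow n x \<in> markov_shift t"
  by (auto simp: markov_shift_def shift_pow_apply)

lemma cylinder_subset: "cylinder t w \<subseteq> markov_shift t"
  by (auto simp: cylinder_def)

lemma cylinder_Nil: "cylinder t [] = markov_shift t"
  by (auto simp: cylinder_def)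

lemma cylinder_eq: "cylinder t w = {x \<in> markov_shift t. prefix_of (length w) x = w}"
proof -
  have "prefix_of (length w) x = w \<longleftrightarrow> (\<forall>i<length w. x i = w ! i)" for x
    unfolding list_eq_iff_nth_eq by simp
  then show ?thesis unfolding cylinder_def by simp
qed

lemma in_cylinder_prefix: "x \<in> markov_shift t \<Longrightarrow> x \<in> cylinder t (prefix_of n x)"
  by (auto simp: cylinder_def)

lemma cylinder_append:
  "cylinder t (u @ v) = {x \<in> cylinder t u. shift_pow (length u) x \<in> cylinder t v}"
proof (intro set_eqI iffI)
  fix x assume x: "x \<in> cylinder t (u @ v)"
  have "x i = u ! i" if "i < length u" for i
    using x that by (auto simp: cylinder_def nth_append)
  moreover have "x (length u + i) = v ! i" if "i < length v" for i
    using x that unfolding cylinder_def by (auto dest!: spec[of _ "length u + i"])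
  ultimately show "x \<in> {x \<in> cylinder t u. shift_pow (length u) x \<in> cylinder t v}"
    using x by (auto simp: cylinder_def shift_pow_apply shift_pow_in)
next
  fix x assume x: "x \<in> {x \<in> cylinder t u. shift_pow (length u) x \<in> cylinder t v}"
  have "x i = (u @ v) ! i" if "i < length u + length v" for i
  proof (cases "i < length u")
    case False
    then have "i - length u < length v" using that by auto
    then have "shift_pow (length u) x (i - length u) = v ! (i - length u)"
      using x by (auto simp: cylinder_def)
    then show ?thesis using False by (simp add: shift_pow_apply nth_append)
  qed (use x in \<open>auto simp: cylinder_def nth_append\<close>)
  then show "x \<in> cylinder t (u @ v)" using x by (auto simp: cylinder_def)
qed

lemma birkhoff_sum_add:
  "birkhoff_sum \<phi> (m + n) x = birkhoff_sum \<phi> m x + birkhoff_sum \<phi> n (shift_pow m x)"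
proof -
  have "(\<Sum>i<m + n. f i) = (\<Sum>i<m. f i) + (\<Sum>i<n. f (m + i))" for f :: "nat \<Rightarrow> real"
    by (induction n) (simp_all add: add.assoc)
  from this[of "\<lambda>i. \<phi> (shift_pow i x)"] show ?thesis
    by (simp only: birkhoff_sum_def shift_pow_shift_pow)
qed

lemma admissible_prefix: "x \<in> markov_shift t \<Longrightarrow> n > 0 \<Longrightarrow> admissible t (prefix_of n x)"
  by (auto simp: admissible_def markov_shift_def)

lemma admissible_cylinder: "x \<in> cylinder t w \<Longrightarrow> w \<noteq> [] \<Longrightarrow> admissible t w"
  using admissible_prefix[of x t "length w"] by (auto simp: cylinder_eq)

lemma admissible_appendD:
  assumes "admissible t (u @ v)"
  shows "u \<noteq> [] \<Longrightarrow> admissible t u" "v \<noteq> [] \<Longrightarrow> admissible t v"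
proof -
  have *: "t ((u @ v) ! i) ((u @ v) ! Suc i)" if "Suc i < length u + length v" for i
    using assms that by (auto simp: admissible_def)
  show "admissible t u" if "u \<noteq> []"
    unfolding admissible_def
  proof (intro conjI allI impI)
    fix i assume "Suc i < length u"
    then show "t (u ! i) (u ! Suc i)" using *[of i] by (simp add: nth_append)
  qed fact
  show "admissible t v" if "v \<noteq> []"
    unfolding admissible_def
  proof (intro conjI allI impI)
    fix i assume "Suc i < length v"
    then show "t (v ! i) (v ! Suc i)" using *[of "length u + i"] by (simp add: nth_append)
  qed fact
qed

lemma ex_extension:
  assumes t: "transition_matrix t" and w: "admissible t w"
  shows "\<exists>x. x \<in> cylinder t w"
proof -
  obtain s where s: "\<And>i. t i (s i)" using t unfolding transition_matrix_def by metis
  \<comment> \<open>Continuation of \<open>w\<close> by a choice of successors; the exponent makes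
    position \<open>length w\<close> the first successor of the last letter.\<close>
  define x where "x i = (if i < length w then w ! i else (s ^^ (Suc i - length w)) (last w))" for i
  have w0: "w \<noteq> []" using w by (auto simp: admissible_def)
  have "t (x i) (x (Suc i))" for i
  proof -
    consider "Suc i < length w" | "Suc i = length w" | "i \<ge> length w" by linarith
    then show ?thesis
    proof cases
      case 1 then show ?thesis using w by (auto simp: x_def admissible_def)
    next
      case 2
      then have "i = length w - 1" by simp
      then have "x i = last w" "x (Suc i) = s (last w)" using w0 2
        by (auto simp: x_def last_conv_nth)
      then show ?thesis using s by simp
    next
      case 3
      then have "x (Suc i) = s (x i)" by (auto simp: x_def Suc_diff_le)
      then show ?thesis using s by simp
    qed
  qed
  then have "x \<in> cylinder t w" by (auto simp: cylinder_def markov_shift_def x_def)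
  then show ?thesis by blast
qed

locale markov_potential =
  fixes t :: "'a::{countable, discrete_topology} \<Rightarrow> 'a \<Rightarrow> bool"
    and \<phi> :: "(nat \<Rightarrow> 'a) \<Rightarrow> real"
  assumes transition: "transition_matrix t"
    and primitive: "finitely_primitive t"
    and summable: "summable_potential t \<phi>"
    and variations: "summable_variations t \<phi>"
    and beta: "beta_infinity t \<phi> < 1"
begin

abbreviation "X \<equiv> markov_shift t"
abbreviation "cyl \<equiv> cylinder t"
abbreviation "S \<equiv> birkhoff_sum \<phi>"

lemma cyl_ne: "cyl w \<noteq> {} \<longleftrightarrow> w = [] \<or> admissible t w"
proof
  show "w = [] \<or> admissible t w" if "cyl w \<noteq> {}" using that admissible_cylinder by fastforce
next
  \<comment> \<open>Any single letter is an admissible word, which makes the shift space nonempty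
    and settles the case of the empty word.\<close>
  have "admissible t [undefined]" by (simp add: admissible_def)
  then have "X \<noteq> {}" using ex_extension[OF transition] cylinder_subset by blast
  then show "cyl w \<noteq> {}" if "w = [] \<or> admissible t w"
    using that ex_extension[OF transition] by (auto simp: cylinder_Nil)
qed

lemma X_ne: "X \<noteq> {}" using cyl_ne[of "[]"] by (simp add: cylinder_Nil)

section \<open>Bounded distortion and weights of cylinders\<close>

definition var :: "nat \<Rightarrow> ennreal" where
  "var n = (SUP w\<in>words t (Suc n). SUP x\<in>cyl w. SUP y\<in>cyl w. ennreal (\<phi> x - \<phi> y))"

text \<open>The total variation of the potential over all depths; it bounds the oscillation of
  Birkhoff sums on cylinders of the matching length, uniformly in that length.\<close>

definition K :: real where "K = enn2real (\<Sum>n. var n)"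

lemma sum_var: "(\<Sum>n. var n) < \<infinity>"
  using variations unfolding summable_variations_def var_def .

lemma K_eq: "ennreal K = (\<Sum>n. var n)" unfolding K_def using sum_var by (intro ennreal_enn2real) simp

lemma K_nonneg: "0 \<le> K" unfolding K_def by simp

lemma var_bound:
  assumes "x \<in> cyl w" "y \<in> cyl w" "length w = Suc n"
  shows "ennreal (\<phi> x - \<phi> y) \<le> var n"
proof -
  have "w \<in> words t (Suc n)" using assms admissible_cylinder[of x t w] by (cases w) (auto simp: words_def)
  then show ?thesis unfolding var_def using assms by (intro SUP_upper2[of w] SUP_upper2[of x] SUP_upper2[of y]) auto
qed

text \<open>After \<open>i\<close> shifts the two points still share \<open>length w - i\<close>
  letters, so the \<open>i\<close>-th terms differ by at most \<open>var (length w - Suc i)\<close>;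
  the index drops by one because \<open>var n\<close> refers to words of length
  \<open>Suc n\<close>. Reversing the order of summation leaves a partial sum of
  \<open>K\<close>.\<close>

lemma distortion:
  assumes x: "x \<in> cyl w" "y \<in> cyl w"
  shows "S (length w) x - S (length w) y \<le> K"
proof -
  let ?n = "length w"
  have *: "ennreal (\<phi> (shift_pow i x) - \<phi> (shift_pow i y)) \<le> var (?n - Suc i)" if i: "i < ?n" for i
  proof (rule var_bound[of _ "drop i w"])
    have "w = take i w @ drop i w" by simp
    then have "x \<in> cyl (take i w @ drop i w)" "y \<in> cyl (take i w @ drop i w)" using x by auto
    then show "shift_pow i x \<in> cyl (drop i w)" "shift_pow i y \<in> cyl (drop i w)"
      using i by (auto simp: cylinder_append simp del: append_take_drop_id)
  qed (use i in auto)
  have "ennreal (S ?n x - S ?n y) \<le> ennreal (\<Sum>i<?n. max 0 (\<phi> (shift_pow i x) - \<phi> (shift_pow i y)))"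
    unfolding birkhoff_sum_def sum_subtractf[symmetric] by (intro ennreal_leI sum_mono) auto
  also have "\<dots> = (\<Sum>i<?n. ennreal (max 0 (\<phi> (shift_pow i x) - \<phi> (shift_pow i y))))"
    by (intro sum_ennreal[symmetric]) auto
  also have "\<dots> \<le> (\<Sum>i<?n. var (?n - Suc i))"
    using * by (intro sum_mono) (auto simp: max_def ennreal_neg)
  also have "\<dots> = (\<Sum>i<?n. var i)" by (rule sum.nat_diff_reindex)
  also have "\<dots> \<le> (\<Sum>i. var i)" by (rule sum_le_suminf) auto
  also have "\<dots> = ennreal K" by (simp add: K_eq)
  finally show ?thesis using K_nonneg by (simp add: ennreal_le_iff)
qed

text \<open>The summand of the partition function, extended to all lists. On an empty cylinder the
  supremum is the bottom element 0, so inadmissible nonempty words drop out of all sums.\<close>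

definition G :: "'a list \<Rightarrow> ennreal" where
  "G w = (SUP x\<in>cyl w. ennreal (exp (S (length w) x)))"

lemma G_ge: "x \<in> cyl w \<Longrightarrow> ennreal (exp (S (length w) x)) \<le> G w"
  unfolding G_def by (rule SUP_upper)

lemma G_le: "x \<in> cyl w \<Longrightarrow> G w \<le> ennreal (exp K * exp (S (length w) x))"
  unfolding G_def
proof (rule SUP_least, rule ennreal_leI)
  fix y assume "x \<in> cyl w" "y \<in> cyl w"
  then show "exp (S (length w) y) \<le> exp K * exp (S (length w) x)"
    using distortion[of y w x] by (simp add: exp_add[symmetric])
qed

lemma G_empty: "cyl w = {} \<Longrightarrow> G w = 0" unfolding G_def by (simp add: bot_ennreal)

lemma G_finite: "G w < \<infinity>"
proof (cases "cyl w = {}")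
  case True then show ?thesis by (simp add: G_empty)
next
  case False
  then obtain x where "x \<in> cyl w" by auto
  from G_le[OF this] show ?thesis by (metis ennreal_less_top infinity_ennreal_def order_le_less_trans)
qed

lemma G_pos: "cyl w \<noteq> {} \<Longrightarrow> G w > 0"
  using G_ge by (metis all_not_in_conv ennreal_less_zero_iff exp_gt_zero order_less_le_trans)

lemma G_Nil: "G [] = 1"
  unfolding G_def using X_ne by (simp add: cylinder_Nil birkhoff_sum_def)

lemma G_append_le: "G (u @ v) \<le> G u * G v"
  unfolding G_def[of "u @ v"]
proof (rule SUP_least)
  fix x assume "x \<in> cyl (u @ v)"
  then have x: "x \<in> cyl u" "shift_pow (length u) x \<in> cyl v" by (auto simp: cylinder_append)
  have "ennreal (exp (S (length (u @ v)) x)) = ennreal (exp (S (length u) x)) * ennreal (exp (S (length v) (shift_pow (length u) x)))"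
    by (simp add: birkhoff_sum_add exp_add ennreal_mult)
  also have "\<dots> \<le> G u * G v" using x by (intro mult_mono G_ge) auto
  finally show "ennreal (exp (S (length (u @ v)) x)) \<le> G u * G v" .
qed

text \<open>A point of the common cylinder realises both factors up to distortion. Each factor costs
  \<open>exp K\<close>, hence \<open>exp (2 * K)\<close>.\<close>

lemma G_append_ge:
  assumes "cyl (u @ v) \<noteq> {}"
  shows "G u * G v \<le> ennreal (exp (2 * K)) * G (u @ v)"
proof -
  obtain x where x: "x \<in> cyl (u @ v)" using assms by auto
  then have x': "x \<in> cyl u" "shift_pow (length u) x \<in> cyl v" by (auto simp: cylinder_append)
  have "G u * G v \<le> ennreal (exp K * exp (S (length u) x)) * ennreal (exp K * exp (S (length v) (shift_pow (length u) x)))"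
    using x' by (intro mult_mono G_le) auto
  also have "\<dots> = ennreal (exp (2 * K)) * ennreal (exp (S (length (u @ v)) x))"
    unfolding mult_2 exp_add by (simp add: birkhoff_sum_add exp_add ennreal_mult[symmetric] mult_ac)
  also have "\<dots> \<le> ennreal (exp (2 * K)) * G (u @ v)" using x by (intro mult_left_mono G_ge) auto
  finally show ?thesis .
qed

section \<open>Partition functions and their exponential growth rate\<close>

definition Z :: "nat \<Rightarrow> ennreal" where
  "Z n = (\<integral>\<^sup>+w. G w \<partial>count_space (lists_of_length n))"

text \<open>There are no admissible words of length 0, so \<open>partition_function\<close> vanishes
  there, while here the empty list contributes 1. This value makes submultiplicativity hold for all
  lengths.\<close>

lemma Z_0: "Z 0 = 1" unfolding Z_def by (simp add: nn_integral_count_space_finite G_Nil)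

lemma partition_function_eq: "n > 0 \<Longrightarrow> partition_function t \<phi> n = Z n"
proof -
  assume n: "n > 0"
  have c: "countable (words t n)" by (rule countableI_type)
  have "partition_function t \<phi> n = (\<integral>\<^sup>+w. G w \<partial>count_space (words t n))"
    unfolding partition_function_def infsum_eq_nn_integral[OF c]
    by (intro nn_integral_cong) (auto simp: G_def words_def)
  also have "\<dots> = Z n" unfolding Z_def
  proof (rule nn_integral_count_space_eq)
    fix w assume "w \<in> lists_of_length n - words t n"
    then have "cyl w = {}" using n cyl_ne[of w] by (auto simp: words_def)
    then show "G w = 0" by (rule G_empty)
  qed (auto simp: words_def)
  finally show ?thesis .
qed

lemma Z_add_le: "Z (m + n) \<le> Z m * Z n"
proof -
  have "Z (m + n) \<le> (\<integral>\<^sup>+u. \<integral>\<^sup>+v. G u * G v \<partial>count_space (lists_of_length n) \<partial>count_space (lists_of_length m))"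
    unfolding Z_def nn_integral_lists_add by (intro nn_integral_mono G_append_le)
  also have "\<dots> = Z m * Z n" unfolding Z_def by (simp add: nn_integral_cmult nn_integral_multc)
  finally show ?thesis .
qed

lemma Z_1: "Z 1 < \<infinity>" using summable partition_function_eq[of 1] unfolding summable_potential_def by simp

lemma Z_finite: "Z n < \<infinity>"
proof (induction n)
  case 0 then show ?case by (simp add: Z_0)
next
  case (Suc n)
  have "Z (1 + n) \<le> Z 1 * Z n" by (rule Z_add_le)
  also have "\<dots> < \<infinity>" using Suc Z_1 by (simp add: ennreal_mult_less_top)
  finally show ?case by simp
qed

lemma Z_pos: "Z n > 0"
proof -
  obtain x where x: "x \<in> X" using X_ne by auto
  have "0 < G (prefix_of n x)" using in_cylinder_prefix[OF x] by (intro G_pos) auto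
  also have "\<dots> \<le> Z n" unfolding Z_def by (intro nn_integral_ge_point) auto
  finally show ?thesis .
qed

text \<open>Finite primitivity provides connecting words of one common length from a finite set.
  Finiteness bounds their weights away from 0, so inserting one changes the product of weights by a
  bounded factor; the common length makes insertion an injective operation on pairs of words of
  given lengths.\<close>

lemma connecting_words:
  obtains N C conn where "\<And>u v. length (conn u v) = N" "C > 0"
    "\<And>u v. admissible t u \<Longrightarrow> admissible t v \<Longrightarrow> admissible t (u @ conn u v @ v)"
    "\<And>u v. admissible t u \<Longrightarrow> admissible t v \<Longrightarrow> G u * G v \<le> ennreal C * G (u @ conn u v @ v)"
proof -
  obtain \<Lambda> N where fin: "finite \<Lambda>" and L: "\<Lambda> \<subseteq> words t N \<or> (N = 0 \<and> (\<forall>i j. t i j) \<and> \<Lambda> \<subseteq> {[]})"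
    and conn: "\<forall>w w'. admissible t w \<longrightarrow> admissible t w' \<longrightarrow> (\<exists>l\<in>\<Lambda>. admissible t (w @ l @ w'))"
    using primitive unfolding finitely_primitive_def by auto
  have len: "length l = N" if "l \<in> \<Lambda>" for l using L that by (auto simp: words_def)
  have pos: "0 < G l" if "l \<in> \<Lambda>" for l using L that by (intro G_pos) (auto simp: cyl_ne words_def)
  \<comment> \<open>The smallest weight of a connecting word. The inserted 1 guarantees a minimum
    over a nonempty set and a finite value.\<close>
  define c where "c = enn2real (Min (insert 1 (G ` \<Lambda>)))"
  have "Min (insert 1 (G ` \<Lambda>)) > 0" using fin pos by simp
  moreover have fin': "Min (insert 1 (G ` \<Lambda>)) \<le> 1" using fin by simp
  ultimately have c: "c > 0" "ennreal c = Min (insert 1 (G ` \<Lambda>))" unfolding c_def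
    by (auto simp: enn2real_positive_iff intro!: ennreal_enn2real order_le_less_trans[OF fin'])
  have cG: "ennreal c \<le> G l" if "l \<in> \<Lambda>" for l using c that fin by auto
  \<comment> \<open>The default value has length \<open>N\<close> too, so the length statement holds
    for all pairs and injectivity arguments need no admissibility.\<close>
  define conn' where "conn' u v = (if admissible t u \<and> admissible t v then SOME l. l \<in> \<Lambda> \<and> admissible t (u @ l @ v) else replicate N undefined)" for u v
  have conn': "conn' u v \<in> \<Lambda> \<and> admissible t (u @ conn' u v @ v)" if "admissible t u" "admissible t v" for u v
    using someI_ex[of "\<lambda>l. l \<in> \<Lambda> \<and> admissible t (u @ l @ v)"] conn that unfolding conn'_def by auto
  show ?thesis
  proof
    show "length (conn' u v) = N" for u v using conn'[of u v] len by (auto simp: conn'_def)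
    \<comment> \<open>Two applications of \<open>G_append_ge\<close> cost \<open>exp (2 * K)\<close>
      each; the division by \<open>c\<close> pays for the weight of the inserted word.\<close>
    show "exp (4 * K) / c > 0" using c by simp
    fix u v assume uv: "admissible t u" "admissible t v"
    show adm: "admissible t (u @ conn' u v @ v)" using conn'[OF uv] by simp
    let ?l = "conn' u v"
    have ne: "cyl (u @ ?l @ v) \<noteq> {}" "cyl (?l @ v) \<noteq> {}"
      using adm admissible_appendD(2)[OF adm] uv by (auto simp: cyl_ne admissible_def[of t v])
    have "ennreal c * (G u * G v) \<le> G ?l * (G u * G v)" using conn'[OF uv] cG by (intro mult_right_mono) auto
    also have "\<dots> = G u * (G ?l * G v)" by (simp add: mult_ac)
    also have "\<dots> \<le> G u * (ennreal (exp (2 * K)) * G (?l @ v))" by (intro mult_left_mono G_append_ge ne) auto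
    also have "\<dots> = ennreal (exp (2 * K)) * (G u * G (?l @ v))" by (simp add: mult_ac)
    also have "\<dots> \<le> ennreal (exp (2 * K)) * (ennreal (exp (2 * K)) * G (u @ ?l @ v))" by (intro mult_left_mono G_append_ge ne) auto
    also have "\<dots> = ennreal (exp (4 * K)) * G (u @ ?l @ v)"
      by (simp add: ennreal_mult[symmetric] mult.assoc[symmetric] exp_add[symmetric])
    finally have "ennreal (1 / c) * (ennreal c * (G u * G v)) \<le> ennreal (1 / c) * (ennreal (exp (4 * K)) * G (u @ ?l @ v))"
      by (intro mult_left_mono) auto
    moreover have "ennreal (1 / c) * (ennreal c * z) = z" for z
      using c(1) by (simp add: mult.assoc[symmetric] ennreal_mult[symmetric])
    moreover have "ennreal (1 / c) * (ennreal (exp (4 * K)) * z) = ennreal (exp (4 * K) / c) * z" for z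
      using c(1) by (simp add: mult.assoc[symmetric] ennreal_mult[symmetric])
    ultimately show "G u * G v \<le> ennreal (exp (4 * K) / c) * G (u @ ?l @ v)" by simp
  qed
qed


text \<open>Inserting connecting words maps pairs injectively to words of length
  \<open>m + N + n\<close>. The surplus \<open>N\<close> letters are then removed by
  submultiplicativity, at the price of the constant factor \<open>Z N\<close>.\<close>

lemma Z_almost_supermultiplicative:
  obtains D where "D \<ge> 1" "\<And>m n. Z m * Z n \<le> ennreal D * Z (m + n)"
proof -
  obtain N C conn where len: "\<And>u v. length (conn u v) = N" and C: "C > 0"
    and G: "\<And>u v. admissible t u \<Longrightarrow> admissible t v \<Longrightarrow> G u * G v \<le> ennreal C * G (u @ conn u v @ v)"
    by (rule connecting_words) blast
  have *: "Z m * Z n \<le> ennreal C * Z (m + (N + n))" if "m > 0" "n > 0" for m n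
  proof -
    let ?L = "lists_of_length m \<times> lists_of_length n"
    have "G u * G v \<le> ennreal C * G (u @ conn u v @ v)" if "length u = m" "length v = n" for u v
    proof (cases "admissible t u \<and> admissible t v")
      case False
      then have "G u * G v = 0" using G_empty[of u] G_empty[of v] cyl_ne[of u] cyl_ne[of v] that \<open>m > 0\<close> \<open>n > 0\<close> by auto
      then show ?thesis by (simp only: zero_le)
    qed (use G in auto)
    then have "(\<integral>\<^sup>+u. \<integral>\<^sup>+v. G u * G v \<partial>count_space (lists_of_length n) \<partial>count_space (lists_of_length m))
       \<le> (\<integral>\<^sup>+u. \<integral>\<^sup>+v. ennreal C * G (u @ conn u v @ v) \<partial>count_space (lists_of_length n) \<partial>count_space (lists_of_length m))"
      by (intro nn_integral_mono) auto
    also have "\<dots> = ennreal C * (\<integral>\<^sup>+u. \<integral>\<^sup>+v. G (u @ conn u v @ v) \<partial>count_space (lists_of_length n) \<partial>count_space (lists_of_length m))"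
      by (simp add: nn_integral_cmult)
    also have "(\<integral>\<^sup>+u. \<integral>\<^sup>+v. G (u @ conn u v @ v) \<partial>count_space (lists_of_length n) \<partial>count_space (lists_of_length m))
       = (\<integral>\<^sup>+w. G (fst w @ conn (fst w) (snd w) @ snd w) \<partial>count_space ?L)"
      using nn_integral_count_space_Times[where f="\<lambda>w. G (fst w @ conn (fst w) (snd w) @ snd w)"] by simp
    also have "\<dots> \<le> Z (m + (N + n))" unfolding Z_def
      by (rule nn_integral_count_space_inj_le) (auto simp: inj_on_def len)
    finally show ?thesis unfolding Z_def by (simp add: nn_integral_cmult nn_integral_multc mult_left_mono)
  qed
  \<comment> \<open>The maximum with 1 covers the cases \<open>m = 0\<close> and
    \<open>n = 0\<close>, where no connecting word can be inserted.\<close>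
  define D where "D = max 1 (C * enn2real (Z N))"
  have ZN: "ennreal (enn2real (Z N)) = Z N" using Z_finite[of N] by (intro ennreal_enn2real) simp
  show ?thesis
  proof (rule that[of D])
    show "D \<ge> 1" by (simp add: D_def)
    fix m n show "Z m * Z n \<le> ennreal D * Z (m + n)"
    proof (cases "m = 0 \<or> n = 0")
      case True
      then have "Z m * Z n = 1 * Z (m + n)" by (auto simp: Z_0)
      also have "\<dots> \<le> ennreal D * Z (m + n)" by (intro mult_right_mono) (auto simp: D_def)
      finally show ?thesis .
    next
      case False
      then have "Z m * Z n \<le> ennreal C * Z (N + (m + n))" using *[of m n] by (simp add: add_ac)
      also have "\<dots> \<le> ennreal C * (Z N * Z (m + n))" by (intro mult_left_mono Z_add_le) auto
      also have "\<dots> = ennreal (C * enn2real (Z N)) * Z (m + n)" using C ZN by (simp add: ennreal_mult mult.assoc)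
      also have "\<dots> \<le> ennreal D * Z (m + n)" by (intro mult_right_mono ennreal_leI) (auto simp: D_def)
      finally show ?thesis .
    qed
  qed
qed

text \<open>With \<open>a = ln Z\<close>, both \<open>a\<close> and \<open>d - a\<close> are
  subadditive, the latter because \<open>Z\<close> is supermultiplicative up to
  \<open>D = exp d\<close>. Their limits are opposite, and the pointwise bounds of Fekete's lemma
  for the two sequences bound \<open>Z n\<close> from below and from above without any
  subexponential correction.\<close>

lemma ex_pressure:
  "\<exists>p C. C \<ge> 1 \<and> (\<lambda>n. ln (enn2real (Z n)) / real n) \<longlonglongrightarrow> p \<and>
    (\<forall>n. ennreal (exp (real n * p)) \<le> Z n \<and> Z n \<le> ennreal (C * exp (real n * p)))"
proof -
  obtain D where D: "D \<ge> 1" "\<And>m n. Z m * Z n \<le> ennreal D * Z (m + n)"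
    by (rule Z_almost_supermultiplicative) blast
  define z where "z n = enn2real (Z n)" for n
  have z: "z n > 0" "Z n = ennreal (z n)" for n
    using Z_finite[of n] Z_pos[of n] unfolding z_def by (auto simp: enn2real_positive_iff)
  define a where "a n = ln (z n)" for n
  define d where "d = ln D"
  have sub: "a (m + n) \<le> a m + a n" for m n
  proof -
    have "z (m + n) \<le> z m * z n" using Z_add_le[of m n] z by (simp add: ennreal_mult[symmetric] less_imp_le)
    then have "ln (z (m + n)) \<le> ln (z m * z n)" using z[of m] z[of n] z[of "m+n"] by (subst ln_le_cancel_iff) auto
    then show ?thesis using z[of m] z[of n] by (simp add: a_def ln_mult)
  qed
  have super: "a m + a n \<le> a (m + n) + d" for m n
  proof -
    have "z m * z n \<le> D * z (m + n)" using D(2)[of m n] z D(1) by (simp add: ennreal_mult[symmetric] less_imp_le)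
    then have "ln (z m * z n) \<le> ln (D * z (m + n))" using z[of m] z[of n] z[of "m+n"] D by (subst ln_le_cancel_iff) auto
    then show ?thesis using z[of m] z[of n] z[of "m+n"] D(1) by (simp add: a_def d_def ln_mult)
  qed
  have d0: "d \<ge> 0" using D by (simp add: d_def)
  have a0: "a 0 = 0" by (simp add: a_def z_def Z_0)
  have lb: "(a 1 - d) * real n \<le> a n" for n
  proof (induction n)
    case (Suc n) then show ?case using super[of 1 n] by (simp add: algebra_simps)
  qed (simp add: a0)
  have ub: "a n \<le> a 1 * real n" for n
  proof (induction n)
    case (Suc n) then show ?case using sub[of 1 n] by (simp add: algebra_simps)
  qed (simp add: a0)
  obtain p where p: "(\<lambda>n. a n / real n) \<longlonglongrightarrow> p" "\<And>n. real n * p \<le> a n"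
    by (rule fekete[of a "a 1 - d"]) (use sub lb in auto)
  obtain q where q: "(\<lambda>n. (d - a n) / real n) \<longlonglongrightarrow> q" "\<And>n. real n * q \<le> d - a n"
  proof (rule fekete[of "\<lambda>n. d - a n" "- a 1"])
    show "d - a (m + n) \<le> d - a m + (d - a n)" for m n using super[of m n] by simp
    show "- a 1 * real n \<le> d - a n" for n using ub[of n] d0 by simp
  qed auto
  have "(\<lambda>n. d / real n - a n / real n) \<longlonglongrightarrow> 0 - p"
    by (intro tendsto_diff p(1) lim_const_over_n)
  then have "q = - p" using q(1) LIMSEQ_unique by (fastforce simp: diff_divide_distrib)
  then have up: "a n \<le> d + real n * p" for n using q(2)[of n] by simp
  have "ennreal (exp (real n * p)) \<le> Z n \<and> Z n \<le> ennreal (D * exp (real n * p))" for n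
  proof -
    have e: "exp (a n) = z n" using z by (simp add: a_def)
    have "exp (real n * p) \<le> z n" using p(2)[of n] unfolding e[symmetric] by simp
    moreover have "z n \<le> exp (d + real n * p)" using up[of n] unfolding e[symmetric] by simp
    then have "z n \<le> D * exp (real n * p)" using D by (simp add: exp_add d_def)
    ultimately show ?thesis unfolding z(2) by (simp add: ennreal_leI)
  qed
  then show ?thesis using p(1) D(1) unfolding a_def z_def by blast
qed

section \<open>Normalised cylinder weights and gluing of words\<close>

definition p :: real where
  "p = (SOME p. \<exists>C. C \<ge> 1 \<and> (\<lambda>n. ln (enn2real (Z n)) / real n) \<longlonglongrightarrow> p \<and>
    (\<forall>n. ennreal (exp (real n * p)) \<le> Z n \<and> Z n \<le> ennreal (C * exp (real n * p))))"

definition rho :: "'a list \<Rightarrow> real" where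
  "rho w = enn2real (G w) * exp (- (real (length w) * p))"

lemma p_props: "\<exists>C. C \<ge> 1 \<and> (\<lambda>n. ln (enn2real (Z n)) / real n) \<longlonglongrightarrow> p \<and>
    (\<forall>n. ennreal (exp (real n * p)) \<le> Z n \<and> Z n \<le> ennreal (C * exp (real n * p)))"
  unfolding p_def by (rule someI_ex[OF ex_pressure])

lemma p_LIMSEQ: "(\<lambda>n. ln (enn2real (Z n)) / real n) \<longlonglongrightarrow> p" using p_props by auto

lemma rho_eq: "ennreal (rho w) = G w * ennreal (exp (- (real (length w) * p)))"
  using G_finite[of w] unfolding rho_def by (simp add: ennreal_mult)

lemma rho_nonneg: "rho w \<ge> 0" by (simp add: rho_def)

lemma rho_pos: "cyl w \<noteq> {} \<Longrightarrow> rho w > 0"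
  using G_pos[of w] G_finite[of w] by (simp add: rho_def enn2real_positive_iff)

lemma rho_empty: "cyl w = {} \<Longrightarrow> rho w = 0"
  by (simp add: rho_def G_empty)

lemma rho_Nil: "rho [] = 1" by (simp add: rho_def G_Nil)

lemma rho_append_le: "rho (u @ v) \<le> rho u * rho v"
proof -
  have "enn2real (G (u @ v)) \<le> enn2real (G u * G v)"
    using G_finite[of u] G_finite[of v] by (intro enn2real_mono G_append_le) (auto simp: ennreal_mult_less_top)
  then have "rho (u @ v) \<le> (enn2real (G u) * enn2real (G v)) * exp (- (real (length (u @ v)) * p))"
    unfolding rho_def by (intro mult_right_mono) (auto simp: enn2real_mult)
  also have "\<dots> = rho u * rho v"
    by (simp add: rho_def exp_add[symmetric] algebra_simps)
  finally show ?thesis .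
qed

lemma rho_le:
  assumes "x \<in> cyl w" shows "rho w \<le> exp K * exp (S (length w) x - real (length w) * p)"
proof -
  have "enn2real (G w) \<le> exp K * exp (S (length w) x)"
    using enn2real_mono[OF G_le[OF assms]] by simp
  then show ?thesis unfolding rho_def exp_diff exp_minus by (simp add: field_simps)
qed

lemma rho_ge:
  assumes "x \<in> cyl w" shows "exp (S (length w) x - real (length w) * p) \<le> rho w"
proof -
  have "exp (S (length w) x) \<le> enn2real (G w)"
    using enn2real_mono[OF G_ge[OF assms]] G_finite[of w] by simp
  then show ?thesis unfolding rho_def exp_diff exp_minus by (simp add: field_simps)
qed

text \<open>The normalisation by \<open>exp (- n * p)\<close> absorbs exactly the growth of
  \<open>Z n\<close>. The lower constant is 1 because Fekete's limit is an infimum.\<close>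

lemma rho_sum_bounds:
  obtains C where "C \<ge> 1" "\<And>n. 1 \<le> (\<integral>\<^sup>+w. ennreal (rho w) \<partial>count_space (lists_of_length n))"
    "\<And>n. (\<integral>\<^sup>+w. ennreal (rho w) \<partial>count_space (lists_of_length n)) \<le> ennreal C"
proof -
  obtain C where C: "C \<ge> 1" "\<And>n. ennreal (exp (real n * p)) \<le> Z n" "\<And>n. Z n \<le> ennreal (C * exp (real n * p))"
    using p_props by auto
  have eq: "(\<integral>\<^sup>+w. ennreal (rho w) \<partial>count_space (lists_of_length n)) = Z n * ennreal (exp (- (real n * p)))" for n
    unfolding Z_def by (subst nn_integral_multc[symmetric]) (auto simp: rho_eq intro!: nn_integral_cong)
  have one: "ennreal (exp (real n * p)) * ennreal (exp (- (real n * p))) = 1" for n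
    by (simp add: ennreal_mult[symmetric] exp_add[symmetric])
  show ?thesis
  proof (rule that[OF C(1)])
    fix n
    show "1 \<le> (\<integral>\<^sup>+w. ennreal (rho w) \<partial>count_space (lists_of_length n))"
      unfolding eq one[of n, symmetric] by (intro mult_right_mono C) auto
    have "Z n * ennreal (exp (- (real n * p))) \<le> ennreal (C * exp (real n * p)) * ennreal (exp (- (real n * p)))"
      by (intro mult_right_mono C) auto
    also have "\<dots> = ennreal C" using C(1) by (simp add: ennreal_mult mult.assoc one)
    finally show "(\<integral>\<^sup>+w. ennreal (rho w) \<partial>count_space (lists_of_length n)) \<le> ennreal C" unfolding eq .
  qed
qed

text \<open>The words \<open>y\<close> that contribute consist of an arbitrary word with a connecting block at each end.
  The estimate yields both the Gibbs bounds for the periodic measures and the mixing property.\<close>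

lemma rho_gluing:
  obtains c r0 where "c > 0" "r0 \<ge> 1"
    "\<And>u v r. admissible t u \<Longrightarrow> admissible t v \<Longrightarrow> r \<ge> r0 \<Longrightarrow>
      ennreal (c * (rho u * rho v)) \<le> (\<integral>\<^sup>+y. ennreal (rho (u @ y @ v)) \<partial>count_space (lists_of_length r))"
proof -
  obtain N C conn where len: "\<And>u v. length (conn u v) = N" and C: "C > 0"
    and adm: "\<And>u v. admissible t u \<Longrightarrow> admissible t v \<Longrightarrow> admissible t (u @ conn u v @ v)"
    and G: "\<And>u v. admissible t u \<Longrightarrow> admissible t v \<Longrightarrow> G u * G v \<le> ennreal C * G (u @ conn u v @ v)"
    by (rule connecting_words) blast
  have one: "1 \<le> (\<integral>\<^sup>+w. ennreal (rho w) \<partial>count_space (lists_of_length n))" for n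
    by (rule rho_sum_bounds) blast
  \<comment> \<open>In normalised weights a connecting block of \<open>N\<close> letters costs the
    additional factor \<open>exp (N * p)\<close>.\<close>
  define E where "E = C * exp (real N * p)"
  have E: "E > 0" using C by (simp add: E_def)
  have r: "rho u * rho v \<le> E * rho (u @ conn u v @ v)" if "admissible t u" "admissible t v" for u v
  proof -
    let ?n = "real (length u + length v)"
    have "enn2real (G u * G v) \<le> enn2real (ennreal C * G (u @ conn u v @ v))"
      using G_finite by (intro enn2real_mono G that) (auto simp: ennreal_mult_less_top)
    then have "(enn2real (G u) * enn2real (G v)) * exp (- (?n * p)) \<le> (C * enn2real (G (u @ conn u v @ v))) * exp (- (?n * p))"
      using C by (intro mult_right_mono) (auto simp: enn2real_mult)
    moreover have "exp (- (?n * p)) = exp (real N * p) * exp (- (real (length (u @ conn u v @ v)) * p))"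
      by (simp add: exp_add[symmetric] len algebra_simps)
    moreover have "rho u * rho v = (enn2real (G u) * enn2real (G v)) * exp (- (?n * p))"
      by (simp add: rho_def exp_add[symmetric] algebra_simps)
    ultimately have "rho u * rho v \<le> (C * enn2real (G (u @ conn u v @ v))) *
        (exp (real N * p) * exp (- (real (length (u @ conn u v @ v)) * p)))" by simp
    also have "\<dots> = E * rho (u @ conn u v @ v)" unfolding E_def rho_def by (simp only: mult_ac)
    finally show ?thesis .
  qed
  \<comment> \<open>Two connecting blocks give \<open>E^2\<close>. The extra 1 in
    \<open>2 * N + 1\<close> keeps the free middle word nonempty, so that its inadmissibility forces
    \<open>rho\<close> to vanish.\<close>
  show ?thesis
  proof (rule that[of "1 / E^2" "2 * N + 1"])
    show "1 / E^2 > 0" using E by simp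
    fix u v :: "'a list" and r assume u: "admissible t u" and v: "admissible t v" and rr: "r \<ge> 2 * N + 1"
    define m where "m = r - 2 * N"
    have m: "r = N + m + N" "m > 0" using rr by (auto simp: m_def)
    \<comment> \<open>The left block depends on \<open>z\<close> and on the right block, but has
      fixed length \<open>N\<close>, so \<open>z\<close> can be read off from positions
      \<open>N\<close> to \<open>N + m - 1\<close>; this gives injectivity.\<close>
    define f where "f z = conn u (z @ conn z v @ v) @ z @ conn z v" for z
    have "ennreal (rho u * rho v) = ennreal (rho u * rho v) * 1" by simp
    \<comment> \<open>The sum over the free middle word is inserted at no cost, since it is at least
      1.\<close>
    also have "\<dots> \<le> ennreal (rho u * rho v) * (\<integral>\<^sup>+z. ennreal (rho z) \<partial>count_space (lists_of_length m))"
      by (intro mult_left_mono one) auto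
    also have "\<dots> = (\<integral>\<^sup>+z. ennreal (rho u * rho v * rho z) \<partial>count_space (lists_of_length m))"
      by (simp add: nn_integral_cmult[symmetric] ennreal_mult rho_nonneg)
    also have "\<dots> \<le> (\<integral>\<^sup>+z. ennreal (E^2) * ennreal (rho (u @ f z @ v)) \<partial>count_space (lists_of_length m))"
    proof (intro nn_integral_mono)
      fix z :: "'a list" assume "z \<in> space (count_space (lists_of_length m))"
      then have z: "length z = m" by simp
      show "ennreal (rho u * rho v * rho z) \<le> ennreal (E^2) * ennreal (rho (u @ f z @ v))"
      proof (cases "admissible t z")
        case False
        then have "rho z = 0" using m z cyl_ne[of z] by (intro rho_empty) auto
        then show ?thesis by simp
      next
        case True
        have "rho u * rho v * rho z = rho u * (rho z * rho v)" by simp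
        also have "\<dots> \<le> rho u * (E * rho (z @ conn z v @ v))"
          by (intro mult_left_mono r True v rho_nonneg)
        also have "\<dots> = E * (rho u * rho (z @ conn z v @ v))" by simp
        also have "\<dots> \<le> E * (E * rho (u @ conn u (z @ conn z v @ v) @ (z @ conn z v @ v)))"
          using E by (intro mult_left_mono r u adm True v) auto
        finally have "rho u * rho v * rho z \<le> E^2 * rho (u @ f z @ v)" by (simp add: f_def power2_eq_square)
        then show ?thesis using E by (simp add: ennreal_mult[symmetric] rho_nonneg ennreal_leI)
      qed
    qed
    also have "\<dots> = ennreal (E^2) * (\<integral>\<^sup>+z. ennreal (rho (u @ f z @ v)) \<partial>count_space (lists_of_length m))"
      by (simp add: nn_integral_cmult)
    also have "\<dots> \<le> ennreal (E^2) * (\<integral>\<^sup>+y. ennreal (rho (u @ y @ v)) \<partial>count_space (lists_of_length r))"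
    proof (intro mult_left_mono nn_integral_count_space_inj_le)
      show "inj_on f (lists_of_length m)"
      proof (rule inj_onI)
        fix z z' assume "z \<in> lists_of_length m" "z' \<in> lists_of_length m" "f z = f z'"
        then show "z = z'" unfolding f_def using len by (auto simp: append_eq_append_conv)
      qed
      show "f ` lists_of_length m \<subseteq> lists_of_length r" using m by (auto simp: f_def len)
    qed simp
    finally have "ennreal (1 / E^2) * ennreal (rho u * rho v) \<le> ennreal (1 / E^2) * (ennreal (E^2) *
       (\<integral>\<^sup>+y. ennreal (rho (u @ y @ v)) \<partial>count_space (lists_of_length r)))"
      by (intro mult_left_mono) auto
    also have "\<dots> = (\<integral>\<^sup>+y. ennreal (rho (u @ y @ v)) \<partial>count_space (lists_of_length r))"
      using E by (simp add: mult.assoc[symmetric] ennreal_mult[symmetric])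
    finally show "ennreal (1 / E^2 * (rho u * rho v)) \<le> (\<integral>\<^sup>+y. ennreal (rho (u @ y @ v)) \<partial>count_space (lists_of_length r))"
      by (subst ennreal_mult) (auto simp: rho_nonneg)
  qed simp
qed

end

section \<open>Borel sets and measures on the shift space\<close>

lemma open_coordinate: "open {x. P (x i)}" for P :: "'a::discrete_topology \<Rightarrow> bool"
proof -
  have "open ((\<lambda>x :: 'b \<Rightarrow> 'a. x i) -` {a. P a})"
    by (intro open_vimage[OF discrete_topology_class.open_discrete] continuous_on_product_coordinates)
  then show ?thesis by (simp add: vimage_def)
qed

lemma cylinder_as_restriction: "cylinder t w = {x. \<forall>i\<in>{..<length w}. x i = w ! i} \<inter> markov_shift t"
  by (auto simp: cylinder_def)

lemma open_contains_cylinder: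
  fixes U :: "(nat \<Rightarrow> 'a::discrete_topology) set"
  assumes "open U" "x \<in> U"
  shows "\<exists>n. \<forall>y. (\<forall>i<n. y i = x i) \<longrightarrow> y \<in> U"
proof -
  from assms(1) have "openin (product_topology (\<lambda>i. euclidean) UNIV) U" by (simp add: open_fun_def)
  from product_topology_open_contains_basis[OF this assms(2)]
  obtain V where V: "x \<in> (\<Pi>\<^sub>E i\<in>UNIV. V i)" "finite {i. V i \<noteq> UNIV}" "(\<Pi>\<^sub>E i\<in>UNIV. V i) \<subseteq> U" by auto
  obtain n where n: "\<And>i. V i \<noteq> UNIV \<Longrightarrow> i < n" using V(2) by (auto simp: finite_nat_set_iff_bounded)
  show ?thesis
  proof (intro exI allI impI)
    fix y assume y: "\<forall>i<n. y i = x i"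
    have "y i \<in> V i" for i
      using V(1) y n[of i] by (cases "V i = UNIV") (auto simp: PiE_iff)
    then show "y \<in> U" using V(3) by (auto simp: PiE_iff)
  qed
qed

lemma space_shift_borel [simp]: "space (shift_borel t) = markov_shift t"
  by (simp add: shift_borel_def space_restrict_space)

lemma cylinder_sets [measurable, simp]: "cylinder t w \<in> sets (shift_borel t)"
proof -
  have "open (\<Inter>i\<in>{..<length w}. {x. x i = w ! i})"
    by (intro open_INT ballI open_coordinate[of "\<lambda>a. a = w ! i" i for i]) simp
  also have "(\<Inter>i\<in>{..<length w}. {x. x i = w ! i}) = {x. \<forall>i\<in>{..<length w}. x i = w ! i}" by auto
  finally show ?thesis unfolding shift_borel_def cylinder_as_restriction sets_restrict_space
    by (subst Int_commute) (intro imageI borel_open)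
qed

text \<open>There are only countably many words, so the trace of an open set is a countable union of
  the cylinders it contains.\<close>

lemma sets_shift_borel:
  fixes t :: "'a::{countable, discrete_topology} \<Rightarrow> 'a \<Rightarrow> bool"
  shows "sets (shift_borel t) = sigma_sets (markov_shift t) (range (cylinder t))"
proof
  show "sigma_sets (markov_shift t) (range (cylinder t)) \<subseteq> sets (shift_borel t)"
    using sets.sigma_sets_subset[of "range (cylinder t)" "shift_borel t"] cylinder_sets[of t] by fastforce
next
  let ?X = "markov_shift t" and ?E = "range (cylinder t)"
  have "B \<inter> ?X \<in> sigma_sets ?X ?E" if "B \<in> sigma_sets UNIV {S. open S}" for B
    using that
  proof induction
    case (Basic U)
    have "U \<inter> ?X = (\<Union>w\<in>{w. cylinder t w \<subseteq> U}. cylinder t w)"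
    proof (intro set_eqI iffI)
      fix x assume x: "x \<in> U \<inter> ?X"
      then obtain n where n: "\<forall>y. (\<forall>i<n. y i = x i) \<longrightarrow> y \<in> U"
        using open_contains_cylinder[of U x] Basic by auto
      then have "cylinder t (prefix_of n x) \<subseteq> U" by (auto simp: cylinder_def)
      then show "x \<in> (\<Union>w\<in>{w. cylinder t w \<subseteq> U}. cylinder t w)" using x in_cylinder_prefix[of x t n] by blast
    qed (auto simp: cylinder_def)
    moreover have "(\<Union>w\<in>{w. cylinder t w \<subseteq> U}. cylinder t w) \<in> sigma_sets ?X ?E"
      by (intro sigma_sets_UNION countable_image) (auto intro: countableI_type)
    ultimately show ?case by simp
  next
    case Empty then show ?case by (simp add: sigma_sets.Empty)
  next
    case (Compl a)
    have "(UNIV - a) \<inter> ?X = ?X - (a \<inter> ?X)" by auto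
    then show ?case using Compl by (simp add: sigma_sets.Compl)
  next
    case (Union a)
    have eq: "(\<Union>i. a i) \<inter> ?X = (\<Union>i. a i \<inter> ?X)" by auto
    show ?case unfolding eq by (rule sigma_sets.Union) (rule Union.IH)
  qed
  then show "sets (shift_borel t) \<subseteq> sigma_sets ?X ?E"
    unfolding shift_borel_def sets_restrict_space borel_def by (auto simp: Int_commute)
qed

lemma cylinder_Int:
  "cylinder t u \<inter> cylinder t v \<in> insert {} (range (cylinder t))"
proof (cases "cylinder t u \<inter> cylinder t v = {}")
  case False
  then obtain x where x: "x \<in> cylinder t u" "x \<in> cylinder t v" by auto
  then have "u = prefix_of (length u) x" "v = prefix_of (length v) x" by (auto simp: cylinder_eq)
  then have eq: "cylinder t u = {y \<in> markov_shift t. \<forall>i<length u. y i = x i}" "cylinder t v = {y \<in> markov_shift t. \<forall>i<length v. y i = x i}"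
    using x by (auto simp: cylinder_def)
  show ?thesis
  proof (cases "length u \<le> length v")
    case True
    then have "cylinder t u \<inter> cylinder t v = cylinder t v" unfolding eq by auto
    then show ?thesis by auto
  next
    case False
    then have "cylinder t u \<inter> cylinder t v = cylinder t u" unfolding eq by auto
    then show ?thesis by auto
  qed
qed simp

lemma measure_eqI_cylinder:
  fixes t :: "'a::{countable, discrete_topology} \<Rightarrow> 'a \<Rightarrow> bool"
  assumes "sets M = sets (shift_borel t)" "sets N = sets (shift_borel t)" "finite_measure M"
    and eq: "\<And>w. emeasure M (cylinder t w) = emeasure N (cylinder t w)"
  shows "M = N"
proof (rule measure_eqI_generator_eq[where \<Omega>="markov_shift t" and E="insert {} (range (cylinder t))" and A="\<lambda>_. markov_shift t"])
  show "Int_stable (insert {} (range (cylinder t)))"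
    unfolding Int_stable_def using cylinder_Int by fastforce
  have s: "sigma_sets \<Omega> (insert {} E) = sigma_sets \<Omega> E" for \<Omega> and E :: "(nat \<Rightarrow> 'a) set set"
    by (auto intro!: sigma_sets_mono sigma_sets.Empty)
  show "sets M = sigma_sets (markov_shift t) (insert {} (range (cylinder t)))"
    "sets N = sigma_sets (markov_shift t) (insert {} (range (cylinder t)))"
    using assms(1,2) by (auto simp: sets_shift_borel s)
  show "range (\<lambda>_. markov_shift t) \<subseteq> insert {} (range (cylinder t))"
    using cylinder_Nil by (metis image_subset_iff insertCI rangeI)
  show "emeasure M (markov_shift t) \<noteq> \<infinity>" for i using assms(3) by (simp add: finite_measure.emeasure_finite)
  show "emeasure M Y = emeasure N Y" if "Y \<in> insert {} (range (cylinder t))" for Y using that eq by auto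
  show "insert {} (range (cylinder t)) \<subseteq> Pow (markov_shift t)" using cylinder_subset by auto
qed auto

lemma vimage_cylinder: "left_shift -` cylinder t w \<inter> markov_shift t = (\<Union>a. cylinder t (a # w))"
proof -
  have "x \<in> cylinder t (a # w) \<longleftrightarrow> x \<in> cylinder t [a] \<and> left_shift x \<in> cylinder t w" for a x
    using cylinder_append[of t "[a]" w] by simp
  then show ?thesis by (auto simp: cylinder_def)
qed

lemma measurable_left_shift:
  fixes t :: "'a::{countable, discrete_topology} \<Rightarrow> 'a \<Rightarrow> bool"
  assumes M: "sets M = sets (shift_borel t)"
  shows "left_shift \<in> measurable M M"
proof -
  have "left_shift \<in> measurable (shift_borel t) (shift_borel t)"
  proof (rule measurable_sigma_sets[OF sets_shift_borel])
    show "range (cylinder t) \<subseteq> Pow (markov_shift t)" by (auto simp: cylinder_def)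
    show "left_shift \<in> space (shift_borel t) \<rightarrow> markov_shift t"
      using shift_pow_in[of _ t 1] by auto
    show "left_shift -` y \<inter> space (shift_borel t) \<in> sets (shift_borel t)" if "y \<in> range (cylinder t)" for y
      using that by (auto simp: vimage_cylinder)
  qed
  then show ?thesis using measurable_cong_sets[OF M M] by simp
qed

lemma invariant_measure_preserving:
  fixes t :: "'a::{countable, discrete_topology} \<Rightarrow> 'a \<Rightarrow> bool"
  assumes "\<nu> \<in> invariant_measures t"
  shows "measure_preserving \<nu> left_shift"
proof -
  have \<nu>: "sets \<nu> = sets (shift_borel t)" "prob_space \<nu>"
    "\<And>A. A \<in> sets \<nu> \<Longrightarrow> emeasure \<nu> (left_shift -` A \<inter> space \<nu>) = emeasure \<nu> A"
    using assms by (auto simp: invariant_measures_def)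
  interpret prob_space \<nu> by fact
  show ?thesis
    by unfold_locales (auto simp: measurable_left_shift[OF \<nu>(1)] \<nu>(3) measure_def)
qed

subsection \<open>Finite codings\<close>

text \<open>All but finitely many letters are merged into one, so that \<open>code n\<close> takes finitely many values.\<close>

definition lab :: "nat \<Rightarrow> (nat \<Rightarrow> 'a::countable) \<Rightarrow> nat" where
  "lab m x = min (to_nat (x 0)) m"

abbreviation code :: "nat \<Rightarrow> (nat \<Rightarrow> 'a::countable) \<Rightarrow> nat list" where
  "code n \<equiv> itin left_shift (lab n) n"

text \<open>One parameter bounds both the number of coordinates and the labels. Hence
  \<open>code m\<close> determines \<open>code n\<close> for \<open>n \<le> m\<close>, and the sets
  form an increasing union of finite algebras, each given by a single finite-valued map.\<close>

definition coded_sets :: "('a::countable \<Rightarrow> 'a \<Rightarrow> bool) \<Rightarrow> (nat \<Rightarrow> 'a) set set" where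
  "coded_sets t = {code n -` B \<inter> markov_shift t | n B. True}"

lemma itin_lab: "itin left_shift (lab m) k x = map (\<lambda>i. min (to_nat (x i)) m) [0..<k]"
  by (simp add: itin_def lab_def shift_pow_apply)

lemma itin_lab_coarsen:
  "k \<le> n \<Longrightarrow> m \<le> n \<Longrightarrow> itin left_shift (lab m) k x = map (\<lambda>a. min a m) (take k (code n x))"
  by (auto simp: itin_lab list_eq_iff_nth_eq)

lemma coded_setsI: "code n -` B \<inter> markov_shift t \<in> coded_sets t"
  by (auto simp: coded_sets_def)

lemma coded_sets_level:
  assumes "A \<in> coded_sets t"
  obtains n where "\<And>m. m \<ge> n \<Longrightarrow> \<exists>B. A = code m -` B \<inter> markov_shift t"
proof -
  obtain n B where A: "A = code n -` B \<inter> markov_shift t" using assms by (auto simp: coded_sets_def)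
  show ?thesis
  proof (rule that[of n])
    fix m assume "n \<le> m"
    then have "A = code m -` ((\<lambda>l. map (\<lambda>a. min a n) (take n l)) -` B) \<inter> markov_shift t"
      unfolding A using itin_lab_coarsen[of n m n] by auto
    then show "\<exists>B. A = code m -` B \<inter> markov_shift t" by blast
  qed
qed

lemma algebra_coded_sets: "algebra (markov_shift t) (coded_sets t)"
proof (unfold algebra_iff_Int, intro conjI ballI)
  show "coded_sets t \<subseteq> Pow (markov_shift t)" by (auto simp: coded_sets_def)
  show "{} \<in> coded_sets t" using coded_setsI[of 0 "{}" t] by simp
  fix a assume a: "a \<in> coded_sets t"
  then obtain n B where "a = code n -` B \<inter> markov_shift t" by (auto simp: coded_sets_def)
  then have "markov_shift t - a = code n -` (- B) \<inter> markov_shift t" by auto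
  then show "markov_shift t - a \<in> coded_sets t" using coded_setsI by metis
  fix b assume b: "b \<in> coded_sets t"
  obtain n1 where n1: "\<And>m. m \<ge> n1 \<Longrightarrow> \<exists>B. a = code m -` B \<inter> markov_shift t" by (rule coded_sets_level[OF a]) blast
  obtain n2 where n2: "\<And>m. m \<ge> n2 \<Longrightarrow> \<exists>B. b = code m -` B \<inter> markov_shift t" by (rule coded_sets_level[OF b]) blast
  obtain B1 B2 where "a = code (max n1 n2) -` B1 \<inter> markov_shift t" "b = code (max n1 n2) -` B2 \<inter> markov_shift t"
    using n1[of "max n1 n2"] n2[of "max n1 n2"] by auto
  then have "a \<inter> b = code (max n1 n2) -` (B1 \<inter> B2) \<inter> markov_shift t" by auto
  then show "a \<inter> b \<in> coded_sets t" using coded_setsI by metis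
qed

lemma cylinder_coded: "cylinder t w \<in> coded_sets t"
proof -
  \<comment> \<open>Strictly larger than the index of every letter of \<open>w\<close>: only labels
    below \<open>n\<close> belong to a single letter, the label \<open>n\<close> being shared by all
    later ones.\<close>
  define n where "n = Suc (Max (insert (length w) (to_nat ` set w)))"
  have n: "length w \<le> n" "\<And>a. a \<in> set w \<Longrightarrow> to_nat a < n"
    unfolding n_def by (auto simp: less_Suc_eq_le le_Suc_eq)
  have eq: "cylinder t w = code n -` {l. \<forall>i<length w. l ! i = to_nat (w ! i)} \<inter> markov_shift t"
  proof -
    have "x i = w ! i \<longleftrightarrow> code n x ! i = to_nat (w ! i)" if "i < length w" for x and i
    proof -
      have "code n x ! i = min (to_nat (x i)) n" using that n(1) by (simp add: itin_lab)
      moreover have "to_nat (w ! i) < n" using n(2) that by simp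
      ultimately show ?thesis by (auto simp: min_def)
    qed
    then show ?thesis by (intro set_eqI) (simp only: cylinder_def mem_Collect_eq Int_iff vimage_eq, blast)
  qed
  show ?thesis unfolding eq by (rule coded_setsI)
qed

lemma simple_lab:
  fixes t :: "'a::{countable, discrete_topology} \<Rightarrow> 'a \<Rightarrow> bool"
  assumes "sets M = sets (shift_borel t)"
  shows "simple_function M (lab m)"
  unfolding simple_function_def
proof
  have sp: "space M = markov_shift t" using sets_eq_imp_space_eq[OF assms] by simp
  show "finite (lab m ` space M)" by (rule finite_subset[of _ "{..m}"]) (auto simp: lab_def)
  show "\<forall>v\<in>lab m ` space M. lab m -` {v} \<inter> space M \<in> sets M"
  proof
    fix v
    have "lab m -` {v} \<inter> space M = (\<Union>a\<in>{a. min (to_nat a) m = v}. cylinder t [a])"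
      by (auto simp: lab_def sp cylinder_def)
    also have "\<dots> \<in> sets M" unfolding assms by (intro sets.countable_UN' countableI_type) auto
    finally show "lab m -` {v} \<inter> space M \<in> sets M" .
  qed
qed

lemma sets_coded:
  fixes t :: "'a::{countable, discrete_topology} \<Rightarrow> 'a \<Rightarrow> bool"
  shows "sets (shift_borel t) = sigma_sets (markov_shift t) (coded_sets t)"
proof
  show "sets (shift_borel t) \<subseteq> sigma_sets (markov_shift t) (coded_sets t)"
    unfolding sets_shift_borel using cylinder_coded by (intro sigma_sets_mono) (auto intro: sigma_sets.Basic)
  have "A \<in> sets (shift_borel t)" if A0: "A \<in> coded_sets t" for A
  proof -
    obtain n where "\<And>m. m \<ge> n \<Longrightarrow> \<exists>B. A = code m -` B \<inter> markov_shift t"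
      by (rule coded_sets_level[OF A0]) blast
    then obtain B where A: "A = code n -` B \<inter> markov_shift t" by (meson order_refl)
    have "A = (\<Union>w\<in>{w. cylinder t w \<subseteq> A}. cylinder t w)"
    proof (intro set_eqI iffI)
      fix x assume x: "x \<in> A"
      have "y \<in> A" if y: "y \<in> cylinder t (prefix_of n x)" for y
      proof -
        have "code n y = code n x" using y by (auto simp: itin_lab cylinder_def)
        then show ?thesis using x y by (auto simp: A cylinder_def)
      qed
      then show "x \<in> (\<Union>w\<in>{w. cylinder t w \<subseteq> A}. cylinder t w)" using x in_cylinder_prefix[of x t n] by (auto simp: A)
    qed auto
    moreover have "(\<Union>w\<in>{w. cylinder t w \<subseteq> A}. cylinder t w) \<in> sets (shift_borel t)"
      by (intro sets.countable_UN' countableI_type) auto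
    ultimately show ?thesis by simp
  qed
  then show "sigma_sets (markov_shift t) (coded_sets t) \<subseteq> sets (shift_borel t)"
    using sets.sigma_sets_subset[of "coded_sets t" "shift_borel t"] by auto
qed

text \<open>Two measures are approximated simultaneously because absolute continuity needs a set that is
  close to a given one for both.\<close>

lemma approximation_by_algebra:
  assumes M: "finite_measure M" and N: "finite_measure N" and NM: "sets N = sets M"
    and gen: "sets M = sigma_sets \<Omega> \<A>" and alg: "algebra \<Omega> \<A>"
    and A: "A \<in> sets M" and e: "e > 0"
  shows "\<exists>R\<in>\<A>. measure M (A - R) + measure M (R - A) < e \<and> measure N (A - R) + measure N (R - A) < e"
proof -
  interpret M: finite_measure M by fact
  interpret N: finite_measure N by fact
  interpret alg: algebra \<Omega> \<A> by fact
  have As: "R \<in> sets M" if "R \<in> \<A>" for R using that gen by auto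
  note [simp] = NM
  have "A \<in> sigma_sets \<Omega> \<A>" using A gen by simp
  then show ?thesis using e
  proof (induction arbitrary: e)
    case (Basic a) then show ?case by (intro bexI[of _ a]) auto
  next
    case Empty then show ?case by (intro bexI[of _ "{}"]) auto
  next
    case (Compl a)
    then obtain R where R: "R \<in> \<A>" "measure M (a - R) + measure M (R - a) < e" "measure N (a - R) + measure N (R - a) < e" by blast
    have "\<Omega> - a - (\<Omega> - R) = R - a" "\<Omega> - R - (\<Omega> - a) = a - R"
      using alg.sets_into_space[OF R(1)] sigma_sets_into_sp[OF alg.space_closed Compl.hyps] by auto
    then show ?case using R by (intro bexI[of _ "\<Omega> - R"]) (auto simp: add.commute)
  next
    \<comment> \<open>Monotone convergence cuts the union to finitely many members for both measures
      at the same stage; each of these is then approximated separately.\<close>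
    case (Union a)
    have am: "a i \<in> sets M" for i using Union.hyps gen by auto
    have un: "(\<Union>i. a i) \<in> sets M" using am by auto
    define U where "U n = (\<Union>i<n. a i)" for n
    have Um: "U n \<in> sets M" for n using am by (auto simp: U_def)
    have inc: "incseq U" by (auto simp: incseq_def U_def intro: less_le_trans)
    have UU: "(\<Union>n. U n) = (\<Union>i. a i)" by (auto simp: U_def)
    have "(\<lambda>n. measure M (U n)) \<longlonglongrightarrow> measure M (\<Union>i. a i)" "(\<lambda>n. measure N (U n)) \<longlonglongrightarrow> measure N (\<Union>i. a i)"
      using M.finite_Lim_measure_incseq[OF _ inc] N.finite_Lim_measure_incseq[OF _ inc] Um UU by auto
    then have "eventually (\<lambda>n. dist (measure M (U n)) (measure M (\<Union>i. a i)) < e / 2) sequentially"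
      "eventually (\<lambda>n. dist (measure N (U n)) (measure N (\<Union>i. a i)) < e / 2) sequentially"
      using Union.prems by (auto dest!: tendstoD[where e="e/2"])
    then have "eventually (\<lambda>n. dist (measure M (U n)) (measure M (\<Union>i. a i)) < e / 2 \<and>
      dist (measure N (U n)) (measure N (\<Union>i. a i)) < e / 2) sequentially"
      by eventually_elim auto
    then obtain n where n: "dist (measure M (U n)) (measure M (\<Union>i. a i)) < e / 2" "dist (measure N (U n)) (measure N (\<Union>i. a i)) < e / 2"
      using eventually_happens' sequentially_bot by blast
    have sub: "U n \<subseteq> (\<Union>i. a i)" by (auto simp: U_def)
    have tail: "measure M ((\<Union>i. a i) - U n) < e / 2" "measure N ((\<Union>i. a i) - U n) < e / 2"
    proof -
      have "measure M (\<Union>i. a i) - measure M (U n) < e / 2" "measure N (\<Union>i. a i) - measure N (U n) < e / 2"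
        using n unfolding dist_real_def by linarith+
      then show "measure M ((\<Union>i. a i) - U n) < e / 2" "measure N ((\<Union>i. a i) - U n) < e / 2"
        using M.finite_measure_Diff[OF un Um sub] N.finite_measure_Diff[of "\<Union>i. a i" "U n"] un Um[of n] sub by auto
    qed
    \<comment> \<open>Half of \<open>e\<close> is reserved for the tail of the union, the other half
      is divided among the \<open>n\<close> approximations. \<open>Suc n\<close> avoids division by
      0.\<close>
    define d where "d = e / (2 * real (Suc n))"
    have d: "d > 0" using Union.prems by (simp add: d_def)
    have "\<forall>i. \<exists>R\<in>\<A>. measure M (a i - R) + measure M (R - a i) < d \<and> measure N (a i - R) + measure N (R - a i) < d"
      using Union.IH[OF d] by auto
    then obtain R where R: "\<And>i. R i \<in> \<A>" "\<And>i. measure M (a i - R i) + measure M (R i - a i) < d"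
       "\<And>i. measure N (a i - R i) + measure N (R i - a i) < d" by metis
    define V where "V = (\<Union>i<n. R i)"
    have V: "V \<in> \<A>" unfolding V_def using R(1) by (intro alg.finite_UN) auto
    have bound: "measure L ((\<Union>i. a i) - V) + measure L (V - (\<Union>i. a i)) < e"
      if L: "finite_measure L" "sets L = sets M" and t: "measure L ((\<Union>i. a i) - U n) < e / 2"
        and r: "\<And>i. measure L (a i - R i) + measure L (R i - a i) < d" for L
    proof -
      interpret L: finite_measure L by fact
      note [simp] = L(2)
      have Rm: "R i \<in> sets M" for i using R(1) As by blast
      have "measure L ((\<Union>i. a i) - V) \<le> measure L (((\<Union>i. a i) - U n) \<union> (\<Union>i<n. a i - R i))"
        using un Um am Rm by (intro L.finite_measure_mono) (auto simp: V_def U_def)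
      also have "\<dots> \<le> measure L ((\<Union>i. a i) - U n) + measure L (\<Union>i<n. a i - R i)"
        using un Um am Rm by (intro measure_Un_le) auto
      also have "measure L (\<Union>i<n. a i - R i) \<le> (\<Sum>i<n. measure L (a i - R i))"
        using am Rm by (intro L.finite_measure_subadditive_finite) auto
      finally have 1: "measure L ((\<Union>i. a i) - V) \<le> measure L ((\<Union>i. a i) - U n) + (\<Sum>i<n. measure L (a i - R i))" by simp
      have "measure L (V - (\<Union>i. a i)) \<le> measure L (\<Union>i<n. R i - a i)"
        using am Rm by (intro L.finite_measure_mono) (auto simp: V_def)
      also have "\<dots> \<le> (\<Sum>i<n. measure L (R i - a i))"
        using am Rm by (intro L.finite_measure_subadditive_finite) auto
      finally have 2: "measure L (V - (\<Union>i. a i)) \<le> (\<Sum>i<n. measure L (R i - a i))" .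
      have "(\<Sum>i<n. measure L (a i - R i)) + (\<Sum>i<n. measure L (R i - a i)) \<le> (\<Sum>i<n. d)"
        unfolding sum.distrib[symmetric] using r by (intro sum_mono less_imp_le)
      also have "\<dots> \<le> real (Suc n) * d" using d by (simp add: algebra_simps)
      also have "\<dots> = e / 2" unfolding d_def by (simp del: of_nat_Suc)
      finally show ?thesis using 1 2 t by linarith
    qed
    show ?case using V bound[OF M _ tail(1) R(2)] bound[OF N _ tail(2) R(3)] by (intro bexI[of _ V]) auto
  qed
qed

section \<open>Gibbs measures\<close>

lemma emeasure_prefix_sets:
  fixes t :: "'a::{countable, discrete_topology} \<Rightarrow> 'a \<Rightarrow> bool"
  assumes "sets M = sets (shift_borel t)"
  shows "(\<Union>w\<in>W. cylinder t w) \<in> sets M"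
  unfolding assms by (intro sets.countable_UN' countableI_type) auto

lemma disjoint_cylinders: "disjoint_family_on (cylinder t) (lists_of_length n)"
  by (auto simp: disjoint_family_on_def cylinder_eq)

section \<open>Mixing, ergodicity and rigidity of Gibbs measures\<close>

context markov_potential
begin

text \<open>The constant is a parameter and not existentially quantified, because uniform bounds
  along a sequence have to pass to its limits with the same constant.\<close>

definition gibbs :: "real \<Rightarrow> (nat \<Rightarrow> 'a) measure \<Rightarrow> bool" where
  "gibbs C M \<longleftrightarrow> C \<ge> 1 \<and> (\<forall>w. measure M (cyl w) \<le> C * rho w \<and> rho w \<le> C * measure M (cyl w))"

text \<open>The set where \<open>u\<close> occurs at time 0 and \<open>v\<close> at time
  \<open>m\<close> is the disjoint union of the cylinders of \<open>u @ y @ v\<close> over all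
  middle words \<open>y\<close> of the right length, so \<open>rho_gluing\<close> bounds its mass
  from below.\<close>

lemma gibbs_mixing_cylinders:
  assumes \<mu>: "\<mu> \<in> invariant_measures t" and gb: "gibbs C \<mu>"
  obtains c r0 where "c > 0"
    "\<And>u v m. admissible t u \<Longrightarrow> admissible t v \<Longrightarrow> m \<ge> length u + r0 \<Longrightarrow>
      ennreal c * (emeasure \<mu> (cyl u) * emeasure \<mu> (cyl v)) \<le> emeasure \<mu> (cyl u \<inter> (shift_pow m -` cyl v \<inter> X))"
proof -
  have sets: "sets \<mu> = sets (shift_borel t)" using \<mu> by (simp add: invariant_measures_def)
  interpret prob_space \<mu> using \<mu> by (simp add: invariant_measures_def)
  have C: "C \<ge> 1" and up: "\<And>w. prob (cyl w) \<le> C * rho w" and lo: "\<And>w. rho w \<le> C * prob (cyl w)"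
    using gb by (auto simp: gibbs_def)
  obtain c r0 where c: "c > 0" "r0 \<ge> 1" and glue: "\<And>u v r. admissible t u \<Longrightarrow> admissible t v \<Longrightarrow> r \<ge> r0 \<Longrightarrow>
      ennreal (c * (rho u * rho v)) \<le> (\<integral>\<^sup>+y. ennreal (rho (u @ y @ v)) \<partial>count_space (lists_of_length r))"
    by (rule rho_gluing) blast
  show ?thesis
  \<comment> \<open>The Gibbs bound is used three times: from the masses of \<open>u\<close> and of
    \<open>v\<close> to \<open>rho\<close>, and from \<open>rho\<close> of the glued words back to
    masses.\<close>
  proof (rule that[of "c / C^3" r0])
    show "c / C^3 > 0" using c C by simp
    fix u v m assume u: "admissible t u" and v: "admissible t v" and m: "m \<ge> length u + r0"
    define r where "r = m - length u"
    have r: "r \<ge> r0" "m = length u + r" using m by (auto simp: r_def)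
    have eq: "cyl u \<inter> (shift_pow m -` cyl v \<inter> X) = (\<Union>y\<in>lists_of_length r. cyl (u @ y @ v))"
    proof (intro set_eqI iffI)
      fix x assume x: "x \<in> cyl u \<inter> (shift_pow m -` cyl v \<inter> X)"
      let ?y = "prefix_of r (shift_pow (length u) x)"
      have "shift_pow (length u) x \<in> cyl ?y" using x by (intro in_cylinder_prefix shift_pow_in) auto
      then have "x \<in> cyl (u @ ?y @ v)"
        using x r by (simp add: cylinder_append shift_pow_shift_pow)
      then show "x \<in> (\<Union>y\<in>lists_of_length r. cyl (u @ y @ v))" by (intro UN_I[of ?y]) auto
    next
      fix x assume "x \<in> (\<Union>y\<in>lists_of_length r. cyl (u @ y @ v))"
      then obtain y where "length y = r" "x \<in> cyl (u @ y @ v)" by auto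
      then show "x \<in> cyl u \<inter> (shift_pow m -` cyl v \<inter> X)"
        using r cylinder_subset[of t u] by (auto simp: cylinder_append shift_pow_shift_pow)
    qed
    have dis: "disjoint_family_on (\<lambda>y. cyl (u @ y @ v)) (lists_of_length r)"
      by (auto simp: disjoint_family_on_def cylinder_eq)
    have "c / C^3 * (prob (cyl u) * prob (cyl v)) \<le> c / C^3 * ((C * rho u) * (C * rho v))"
      using c C by (intro mult_left_mono mult_mono up) (auto simp: rho_nonneg)
    also have "\<dots> = (1 / C) * (c * (rho u * rho v))" using C by (simp add: power3_eq_cube)
    finally have "ennreal (c / C^3 * (prob (cyl u) * prob (cyl v))) \<le> ennreal (1 / C) * ennreal (c * (rho u * rho v))"
      using C c by (simp add: ennreal_mult[symmetric] rho_nonneg ennreal_leI)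
    also have "\<dots> \<le> ennreal (1 / C) * (\<integral>\<^sup>+y. ennreal (rho (u @ y @ v)) \<partial>count_space (lists_of_length r))"
      by (intro mult_left_mono glue u v r) auto
    also have "\<dots> = (\<integral>\<^sup>+y. ennreal (1 / C) * ennreal (rho (u @ y @ v)) \<partial>count_space (lists_of_length r))"
      by (simp add: nn_integral_cmult)
    also have "\<dots> \<le> (\<integral>\<^sup>+y. emeasure \<mu> (cyl (u @ y @ v)) \<partial>count_space (lists_of_length r))"
    proof (intro nn_integral_mono)
      fix y
      have "1 / C * rho (u @ y @ v) \<le> prob (cyl (u @ y @ v))" using lo[of "u @ y @ v"] C by (simp add: field_simps)
      then show "ennreal (1 / C) * ennreal (rho (u @ y @ v)) \<le> emeasure \<mu> (cyl (u @ y @ v))"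
        using C by (simp add: emeasure_eq_measure ennreal_mult[symmetric] rho_nonneg ennreal_leI del: times_divide_eq_left)
    qed
    also have "\<dots> = emeasure \<mu> (\<Union>y\<in>lists_of_length r. cyl (u @ y @ v))"
      using dis by (intro emeasure_UN_countable[symmetric]) (auto simp: sets intro: countableI_type)
    finally show "ennreal (c / C^3) * (emeasure \<mu> (cyl u) * emeasure \<mu> (cyl v)) \<le> emeasure \<mu> (cyl u \<inter> (shift_pow m -` cyl v \<inter> X))"
    proof -
      assume *: "ennreal (c / C^3 * (prob (cyl u) * prob (cyl v))) \<le> emeasure \<mu> (\<Union>y\<in>lists_of_length r. cyl (u @ y @ v))"
      have "ennreal (c / C^3) * (ennreal (prob (cyl u)) * ennreal (prob (cyl v))) = ennreal (c / C^3 * (prob (cyl u) * prob (cyl v)))"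
        using c C by (simp add: ennreal_mult del: times_divide_eq_left)
      then show ?thesis using * by (simp only: eq emeasure_eq_measure)
    qed
  qed
qed

text \<open>Coded sets are countable unions of cylinders of one common length, so a single time
  \<open>m\<close> serves all pairs of cylinders and the estimate can be summed. The constant does
  not depend on the sets, which lets it survive approximation in measure.\<close>

lemma gibbs_mixing:
  assumes \<mu>: "\<mu> \<in> invariant_measures t" and gb: "gibbs C \<mu>"
  obtains c where "c > 0" "\<And>A B. A \<in> coded_sets t \<Longrightarrow> B \<in> coded_sets t \<Longrightarrow>
      \<exists>m. c * (measure \<mu> A * measure \<mu> B) \<le> measure \<mu> (A \<inter> (shift_pow m -` B \<inter> X))"
proof -
  have sets: "sets \<mu> = sets (shift_borel t)" using \<mu> by (simp add: invariant_measures_def)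
  interpret prob_space \<mu> using \<mu> by (simp add: invariant_measures_def)
  interpret measure_preserving \<mu> left_shift using \<mu> by (rule invariant_measure_preserving)
  have sp: "space \<mu> = X" using sets_eq_imp_space_eq[OF sets] by simp
  obtain c r0 where c: "c > 0" and mix: "\<And>u v m. admissible t u \<Longrightarrow> admissible t v \<Longrightarrow> m \<ge> length u + r0 \<Longrightarrow>
      ennreal c * (emeasure \<mu> (cyl u) * emeasure \<mu> (cyl v)) \<le> emeasure \<mu> (cyl u \<inter> (shift_pow m -` cyl v \<inter> X))"
    by (rule gibbs_mixing_cylinders[OF \<mu> gb]) blast
  show ?thesis
  proof (rule that[OF c])
    fix A B assume A: "A \<in> coded_sets t" and B: "B \<in> coded_sets t"
    obtain n1 where n1: "\<And>m. m \<ge> n1 \<Longrightarrow> \<exists>D. A = code m -` D \<inter> X" by (rule coded_sets_level[OF A]) blast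
    obtain n2 where n2: "\<And>m. m \<ge> n2 \<Longrightarrow> \<exists>D. B = code m -` D \<inter> X" by (rule coded_sets_level[OF B]) blast
    \<comment> \<open>\<open>Suc\<close> makes the words nonempty, so that an inadmissible word has
      an empty cylinder.\<close>
    define n where "n = Suc (max n1 n2)"
    define m where "m = n + r0"
    have level: "\<exists>W\<subseteq>lists_of_length n. E = (\<Union>w\<in>W. cyl w)" if "E = code n -` D \<inter> X" for E D
    proof (intro exI conjI)
      show "{w. length w = n \<and> cyl w \<subseteq> E} \<subseteq> lists_of_length n" by auto
      show "E = (\<Union>w\<in>{w. length w = n \<and> cyl w \<subseteq> E}. cyl w)"
      proof (intro set_eqI iffI)
        fix x assume x: "x \<in> E"
        have "y \<in> E" if y: "y \<in> cyl (prefix_of n x)" for y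
        proof -
          have "code n y = code n x" using y by (auto simp: itin_lab cylinder_def)
          then show ?thesis using x y that \<open>E = _\<close> by (auto simp: cylinder_def)
        qed
        then show "x \<in> (\<Union>w\<in>{w. length w = n \<and> cyl w \<subseteq> E}. cyl w)"
          using x in_cylinder_prefix[of x t n] \<open>E = _\<close> by (intro UN_I[of "prefix_of n x"]) auto
      qed auto
    qed
    obtain WA where WA: "WA \<subseteq> lists_of_length n" "A = (\<Union>w\<in>WA. cyl w)" 
    proof -
      obtain D where D: "A = code n -` D \<inter> X" using n1[of n] unfolding n_def by (meson le_SucI max.cobounded1)
      from level[OF D] show ?thesis using that by blast
    qed
    obtain WB where WB: "WB \<subseteq> lists_of_length n" "B = (\<Union>w\<in>WB. cyl w)" 
    proof -
      obtain D where D: "B = code n -` D \<inter> X" using n2[of n] unfolding n_def by (meson le_SucI max.cobounded2)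
      from level[OF D] show ?thesis using that by blast
    qed
    have dis: "disjoint_family_on cyl WA" "disjoint_family_on cyl WB"
      using disjoint_cylinders[of t n] WA WB by (auto simp: disjoint_family_on_def subset_iff)
    have eA: "emeasure \<mu> A = (\<integral>\<^sup>+u. emeasure \<mu> (cyl u) \<partial>count_space WA)"
      unfolding WA(2) using dis by (intro emeasure_UN_countable) (auto simp: sets intro: countableI_type)
    have eB: "emeasure \<mu> B = (\<integral>\<^sup>+u. emeasure \<mu> (cyl u) \<partial>count_space WB)"
      unfolding WB(2) using dis by (intro emeasure_UN_countable) (auto simp: sets intro: countableI_type)
    have pre: "shift_pow m -` cyl v \<inter> X \<in> sets \<mu>" for v
      using measurable_sets[OF Tn_measurable, of "cyl v" m] by (simp add: sp sets)
    have "ennreal c * (emeasure \<mu> A * emeasure \<mu> B) =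
      (\<integral>\<^sup>+u. \<integral>\<^sup>+v. ennreal c * (emeasure \<mu> (cyl u) * emeasure \<mu> (cyl v)) \<partial>count_space WB \<partial>count_space WA)"
      unfolding eA eB by (simp add: nn_integral_cmult nn_integral_multc)
    also have "\<dots> \<le> (\<integral>\<^sup>+u. \<integral>\<^sup>+v. emeasure \<mu> (cyl u \<inter> (shift_pow m -` cyl v \<inter> X)) \<partial>count_space WB \<partial>count_space WA)"
    proof (intro nn_integral_mono)
      fix u v assume "u \<in> space (count_space WA)" "v \<in> space (count_space WB)"
      then have uv: "length u = n" "length v = n" using WA WB by auto
      show "ennreal c * (emeasure \<mu> (cyl u) * emeasure \<mu> (cyl v)) \<le> emeasure \<mu> (cyl u \<inter> (shift_pow m -` cyl v \<inter> X))"
      proof (cases "admissible t u \<and> admissible t v")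
        case True then show ?thesis using uv by (intro mix) (auto simp: m_def)
      next
        case False
        then have "cyl u = {} \<or> cyl v = {}" using cyl_ne[of u] cyl_ne[of v] uv by (auto simp: n_def)
        then show ?thesis by auto
      qed
    qed
    also have "\<dots> = (\<integral>\<^sup>+u. emeasure \<mu> (\<Union>v\<in>WB. cyl u \<inter> (shift_pow m -` cyl v \<inter> X)) \<partial>count_space WA)"
    proof (intro nn_integral_cong emeasure_UN_countable[symmetric])
      fix u show "disjoint_family_on (\<lambda>v. cyl u \<inter> (shift_pow m -` cyl v \<inter> X)) WB"
        using dis(2) by (fastforce simp: disjoint_family_on_def)
    qed (use pre in \<open>auto simp: sets intro: countableI_type\<close>)
    also have "\<dots> = emeasure \<mu> (\<Union>u\<in>WA. \<Union>v\<in>WB. cyl u \<inter> (shift_pow m -` cyl v \<inter> X))"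
    proof (intro emeasure_UN_countable[symmetric])
      show "disjoint_family_on (\<lambda>u. \<Union>v\<in>WB. cyl u \<inter> (shift_pow m -` cyl v \<inter> X)) WA"
        using dis(1) by (fastforce simp: disjoint_family_on_def)
      show "(\<Union>v\<in>WB. cyl u \<inter> (shift_pow m -` cyl v \<inter> X)) \<in> sets \<mu>" for u
        using pre by (intro sets.countable_UN' countableI_type) (auto simp: sets)
    qed (auto intro: countableI_type)
    also have "(\<Union>u\<in>WA. \<Union>v\<in>WB. cyl u \<inter> (shift_pow m -` cyl v \<inter> X)) = A \<inter> (shift_pow m -` B \<inter> X)"
      unfolding WA(2) WB(2) by auto
    finally have "c * (prob A * prob B) \<le> prob (A \<inter> (shift_pow m -` B \<inter> X))"
      using c by (simp add: emeasure_eq_measure ennreal_mult[symmetric])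
    then show "\<exists>m. c * (prob A * prob B) \<le> prob (A \<inter> (shift_pow m -` B \<inter> X))" ..
  qed
qed

text \<open>No point outside \<open>B\<close> enters \<open>B\<close> later, up to null sets,
  whereas mixing forces a fixed proportion of \<open>prob (X - B) * prob B\<close> to do so. Hence
  this product vanishes. One-sided invariance modulo null sets is the form in which the superlevel
  set of a density will satisfy the hypothesis.\<close>

lemma gibbs_ergodic:
  assumes \<mu>: "\<mu> \<in> invariant_measures t" and gb: "gibbs C \<mu>"
    and B: "B \<in> sets \<mu>" and inv: "measure \<mu> (left_shift -` B \<inter> space \<mu> - B) = 0"
  shows "measure \<mu> B = 0 \<or> measure \<mu> B = 1"
proof -
  have sets: "sets \<mu> = sets (shift_borel t)" using \<mu> by (simp add: invariant_measures_def)
  interpret measure_preserving \<mu> left_shift using \<mu> by (rule invariant_measure_preserving)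
  have sp: "space \<mu> = X" using sets_eq_imp_space_eq[OF sets] by simp
  have pre: "shift_pow m -` E \<inter> space \<mu> \<in> sets \<mu>" if "E \<in> sets \<mu>" for m E
    by (rule measurable_sets[OF Tn_measurable that])
  \<comment> \<open>The mixing time depends on the approximating coded set, so the null discrepancy
    is needed at all times.\<close>
  have zero: "prob (shift_pow m -` B \<inter> space \<mu> - B) = 0" for m
  proof (induction m)
    case 0
    have "shift_pow 0 -` B \<inter> space \<mu> - B = {}" by auto
    then show ?case by (simp only: measure_empty)
  next
    case (Suc m)
    let ?D = "left_shift -` B \<inter> space \<mu> - B"
    have D: "?D \<in> sets \<mu>" using B pre[of B 1] by auto
    have sub: "shift_pow (Suc m) -` B \<inter> space \<mu> - B \<subseteq> (shift_pow m -` ?D \<inter> space \<mu>) \<union> (shift_pow m -` B \<inter> space \<mu> - B)"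
      using Tn_space by auto
    have "prob (shift_pow (Suc m) -` B \<inter> space \<mu> - B) \<le> prob ((shift_pow m -` ?D \<inter> space \<mu>) \<union> (shift_pow m -` B \<inter> space \<mu> - B))"
      using B D pre by (intro finite_measure_mono[OF sub]) auto
    also have "\<dots> \<le> prob (shift_pow m -` ?D \<inter> space \<mu>) + prob (shift_pow m -` B \<inter> space \<mu> - B)"
      using B D pre by (intro measure_Un_le) auto
    also have "\<dots> = 0" unfolding Tn_invariant[OF D] using Suc inv by simp
    finally show ?case by (simp add: measure_le_0_iff del: funpow.simps)
  qed
  obtain c where c: "c > 0" and mix: "\<And>A B. A \<in> coded_sets t \<Longrightarrow> B \<in> coded_sets t \<Longrightarrow>
      \<exists>m. c * (prob A * prob B) \<le> prob (A \<inter> (shift_pow m -` B \<inter> X))"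
    by (rule gibbs_mixing[OF \<mu> gb]) blast
  let ?b = "prob B"
  have b: "0 \<le> ?b" "?b \<le> 1" by auto
  have bound: "c * (?b * (1 - ?b)) \<le> (2 + 2 * c) * e" if e: "e > 0" for e
  proof -
    obtain R where R: "R \<in> coded_sets t" "prob (B - R) + prob (R - B) < e"
      using approximation_by_algebra[OF finite_measure_axioms finite_measure_axioms refl _ algebra_coded_sets B e, of t] sets sets_coded[of t] by auto
    have Rs: "R \<in> sets \<mu>" using R(1) sets sets_coded[of t] by auto
    interpret alg: algebra X "coded_sets t" by (rule algebra_coded_sets)
    obtain m where m: "c * (prob (X - R) * prob R) \<le> prob ((X - R) \<inter> (shift_pow m -` R \<inter> X))"
      using mix[of "X - R" R] R(1) by auto
    let ?V = "shift_pow m -` (R - B) \<inter> space \<mu>"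
    \<comment> \<open>A point outside \<open>R\<close> whose \<open>m\<close>-th image is in
      \<open>R\<close> enters \<open>B\<close> from outside, or lies in \<open>B - R\<close>, or has
      its image in \<open>R - B\<close>. The first event is null and the others are approximation
      errors.\<close>
    have "prob ((X - R) \<inter> (shift_pow m -` R \<inter> X)) \<le> prob ((shift_pow m -` B \<inter> space \<mu> - B) \<union> ((B - R) \<union> ?V))"
      using B Rs pre by (intro finite_measure_mono) (auto simp: sp)
    also have "\<dots> \<le> prob (shift_pow m -` B \<inter> space \<mu> - B) + prob ((B - R) \<union> ?V)"
      using B Rs pre[of B] pre[of "R - B"] by (intro measure_Un_le) auto
    also have "prob ((B - R) \<union> ?V) \<le> prob (B - R) + prob ?V"
      using B Rs pre[of "R - B"] by (intro measure_Un_le) auto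
    also have "prob ?V = prob (R - B)" using B Rs by (intro Tn_invariant) auto
    finally have 1: "c * (prob (X - R) * prob R) \<le> e" using m R(2) zero by simp
    have r: "prob (X - R) = 1 - prob R" using prob_compl[OF Rs] sp by simp
    have "prob B \<le> prob (R \<union> (B - R))" using B Rs by (intro finite_measure_mono) auto
    also have "\<dots> \<le> prob R + prob (B - R)" using B Rs by (intro measure_Un_le) auto
    finally have br: "?b \<le> prob R + e" using R(2) measure_nonneg[of \<mu> "R - B"] by linarith
    have "prob R \<le> prob (B \<union> (R - B))" using B Rs by (intro finite_measure_mono) auto
    also have "\<dots> \<le> ?b + prob (R - B)" using B Rs by (intro measure_Un_le) auto
    finally have rb: "prob R \<le> ?b + e" using R(2) measure_nonneg[of \<mu> "B - R"] by linarith
    have "?b * (1 - ?b) \<le> (prob R + e) * (1 - ?b)" using br b by (intro mult_right_mono) auto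
    also have "\<dots> \<le> prob R * (1 - ?b) + e" using b e by (simp add: algebra_simps)
    also have "prob R * (1 - ?b) \<le> prob R * (1 - prob R + e)" using rb by (intro mult_left_mono) auto
    also have "prob R * (1 - prob R + e) \<le> prob (X - R) * prob R + e"
      using e mult_right_mono[of "prob R" 1 e] by (simp add: r algebra_simps)
    finally have "?b * (1 - ?b) \<le> prob (X - R) * prob R + 2 * e" by simp
    then have "c * (?b * (1 - ?b)) \<le> c * (prob (X - R) * prob R + 2 * e)" using c by (intro mult_left_mono) auto
    also have "\<dots> \<le> (2 + 2 * c) * e" using 1 e by (simp add: algebra_simps)
    finally show ?thesis .
  qed
  have "c * (?b * (1 - ?b)) \<le> 0"
  proof (rule field_le_epsilon)
    fix e :: real assume e: "e > 0"
    have "c * (?b * (1 - ?b)) \<le> (2 + 2 * c) * (e / (2 + 2 * c))" using e c by (intro bound) auto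
    then show "c * (?b * (1 - ?b)) \<le> 0 + e" using c by simp
  qed
  moreover have "0 \<le> ?b * (1 - ?b)" using b by (intro mult_nonneg_nonneg) auto
  moreover from calculation have "?b * (1 - ?b) \<le> 0" using c by (metis mult_le_cancel_left_pos mult_zero_right)
  ultimately have "?b * (1 - ?b) = 0" by (intro antisym)
  then show ?thesis by auto
qed

text \<open>Invariance is tested on the single set where the density exceeds 1, which avoids proving
  that the density is an invariant function. This set is invariant modulo null sets, so by
  ergodicity the density is almost everywhere at most 1 or almost everywhere greater than 1; having
  integral 1, it equals 1.\<close>

lemma gibbs_absolutely_continuous_eq:
  assumes \<mu>: "\<mu> \<in> invariant_measures t" and gb: "gibbs C \<mu>"
    and \<nu>: "\<nu> \<in> invariant_measures t" and ac: "absolutely_continuous \<mu> \<nu>"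
  shows "\<nu> = \<mu>"
proof -
  have sets: "sets \<mu> = sets (shift_borel t)" "sets \<nu> = sets \<mu>" using \<mu> \<nu> by (auto simp: invariant_measures_def)
  interpret measure_preserving \<mu> left_shift using \<mu> by (rule invariant_measure_preserving)
  interpret N: measure_preserving \<nu> left_shift using \<nu> by (rule invariant_measure_preserving)
  have sp: "space \<nu> = space \<mu>" using sets_eq_imp_space_eq[OF sets(2)] .
  obtain f where f[measurable]: "f \<in> borel_measurable \<mu>" and fd: "density \<mu> f = \<nu>"
    using Radon_Nikodym[OF ac sets(2)] by auto
  have em: "emeasure \<nu> E = (\<integral>\<^sup>+x. f x * indicator E x \<partial>\<mu>)" if "E \<in> sets \<mu>" for E
    unfolding fd[symmetric] using that by (simp add: emeasure_density)
  have one: "(\<integral>\<^sup>+x. f x \<partial>\<mu>) = 1"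
  proof -
    have "(\<integral>\<^sup>+x. f x \<partial>\<mu>) = (\<integral>\<^sup>+x. f x * indicator (space \<mu>) x \<partial>\<mu>)" by (intro nn_integral_cong) auto
    then show ?thesis using em[of "space \<mu>"] N.emeasure_space_1 sp by simp
  qed
  define A where "A = {x \<in> space \<mu>. f x > 1}"
  have A[measurable]: "A \<in> sets \<mu>" unfolding A_def by measurable
  let ?T = "left_shift -` A \<inter> space \<mu>"
  have T[measurable]: "?T \<in> sets \<mu>" by (rule measurable_sets[OF T_measurable A])
  have \<mu>eq: "measure \<mu> (?T - A) = measure \<mu> (A - ?T)"
  proof -
    have "measure \<mu> (?T - A) = measure \<mu> ?T - measure \<mu> (?T \<inter> A)" "measure \<mu> (A - ?T) = measure \<mu> A - measure \<mu> (?T \<inter> A)"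
      by (auto simp: finite_measure_Diff' Int_commute)
    then show ?thesis using T_invariant[OF A] by simp
  qed
  have \<nu>eq: "measure \<nu> (?T - A) = measure \<nu> (A - ?T)"
  proof -
    have "measure \<nu> (?T - A) = measure \<nu> ?T - measure \<nu> (?T \<inter> A)" "measure \<nu> (A - ?T) = measure \<nu> A - measure \<nu> (?T \<inter> A)"
      using A T sets(2) by (auto simp: N.finite_measure_Diff' Int_commute)
    then show ?thesis using N.T_invariant[of A] A sets(2) sp by simp
  qed
  \<comment> \<open>On \<open>?T - A\<close> the density is at most 1. Both measures give
    \<open>?T - A\<close> and \<open>A - ?T\<close> equal masses, so the inequality carries over to
    \<open>A - ?T\<close>, where the density exceeds 1; that set must be null.\<close>
  have "emeasure \<nu> (?T - A) \<le> emeasure \<mu> (?T - A)"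
  proof -
    have "emeasure \<nu> (?T - A) \<le> (\<integral>\<^sup>+x. indicator (?T - A) x \<partial>\<mu>)"
      unfolding em[OF sets.Diff[OF T A]] by (intro nn_integral_mono) (auto simp: A_def split: split_indicator)
    then show ?thesis by simp
  qed
  then have le: "emeasure \<nu> (A - ?T) \<le> emeasure \<mu> (A - ?T)"
    unfolding emeasure_eq_measure N.emeasure_eq_measure \<mu>eq \<nu>eq .
  have "AE x in \<mu>. f x * indicator (A - ?T) x \<le> indicator (A - ?T) x"
  proof (rule ccontr)
    assume n: "\<not> ?thesis"
    have "(\<integral>\<^sup>+x. indicator (A - ?T) x \<partial>\<mu>) < (\<integral>\<^sup>+x. f x * indicator (A - ?T) x \<partial>\<mu>)"
      using n by (intro nn_integral_less) (auto simp: A_def emeasure_eq_measure split: split_indicator)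
    then show False using le em[of "A - ?T"] by (simp add: emeasure_eq_measure)
  qed
  then have "AE x in \<mu>. x \<notin> A - ?T"
    by eventually_elim (auto simp: A_def split: split_indicator_asm)
  then have "emeasure \<mu> (A - ?T) = 0" by (subst (asm) AE_iff_measurable[of "A - ?T"]) (auto dest: sets.sets_into_space[OF A, THEN subsetD])
  then have "measure \<mu> (?T - A) = 0" using \<mu>eq by (simp add: measure_def)
  from gibbs_ergodic[OF \<mu> gb A this] have "AE x in \<mu>. f x = 1"
  proof
    assume "prob A = 0"
    then have "A \<in> null_sets \<mu>" using A by (simp add: null_sets_def emeasure_eq_measure)
    then have "AE x in \<mu>. x \<notin> A" by (rule AE_not_in)
    then have le1: "AE x in \<mu>. f x \<le> 1" by (auto simp: A_def not_less)
    have "AE x in \<mu>. 1 \<le> f x"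
    proof (rule ccontr)
      assume "\<not> ?thesis"
      then have "(\<integral>\<^sup>+x. f x \<partial>\<mu>) < (\<integral>\<^sup>+x. 1 \<partial>\<mu>)" using le1 one by (intro nn_integral_less) auto
      then show False using one by (simp add: emeasure_space_1)
    qed
    with le1 show ?thesis by eventually_elim auto
  next
    assume "prob A = 1"
    then have gt: "AE x in \<mu>. x \<in> A" using A by (simp add: AE_in_set_eq_1)
    then have le1: "AE x in \<mu>. 1 \<le> f x" by eventually_elim (auto simp: A_def)
    have "\<not> (AE x in \<mu>. f x \<le> 1)"
    proof
      assume "AE x in \<mu>. f x \<le> 1"
      with gt have "AE x in \<mu>. False" by eventually_elim (auto simp: A_def)
      then show False by simp
    qed
    then have "(\<integral>\<^sup>+x. 1 \<partial>\<mu>) < (\<integral>\<^sup>+x. f x \<partial>\<mu>)" using le1 by (intro nn_integral_less) (auto simp: emeasure_space_1)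
    then show ?thesis using one by (simp add: emeasure_space_1)
  qed
  then have "density \<mu> f = density \<mu> (\<lambda>_. 1)" by (intro density_cong) auto
  then show ?thesis using fd by (simp add: density_1)
qed

end

section \<open>Measures with prescribed cylinder masses\<close>

text \<open>The Ionescu-Tulcea construction with transition probabilities
  \<open>c (w @ [a]) / c w\<close>: consistency on the right says that they sum to 1. This yields
  countable additivity without compactness.\<close>

lemma ex_measure_prefix:
  fixes c :: "'a::countable list \<Rightarrow> real"
  assumes nonneg: "\<And>w. c w \<ge> 0" and Nil: "c [] = 1"
    and step: "\<And>w. (\<integral>\<^sup>+a. ennreal (c (w @ [a])) \<partial>count_space UNIV) = ennreal (c w)"
  obtains N :: "(nat \<Rightarrow> 'a) measure" where "prob_space N" "sets N = sets (PiM UNIV (\<lambda>_. count_space UNIV))"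
    "\<And>w. emeasure N {x. prefix_of (length w) x = w} = ennreal (c w)"
proof -
  define M where "M = (\<lambda>i::nat. count_space (UNIV :: 'a set))"
  \<comment> \<open>After a prefix of mass 0 the next letter is put at an arbitrary point, only to
    keep the kernel a probability.\<close>
  define q where "q i \<omega> a = (if c (map \<omega> [0..<i]) > 0 then ennreal (c (map \<omega> [0..<i] @ [a]) / c (map \<omega> [0..<i]))
    else indicator {undefined} a)" for i \<omega> a
  define P where "P i \<omega> = density (count_space (UNIV :: 'a set)) (q i \<omega>)" for i \<omega>
  \<comment> \<open>Over finitely many coordinates of a countable alphabet the product
    \<sigma>-algebra is discrete. All kernels are then measurable, and the finite-dimensional laws
    are determined by their values on singletons.\<close>
  have PiM_eq: "PiM {0..<i} M = count_space (PiE {0..<i} (\<lambda>_. UNIV))" for i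
    unfolding M_def by (intro count_space_PiM_finite) auto
  have q1: "(\<integral>\<^sup>+a. q i \<omega> a \<partial>count_space UNIV) = 1" for i \<omega>
  proof (cases "c (map \<omega> [0..<i]) > 0")
    case True
    let ?w = "map \<omega> [0..<i]"
    have "(\<integral>\<^sup>+a. q i \<omega> a \<partial>count_space UNIV) = (\<integral>\<^sup>+a. ennreal (c (?w @ [a])) * ennreal (1 / c ?w) \<partial>count_space UNIV)"
      using True by (simp add: q_def ennreal_mult[symmetric] nonneg)
    also have "\<dots> = ennreal (c ?w) * ennreal (1 / c ?w)"
      using step by (simp add: nn_integral_multc)
    finally show ?thesis using True by (simp add: ennreal_mult[symmetric])
  next
    case False then show ?thesis by (simp add: q_def)
  qed
  have Pp: "prob_space (P i \<omega>)" for i \<omega>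
    by (rule prob_spaceI) (simp add: P_def emeasure_density q1 cong: nn_integral_cong)
  interpret Ionescu_Tulcea P M
  proof (rule Ionescu_Tulcea.intro)
    show "P i \<in> measurable (PiM {0..<i} M) (subprob_algebra (M i))" for i
      unfolding PiM_eq measurable_count_space_eq1
      by (auto simp: space_subprob_algebra prob_space_imp_subprob_space[OF Pp]) (simp_all add: P_def M_def)
  qed (rule Pp)
  have Csing: "emeasure (C 0 n (\<lambda>_. undefined)) {f} = ennreal (c (map f [0..<n]))"
    if "f \<in> PiE {0..<n} (\<lambda>_. UNIV)" for n f
    using that
  proof (induction n arbitrary: f)
    case 0
    then show ?case by (simp add: Nil PiM_eq[of 0, simplified] emeasure_return)
  next
    case (Suc n)
    let ?u = "\<lambda>_::nat. undefined :: 'a"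
    define g where "g = restrict f {0..<n}"
    have g: "g \<in> PiE {0..<n} (\<lambda>_. UNIV)" by (auto simp: g_def)
    have mg: "map g [0..<n] = map f [0..<n]" by (simp add: g_def)
    have u: "?u \<in> space (PiM {0..<0} M)" by (simp add: PiM_eq)
    have sC: "sets (C 0 n ?u) = sets (PiM {0..<n} M)" using sets_C[OF u, of n] by simp
    have spC: "space (C 0 n ?u) = space (PiM {0..<n} M)" using sets_eq_imp_space_eq[OF sC] .
    have fs: "{f} \<in> sets (PiM {0..<Suc n} M)" using Suc.prems by (simp add: PiM_eq)
    have eP: "eP n \<in> measurable (C 0 n ?u) (subprob_algebra (PiM {0..<Suc n} M))"
      using measurable_eP[of n] by (simp only: measurable_cong_sets[OF sC refl])
    have "emeasure (C 0 (Suc n) ?u) {f} = (\<integral>\<^sup>+\<omega>. emeasure (eP n \<omega>) {f} \<partial>C 0 n ?u)"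
      using emeasure_bind[OF _ eP fs] spC by (simp add: PiM_eq) (metis PiE_eq_empty_iff UNIV_not_empty)
    also have "\<dots> = (\<integral>\<^sup>+\<omega>. q n g (f n) * indicator {g} \<omega> \<partial>C 0 n ?u)"
    proof (intro nn_integral_cong)
      fix \<omega> assume "\<omega> \<in> space (C 0 n ?u)"
      then have w: "\<omega> \<in> space (PiM {0..<n} M)" by (simp add: spC)
      then have we: "\<omega> \<in> PiE {0..<n} (\<lambda>_. UNIV)" by (simp add: PiM_eq)
      have "emeasure (eP n \<omega>) {f} = emeasure (P n \<omega>) ((\<lambda>x. fun_upd \<omega> n x) -` {f} \<inter> space (M n))"
        by (rule emeasure_eP[OF w fs])
      also have "(\<lambda>x. fun_upd \<omega> n x) -` {f} \<inter> space (M n) = (if \<omega> = g then {f n} else {})"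
      proof -
        have "fun_upd \<omega> n x = f \<longleftrightarrow> \<omega> = g \<and> x = f n" for x
        proof
          assume eq: "fun_upd \<omega> n x = f"
          have "\<omega> = g"
          proof
            fix i show "\<omega> i = g i"
              using fun_cong[OF eq, of i] we unfolding g_def by (cases "i < n") (auto simp: fun_eq_iff PiE_iff extensional_def)
          qed
          then show "\<omega> = g \<and> x = f n" using eq by auto
        next
          assume *: "\<omega> = g \<and> x = f n"
          show "fun_upd \<omega> n x = f"
          proof
            fix i show "fun_upd \<omega> n x i = f i"
              using * Suc.prems unfolding g_def by (cases "i < n"; cases "i = n") (auto simp: PiE_iff extensional_def)
          qed
        qed
        then show ?thesis by (auto simp: M_def)
      qed
      also have "emeasure (P n \<omega>) (if \<omega> = g then {f n} else {}) = q n g (f n) * indicator {g} \<omega>"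
        by (auto simp: P_def emeasure_density nn_integral_count_space_indicator[symmetric]
            nn_integral_count_space_finite mult.commute)
      finally show "emeasure (eP n \<omega>) {f} = q n g (f n) * indicator {g} \<omega>" .
    qed
    also have "\<dots> = q n g (f n) * emeasure (C 0 n ?u) {g}"
      using g by (intro nn_integral_cmult_indicator) (simp add: sC PiM_eq)
    also have "\<dots> = q n g (f n) * ennreal (c (map f [0..<n]))" using Suc.IH[OF g] mg by simp
    also have "\<dots> = ennreal (c (map f [0..<n] @ [f n]))"
    proof (cases "c (map f [0..<n]) > 0")
      case True then show ?thesis unfolding q_def mg by (simp add: ennreal_mult[symmetric] nonneg)
    next
      case False
      then have 0: "c (map f [0..<n]) = 0" using nonneg[of "map f [0..<n]"] by simp
      have "ennreal (c (map f [0..<n] @ [f n])) \<le> (\<integral>\<^sup>+a. ennreal (c (map f [0..<n] @ [a])) \<partial>count_space UNIV)"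
        by (rule nn_integral_ge_point) simp
      then have "ennreal (c (map f [0..<n] @ [f n])) = 0" using step[of "map f [0..<n]"] 0 by simp
      then show ?thesis using 0 by simp
    qed
    finally show ?case by simp
  qed
  show ?thesis
  proof (rule that[of PF.lim])
    have sets_lim: "sets PF.lim = sets (PiM UNIV (\<lambda>_. count_space UNIV))" unfolding PF.sets_lim by (simp add: M_def)
    then show "sets PF.lim = sets (PiM UNIV (\<lambda>_. count_space UNIV))" .
    have prefix: "emeasure PF.lim {x. prefix_of (length w) x = w} = ennreal (c w)" for w
    proof -
      define n where "n = length w"
      define f where "f = (\<lambda>i\<in>{0..<n}. w ! i)"
      have f: "f \<in> PiE {0..<n} (\<lambda>_. UNIV)" by (auto simp: f_def)
      have mf: "map f [0..<n] = w" by (auto simp: f_def n_def intro!: nth_equalityI)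
      have fs: "{f} \<in> sets (PiM {0..<n} M)" using f by (simp add: PiM_eq)
      have "emeasure PF.lim (PF.emb UNIV {0..<n} {f}) = emeasure (CI {0..<n}) {f}"
        by (rule lim[OF _ fs]) simp
      also have "\<dots> = emeasure (C 0 n (\<lambda>_. undefined)) (PF.emb {0..<n} {0..<n} {f})"
        by (rule emeasure_CI[OF _ fs]) simp
      also have "PF.emb {0..<n} {0..<n} {f} = {f}"
        using f by (intro prod_emb_id) (auto simp: M_def)
      also have "emeasure (C 0 n (\<lambda>_. undefined)) {f} = ennreal (c w)" using Csing[OF f] mf by simp
      also have "PF.emb UNIV {0..<n} {f} = {x. prefix_of n x = w}"
      proof -
        have "restrict x {0..<n} = f \<longleftrightarrow> prefix_of n x = w" for x
        proof
          assume "restrict x {0..<n} = f"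
          then have "map (restrict x {0..<n}) [0..<n] = w" using mf by simp
          moreover have "map (restrict x {0..<n}) [0..<n] = prefix_of n x" by (intro map_cong) auto
          ultimately show "prefix_of n x = w" by simp
        next
          assume "prefix_of n x = w"
          then have "x i = w ! i" if "i < n" for i using that by (metis add_0 diff_zero length_upt nth_map nth_upt)
          then show "restrict x {0..<n} = f" by (auto simp: f_def fun_eq_iff)
        qed
        then show ?thesis by (auto simp: prod_emb_def M_def PiE_UNIV_domain)
      qed
      finally show ?thesis by (simp add: n_def)
    qed
    then show "emeasure PF.lim {x. prefix_of (length w) x = w} = ennreal (c w)" for w .
    have "space PF.lim = UNIV" unfolding PF.space_lim by (simp add: M_def space_PiM)
    then show "prob_space PF.lim" using prefix[of "[]"] Nil by (intro prob_spaceI) simp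
  qed
qed

lemma sets_prefix:
  "{x. prefix_of (length w) x = w} \<in> sets (PiM UNIV (\<lambda>_. count_space (UNIV :: 'a::countable set)))"
proof -
  have "{x. prefix_of (length w) x = w} = {x \<in> space (PiM UNIV (\<lambda>_. count_space UNIV)). \<forall>i<length w. x i = w ! i}"
    by (auto simp: space_PiM intro!: nth_equalityI) (metis add_0 diff_zero length_upt nth_map nth_upt)
  also have "\<dots> \<in> sets (PiM UNIV (\<lambda>_. count_space UNIV))" by measurable
  finally show ?thesis .
qed

lemma disjoint_cylinders_Cons: "disjoint_family_on (\<lambda>a. cylinder t (a # w)) A"
proof -
  have "x 0 = a" if "x \<in> cylinder t (a # w)" for x a
    using that by (auto simp: cylinder_def dest!: spec[of _ 0])
  then show ?thesis unfolding disjoint_family_on_def by (metis disjoint_iff)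
qed

lemma disjoint_cylinders_snoc: "disjoint_family_on (\<lambda>a. cylinder t (w @ [a])) A"
proof -
  have "x (length w) = a" if "x \<in> cylinder t (w @ [a])" for x a
    using that by (auto simp: cylinder_def dest!: spec[of _ "length w"])
  then show ?thesis unfolding disjoint_family_on_def by (metis disjoint_iff)
qed

text \<open>Each condition has one purpose: consistency on the right gives existence, consistency on
  the left gives invariance under the shift, and vanishing on empty cylinders places the mass on the
  shift space.\<close>

lemma ex_markov_measure:
  fixes t :: "'a::{countable, discrete_topology} \<Rightarrow> 'a \<Rightarrow> bool"
  assumes nonneg: "\<And>w. c w \<ge> 0" and Nil: "c [] = 1"
    and right: "\<And>w. (\<integral>\<^sup>+a. ennreal (c (w @ [a])) \<partial>count_space UNIV) = ennreal (c w)"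
    and left: "\<And>w. (\<integral>\<^sup>+a. ennreal (c (a # w)) \<partial>count_space UNIV) = ennreal (c w)"
    and empty: "\<And>w. cylinder t w = {} \<Longrightarrow> c w = 0"
  obtains \<mu> where "\<mu> \<in> invariant_measures t" "\<And>w. measure \<mu> (cylinder t w) = c w"
proof -
  let ?X = "markov_shift t"
  obtain N :: "(nat \<Rightarrow> 'a) measure" where N: "prob_space N" "sets N = sets (PiM UNIV (\<lambda>_. count_space UNIV))"
    "\<And>w. emeasure N {x. prefix_of (length w) x = w} = ennreal (c w)"
    by (rule ex_measure_prefix[OF nonneg Nil right]) blast
  interpret N: prob_space N by fact
  have spN: "space N = UNIV" using sets_eq_imp_space_eq[OF N(2)] by (simp add: space_PiM)
  have pre[simp]: "{x. prefix_of (length w) x = w} \<in> sets N" for w using sets_prefix N(2) by blast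
  \<comment> \<open>A sequence outside the shift space contains a forbidden transition, hence has a
    prefix with empty cylinder. There are countably many such prefixes, all of mass 0.\<close>
  have compl: "- ?X = (\<Union>w\<in>{w. cylinder t w = {}}. {x. prefix_of (length w) x = w})"
  proof (intro set_eqI iffI)
    fix x assume "x \<in> - ?X"
    then obtain i where i: "\<not> t (x i) (x (Suc i))" by (auto simp: markov_shift_def)
    have "cylinder t (prefix_of (Suc (Suc i)) x) = {}"
    proof (rule ccontr)
      assume "cylinder t (prefix_of (Suc (Suc i)) x) \<noteq> {}"
      then obtain y where y: "y \<in> cylinder t (prefix_of (Suc (Suc i)) x)" by auto
      then have "y j = x j" if "j < Suc (Suc i)" for j using that unfolding cylinder_def by (auto simp del: upt_Suc)
      then have "t (x i) (x (Suc i))" using y unfolding cylinder_def markov_shift_def by (auto simp del: upt_Suc) (metis lessI less_SucI)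
      then show False using i by simp
    qed
    then show "x \<in> (\<Union>w\<in>{w. cylinder t w = {}}. {x. prefix_of (length w) x = w})"
      by (intro UN_I[of "prefix_of (Suc (Suc i)) x"]) (auto simp del: upt_Suc)
  next
    fix x assume "x \<in> (\<Union>w\<in>{w. cylinder t w = {}}. {x. prefix_of (length w) x = w})"
    then obtain w where w: "cylinder t w = {}" "prefix_of (length w) x = w" by auto
    show "x \<in> - ?X"
    proof
      assume "x \<in> ?X"
      then have "x \<in> cylinder t w" using w(2) by (simp add: cylinder_eq)
      then show False using w(1) by simp
    qed
  qed
  have Xc: "- ?X \<in> null_sets N" unfolding compl
  proof (intro null_sets_UN' countableI_type)
    fix w assume "w \<in> {w. cylinder t w = {}}"
    then have "c w = 0" using empty by auto
    then show "{x. prefix_of (length w) x = w} \<in> null_sets N" using N(3)[of w] by (intro null_setsI) auto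
  qed
  then have "- (- ?X) \<in> sets N" using sets.Diff[OF sets.top[of N], of "- ?X"] by (simp add: spN null_setsD2 Compl_eq_Diff_UNIV)
  then have X[simp]: "?X \<in> sets N" by simp
  have AEX: "AE x in N. x \<in> ?X" using AE_not_in[OF Xc] by simp
  have "N.prob (- ?X) = 0" using Xc by (simp add: measure_def null_setsD1)
  then have "?X \<noteq> {}" using N.prob_space spN by auto
  then obtain x0 where x0: "x0 \<in> ?X" by auto
  \<comment> \<open>A retraction onto the shift space that differs from the identity only on a null
    set; pushing forward along it gives a measure on \<open>shift_borel t\<close>.\<close>
  define g where "g x = (if x \<in> ?X then x else x0)" for x
  have gX: "g x \<in> ?X" for x using x0 by (simp add: g_def)
  have gcyl: "g -` cylinder t w \<inter> space N = ({x. prefix_of (length w) x = w} \<inter> ?X) \<union> (if x0 \<in> cylinder t w then - ?X else {})" for w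
    by (auto simp: g_def cylinder_eq spN)
  have g: "g \<in> measurable N (shift_borel t)"
  proof (rule measurable_sigma_sets[OF sets_shift_borel])
    show "range (cylinder t) \<subseteq> Pow ?X" by (auto simp: cylinder_def)
    show "g -` y \<inter> space N \<in> sets N" if "y \<in> range (cylinder t)" for y
    proof -
      obtain w where "y = cylinder t w" using \<open>y \<in> range (cylinder t)\<close> by auto
      moreover have "g -` cylinder t w \<inter> space N \<in> sets N"
        unfolding gcyl using null_setsD2[OF Xc] by (intro sets.Int sets.Un) auto
      ultimately show ?thesis by simp
    qed
  qed (simp add: gX)
  define \<mu> where "\<mu> = distr N (shift_borel t) g"
  have s\<mu>: "sets \<mu> = sets (shift_borel t)" by (simp add: \<mu>_def)
  have sp\<mu>: "space \<mu> = ?X" by (simp add: \<mu>_def)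
  interpret \<mu>: prob_space \<mu> unfolding \<mu>_def by (rule N.prob_space_distr[OF g])
  have cyl: "emeasure \<mu> (cylinder t w) = ennreal (c w)" for w
  proof -
    have "emeasure \<mu> (cylinder t w) = emeasure N (g -` cylinder t w \<inter> space N)"
      unfolding \<mu>_def by (rule emeasure_distr[OF g]) simp
    also have "\<dots> = emeasure N {x. prefix_of (length w) x = w}"
    proof (rule emeasure_eq_AE)
      show "AE x in N. x \<in> g -` cylinder t w \<inter> space N \<longleftrightarrow> x \<in> {x. prefix_of (length w) x = w}"
        using AEX by eventually_elim (auto simp: gcyl)
      show "g -` cylinder t w \<inter> space N \<in> sets N" by (rule measurable_sets[OF g]) simp
    qed simp
    finally show ?thesis using N(3) by simp
  qed
  have T: "left_shift \<in> measurable \<mu> \<mu>" by (rule measurable_left_shift[OF s\<mu>])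
  have "distr \<mu> \<mu> left_shift = \<mu>"
  proof (rule measure_eqI_cylinder[of _ t])
    show "finite_measure (distr \<mu> \<mu> left_shift)" using \<mu>.finite_measure_distr[OF T] .
    fix w
    have "emeasure (distr \<mu> \<mu> left_shift) (cylinder t w) = emeasure \<mu> (left_shift -` cylinder t w \<inter> space \<mu>)"
      by (rule emeasure_distr[OF T]) (simp add: s\<mu>)
    also have "\<dots> = emeasure \<mu> (\<Union>a\<in>UNIV. cylinder t (a # w))" by (simp add: sp\<mu> vimage_cylinder)
    also have "\<dots> = (\<integral>\<^sup>+a. emeasure \<mu> (cylinder t (a # w)) \<partial>count_space UNIV)"
      by (intro emeasure_UN_countable countableI_type disjoint_cylinders_Cons) (simp add: s\<mu>)
    also have "\<dots> = emeasure \<mu> (cylinder t w)" by (simp add: cyl left)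
    finally show "emeasure (distr \<mu> \<mu> left_shift) (cylinder t w) = emeasure \<mu> (cylinder t w)" .
  qed (auto simp: s\<mu>)
  then have inv: "emeasure \<mu> (left_shift -` A \<inter> space \<mu>) = emeasure \<mu> A" if "A \<in> sets \<mu>" for A
    using emeasure_distr[OF T that] by simp
  show ?thesis
  proof (rule that[of \<mu>])
    show "\<mu> \<in> invariant_measures t"
      using s\<mu> \<mu>.prob_space_axioms inv by (auto simp: invariant_measures_def)
    show "measure \<mu> (cylinder t w) = c w" for w using cyl[of w] nonneg by (simp add: measure_def)
  qed
qed

section \<open>Limits of measures with uniform Gibbs bounds\<close>

context markov_potential
begin

lemma rho_letters_finite: "(\<integral>\<^sup>+a. ennreal (rho [a]) \<partial>count_space UNIV) < \<infinity>"
proof -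
  obtain C1 where C1: "\<And>n. (\<integral>\<^sup>+w. ennreal (rho w) \<partial>count_space (lists_of_length n)) \<le> ennreal C1"
    by (rule rho_sum_bounds) blast
  have "(\<integral>\<^sup>+a. ennreal (rho [a]) \<partial>count_space UNIV) \<le> (\<integral>\<^sup>+w. ennreal (rho w) \<partial>count_space (lists_of_length 1))"
    by (rule nn_integral_count_space_inj_le) (auto simp: inj_on_def)
  also have "\<dots> \<le> ennreal C1" by (rule C1)
  finally show ?thesis by (simp add: order_le_less_trans)
qed

lemma cylinder_right: "measure_preserving M left_shift \<Longrightarrow> sets M = sets (shift_borel t) \<Longrightarrow>
  (\<integral>\<^sup>+a. ennreal (measure M (cyl (w @ [a]))) \<partial>count_space UNIV) = ennreal (measure M (cyl w))"
proof -
  assume "measure_preserving M left_shift" and s: "sets M = sets (shift_borel t)"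
  then interpret measure_preserving M left_shift by simp
  have "cyl w = (\<Union>a\<in>UNIV. cyl (w @ [a]))"
  proof (intro set_eqI iffI)
    fix x assume x: "x \<in> cyl w"
    then have "shift_pow (length w) x \<in> X" using cylinder_subset by (intro shift_pow_in) blast
    from in_cylinder_prefix[OF this, of 1] show "x \<in> (\<Union>a\<in>UNIV. cyl (w @ [a]))"
      using x by (auto simp: cylinder_append)
  qed (auto simp: cylinder_append)
  then have "emeasure M (cyl w) = emeasure M (\<Union>a\<in>UNIV. cyl (w @ [a]))" by simp
  also have "\<dots> = (\<integral>\<^sup>+a. emeasure M (cyl (w @ [a])) \<partial>count_space UNIV)"
    by (intro emeasure_UN_countable countableI_type disjoint_cylinders_snoc) (simp add: s)
  finally show ?thesis by (simp add: emeasure_eq_measure)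
qed

lemma cylinder_left: "measure_preserving M left_shift \<Longrightarrow> sets M = sets (shift_borel t) \<Longrightarrow>
  (\<integral>\<^sup>+a. ennreal (measure M (cyl (a # w))) \<partial>count_space UNIV) = ennreal (measure M (cyl w))"
proof -
  assume "measure_preserving M left_shift" and s: "sets M = sets (shift_borel t)"
  then interpret measure_preserving M left_shift by simp
  have sp: "space M = X" using sets_eq_imp_space_eq[OF s] by simp
  have "ennreal (measure M (cyl w)) = emeasure M (left_shift -` cyl w \<inter> space M)"
    using T_invariant[of "cyl w"] by (simp add: s emeasure_eq_measure)
  also have "\<dots> = emeasure M (\<Union>a\<in>UNIV. cyl (a # w))" by (simp add: sp vimage_cylinder)
  also have "\<dots> = (\<integral>\<^sup>+a. emeasure M (cyl (a # w)) \<partial>count_space UNIV)"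
    by (intro emeasure_UN_countable countableI_type disjoint_cylinders_Cons) (simp add: s)
  finally show ?thesis by (simp add: emeasure_eq_measure)
qed

text \<open>Cylinder masses converge along a diagonal subsequence. Consistency of the limits is the
  critical point, since mass could escape through infinitely many letters; the uniform upper bound
  and submultiplicativity of \<open>rho\<close> give the majorant
  \<open>C * (rho w * rho [a])\<close>, summable in \<open>a\<close>. The bounds are required only
  eventually for each length, as the periodic measures provide no more.\<close>

lemma gibbs_limit:
  assumes M: "\<And>n. M n \<in> invariant_measures t" and C: "C \<ge> 1"
    and bounds: "\<And>k. \<forall>\<^sub>F n in sequentially. \<forall>w. length w = k \<longrightarrow>
       measure (M n) (cyl w) \<le> C * rho w \<and> rho w \<le> C * measure (M n) (cyl w)"
  obtains s \<mu> where "strict_mono s" "\<mu> \<in> invariant_measures t" "gibbs C \<mu>"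
    "\<And>w. (\<lambda>n. measure (M (s n)) (cyl w)) \<longlonglongrightarrow> measure \<mu> (cyl w)"
proof -
  have mp: "measure_preserving (M n) left_shift" for n using M by (rule invariant_measure_preserving)
  have ps: "prob_space (M n)" and sM: "sets (M n) = sets (shift_borel t)" for n
    using M by (auto simp: invariant_measures_def)
  let ?f = "\<lambda>n w. measure (M n) (cyl w)"
  interpret subseqs "\<lambda>k s. convergent (\<lambda>n. ?f (s n) (from_nat k))"
  proof
    fix k :: nat and s :: "nat \<Rightarrow> nat"
    have "?f (s n) (from_nat k) \<in> {0..1}" for n using prob_space.prob_le_1[OF ps] by auto
    then have "bounded (range (\<lambda>n. ?f (s n) (from_nat k)))"
      by (intro bounded_subset[OF bounded_closed_interval[of 0 1]]) auto
    from bounded_imp_convergent_subsequence[OF this]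
    show "\<exists>r'. strict_mono r' \<and> convergent (\<lambda>n. ?f ((s \<circ> r') n) (from_nat k))"
      by (auto simp: convergent_def comp_def)
  qed
  define s where "s = diagseq"
  have s: "strict_mono s" unfolding s_def by (rule subseq_diagseq)
  have "convergent (\<lambda>n. ?f (s n) w)" for w
  proof -
    \<comment> \<open>Convergence for a given word is obtained only on a tail of the diagonal
      sequence; the offset is removed afterwards.\<close>
    have "convergent (\<lambda>n. ?f ((diagseq \<circ> (+) (Suc (to_nat w))) n) (from_nat (to_nat w)))"
    proof (rule diagseq_holds)
      fix r s :: "nat \<Rightarrow> nat" and n assume r: "strict_mono r" and c: "convergent (\<lambda>i. ?f (s i) (from_nat n))"
      then show "convergent (\<lambda>i. ?f ((s \<circ> r) i) (from_nat n))"
        using convergent_subseq_convergent[OF c r] by (simp add: comp_def)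
    qed
    then have "convergent (\<lambda>n. ?f (s (n + Suc (to_nat w))) w)" by (simp add: s_def comp_def add.commute)
    then show ?thesis by (subst (asm) convergent_ignore_initial_segment)
  qed
  then obtain c where c: "\<And>w. (\<lambda>n. ?f (s n) w) \<longlonglongrightarrow> c w" unfolding convergent_def by metis
  have ev: "\<forall>\<^sub>F n in sequentially. \<forall>w. length w = k \<longrightarrow> ?f (s n) w \<le> C * rho w \<and> rho w \<le> C * ?f (s n) w" for k
    using eventually_subseq[OF s bounds] .
  have c0: "c w \<ge> 0" for w by (rule LIMSEQ_le_const[OF c]) auto
  have cup: "c w \<le> C * rho w" for w
    by (rule tendsto_upperbound[OF c]) (use ev[of "length w"] in \<open>auto elim: eventually_mono\<close>)
  have clo: "rho w \<le> C * c w" for w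
    by (rule tendsto_lowerbound[OF tendsto_mult_left[OF c]]) (use ev[of "length w"] in \<open>auto elim: eventually_mono\<close>)
  have cNil: "c [] = 1"
  proof (rule LIMSEQ_unique[OF c])
    have "?f (s n) [] = 1" for n
      using prob_space.prob_space[OF ps, of "s n"] sets_eq_imp_space_eq[OF sM, of "s n"] by (simp add: cylinder_Nil)
    then show "(\<lambda>n. ?f (s n) []) \<longlonglongrightarrow> 1" by simp
  qed
  \<comment> \<open>One statement for both consistency conditions: \<open>h a\<close> will be
    \<open>w @ [a]\<close> or \<open>a # w\<close>.\<close>
  have sumlim: "(\<integral>\<^sup>+a. ennreal (c (h a)) \<partial>count_space UNIV) = ennreal (c w)"
    if h: "\<And>a. length (h a) = k" "\<And>a. rho (h a) \<le> rho w * rho [a]"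
      and sum: "\<And>n. (\<integral>\<^sup>+a. ennreal (?f (s n) (h a)) \<partial>count_space UNIV) = ennreal (?f (s n) w)" for h w k
  proof -
    obtain n0 where n0: "\<And>n v. n \<ge> n0 \<Longrightarrow> length v = k \<Longrightarrow> ?f (s n) v \<le> C * rho v"
      using ev[of k] unfolding eventually_sequentially by blast
    have fin: "(\<integral>\<^sup>+a. ennreal (C * (rho w * rho [a])) \<partial>count_space UNIV) < \<infinity>"
    proof -
      have "(\<integral>\<^sup>+a. ennreal (C * (rho w * rho [a])) \<partial>count_space UNIV) = ennreal (C * rho w) * (\<integral>\<^sup>+a. ennreal (rho [a]) \<partial>count_space UNIV)"
        using C by (simp add: nn_integral_cmult[symmetric] ennreal_mult[symmetric] rho_nonneg mult.assoc)
      then show ?thesis using rho_letters_finite by (simp add: ennreal_mult_less_top)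
    qed
    have "(\<lambda>n. \<integral>\<^sup>+a. ennreal (?f (s (n + n0)) (h a)) \<partial>count_space UNIV) \<longlonglongrightarrow> (\<integral>\<^sup>+a. ennreal (c (h a)) \<partial>count_space UNIV)"
    proof (rule nn_integral_dominated_convergence[where w="\<lambda>a. ennreal (C * (rho w * rho [a]))"])
      show "AE a in count_space UNIV. ennreal (?f (s (j + n0)) (h a)) \<le> ennreal (C * (rho w * rho [a]))" for j
      proof (intro AE_I2 ennreal_leI)
        fix a
        have "?f (s (j + n0)) (h a) \<le> C * rho (h a)" by (intro n0 h) auto
        also have "\<dots> \<le> C * (rho w * rho [a])" using C by (intro mult_left_mono h) auto
        finally show "?f (s (j + n0)) (h a) \<le> C * (rho w * rho [a])" .
      qed
      show "AE a in count_space UNIV. (\<lambda>n. ennreal (?f (s (n + n0)) (h a))) \<longlonglongrightarrow> ennreal (c (h a))"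
        using LIMSEQ_ignore_initial_segment[OF c] by (intro AE_I2 tendsto_ennrealI) auto
    qed (use fin in auto)
    moreover have "(\<lambda>n. ennreal (?f (s (n + n0)) w)) \<longlonglongrightarrow> ennreal (c w)"
      using LIMSEQ_ignore_initial_segment[OF c] by (intro tendsto_ennrealI) auto
    ultimately show ?thesis unfolding sum by (rule LIMSEQ_unique)
  qed
  obtain \<mu> where \<mu>: "\<mu> \<in> invariant_measures t" "\<And>w. measure \<mu> (cyl w) = c w"
  proof (rule ex_markov_measure[of c t])
    show "(\<integral>\<^sup>+a. ennreal (c (w @ [a])) \<partial>count_space UNIV) = ennreal (c w)" for w
      using cylinder_right[OF mp sM] by (intro sumlim[of _ "Suc (length w)"]) (auto intro: rho_append_le)
    show "(\<integral>\<^sup>+a. ennreal (c (a # w)) \<partial>count_space UNIV) = ennreal (c w)" for w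
      using cylinder_left[OF mp sM] rho_append_le[of "[a]" w for a]
      by (intro sumlim[of _ "Suc (length w)"]) (auto simp: mult.commute)
    show "c w = 0" if "cyl w = {}" for w using cup[of w] c0[of w] rho_empty[OF that] by simp
  qed (use c0 cNil in auto)
  show ?thesis
  proof (rule that[OF s \<mu>(1)])
    show "gibbs C \<mu>" using C cup clo \<mu>(2) by (simp add: gibbs_def)
    show "(\<lambda>n. ?f (s n) w) \<longlonglongrightarrow> measure \<mu> (cyl w)" for w using c \<mu>(2) by simp
  qed
qed

end

section \<open>Measures on periodic points\<close>

lemma periodic_point_mod:
  assumes "x \<in> periodic_points t n" "n > 0"
  shows "x i = x (i mod n)"
proof (induction i rule: less_induct)
  case (less i)
  show ?case
  proof (cases "i < n")
    case False
    then have "x i = shift_pow n x (i - n)" by (simp add: shift_pow_apply)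
    also have "\<dots> = x (i - n)" using assms by (simp add: periodic_points_def)
    also have "\<dots> = x ((i - n) mod n)" using False assms by (intro less) auto
    finally show ?thesis using False by (simp add: le_mod_geq)
  qed simp
qed

lemma inj_prefix_periodic: "n > 0 \<Longrightarrow> inj_on (prefix_of n) (periodic_points t n)"
proof (rule inj_onI, rule ext)
  fix x y i assume n: "n > 0" and xy: "x \<in> periodic_points t n" "y \<in> periodic_points t n" "prefix_of n x = prefix_of n y"
  have "prefix_of n x ! (i mod n) = prefix_of n y ! (i mod n)" by (simp only: xy(3))
  then have "x (i mod n) = y (i mod n)" using n by simp
  then show "x i = y i" using periodic_point_mod[OF xy(1) n, of i] periodic_point_mod[OF xy(2) n, of i] by simp
qed

lemma countable_periodic: "n > 0 \<Longrightarrow> countable (periodic_points (t :: 'a::countable \<Rightarrow> 'a \<Rightarrow> bool) n)"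
  using countable_image_inj_on[OF countableI_type inj_prefix_periodic] by blast

lemma periodic_shift: "x \<in> periodic_points t n \<Longrightarrow> left_shift x \<in> periodic_points t n"
  using shift_pow_in[of x t 1] by (auto simp: periodic_points_def simp flip: funpow_swap1)

lemma periodic_shift_pow: "x \<in> periodic_points t n \<Longrightarrow> shift_pow i x \<in> periodic_points t n"
  by (induction i) (auto intro: periodic_shift)

lemma bij_periodic: "n > 0 \<Longrightarrow> bij_betw left_shift (periodic_points t n) (periodic_points t n)"
proof (rule bij_betwI[where g="shift_pow (n - 1)"])
  assume n: "n > 0"
  fix x assume x: "x \<in> periodic_points t n"
  have "shift_pow (n - 1) (left_shift x) = shift_pow n x" using shift_pow_shift_pow[of "n - 1" 1 x] n by simp
  then show "shift_pow (n - 1) (left_shift x) = x" using x by (simp add: periodic_points_def)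
  have "left_shift (shift_pow (n - 1) x) = shift_pow n x" using shift_pow_shift_pow[of 1 "n - 1" x] n by simp
  then show "left_shift (shift_pow (n - 1) x) = x" using x by (simp add: periodic_points_def)
qed (auto intro: periodic_shift periodic_shift_pow)

lemma birkhoff_sum_periodic:
  assumes "x \<in> periodic_points t n"
  shows "birkhoff_sum \<phi> n (left_shift x) = birkhoff_sum \<phi> n x"
proof -
  have "birkhoff_sum \<phi> (1 + n) x = birkhoff_sum \<phi> (n + 1) x" by (simp add: add.commute)
  then have "birkhoff_sum \<phi> 1 x + birkhoff_sum \<phi> n (left_shift x) = birkhoff_sum \<phi> n x + birkhoff_sum \<phi> 1 (shift_pow n x)"
    unfolding birkhoff_sum_add by simp
  then show ?thesis using assms by (simp add: periodic_points_def)
qed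

section \<open>Masses of cylinders under the periodic measures\<close>

context markov_potential
begin

text \<open>The factor \<open>exp (- n * p)\<close> cancels in the quotient defining the periodic
  measure. It brings the sums over periodic points to the scale of \<open>rho\<close>.\<close>

definition weight :: "nat \<Rightarrow> (nat \<Rightarrow> 'a) \<Rightarrow> ennreal" where
  "weight n x = ennreal (exp (S n x - real n * p))"

definition W :: "nat \<Rightarrow> (nat \<Rightarrow> 'a) set \<Rightarrow> ennreal" where
  "W n A = (\<integral>\<^sup>+x. weight n x * indicator A x \<partial>count_space (periodic_points t n))"

lemma weight_eq: "ennreal (exp (S n x)) = ennreal (exp (real n * p)) * weight n x"
  by (simp add: weight_def ennreal_mult[symmetric] exp_add[symmetric])

lemma W_shift:
  assumes n: "n > 0" shows "(\<integral>\<^sup>+x. weight n x * indicator A (left_shift x) \<partial>count_space (periodic_points t n)) = W n A"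
proof -
  have "(\<integral>\<^sup>+x. weight n x * indicator A (left_shift x) \<partial>count_space (periodic_points t n)) =
    (\<integral>\<^sup>+x. weight n (left_shift x) * indicator A (left_shift x) \<partial>count_space (periodic_points t n))"
    by (intro nn_integral_cong) (simp add: weight_def birkhoff_sum_periodic)
  also have "\<dots> = W n A" unfolding W_def
    by (rule nn_integral_bij_count_space[OF bij_periodic[OF n], where f="\<lambda>x. weight n x * indicator A x"])
  finally show ?thesis .
qed

text \<open>The shift permutes the points of period \<open>n\<close> and preserves their Birkhoff
  sums of length \<open>n\<close>. Weighted sums over periodic points are thus invariant, and
  averaging along orbits changes nothing.\<close>

lemma W_shift_pow:
  assumes n: "n > 0" shows "(\<integral>\<^sup>+x. weight n x * indicator A (shift_pow i x) \<partial>count_space (periodic_points t n)) = W n A"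
proof (induction i arbitrary: A)
  case 0 then show ?case by (simp add: W_def)
next
  case (Suc i)
  have "(\<integral>\<^sup>+x. weight n x * indicator A (shift_pow (Suc i) x) \<partial>count_space (periodic_points t n)) =
     (\<integral>\<^sup>+x. weight n x * indicator (left_shift -` A) (shift_pow i x) \<partial>count_space (periodic_points t n))"
    by (intro nn_integral_cong) (auto split: split_indicator)
  also have "\<dots> = W n (left_shift -` A)" by (rule Suc)
  also have "\<dots> = (\<integral>\<^sup>+x. weight n x * indicator A (left_shift x) \<partial>count_space (periodic_points t n))"
    unfolding W_def by (intro nn_integral_cong) (auto split: split_indicator)
  also have "\<dots> = W n A" by (rule W_shift[OF n])
  finally show ?case .
qed

text \<open>\<open>measure_of\<close> returns the prescribed values only for a countably additive
  set function. Additivity is inherited from \<open>D\<close>, the image of the uniform distribution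
  on the times below \<open>n\<close>.\<close>

lemma emeasure_orbit_measure:
  assumes A: "A \<in> sets (shift_borel t)" and x: "x \<in> X"
  shows "emeasure (orbit_measure t n x) A = (\<Sum>i<n. indicator A (shift_pow i x)) / of_nat n"
proof -
  let ?S = "shift_borel t"
  define D where "D = distr (density (count_space {..<n}) (\<lambda>_. 1 / of_nat n)) ?S (\<lambda>i. shift_pow i x)"
  have m: "(\<lambda>i. shift_pow i x) \<in> measurable (density (count_space {..<n}) (\<lambda>_. 1 / of_nat n)) ?S"
    using shift_pow_in[OF x] by (simp add: measurable_count_space_eq1)
  have D: "emeasure D B = (\<Sum>i<n. emeasure (return ?S (shift_pow i x)) B) / of_nat n" if B: "B \<in> sets ?S" for B
  proof -
    have "emeasure D B = (\<integral>\<^sup>+i. 1 / of_nat n * indicator ((\<lambda>i. shift_pow i x) -` B \<inter> {..<n}) i \<partial>count_space {..<n})"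
      unfolding D_def using B by (subst emeasure_distr[OF m]) (auto simp: emeasure_density)
    also have "\<dots> = (\<Sum>i<n. 1 / of_nat n * indicator B (shift_pow i x))"
      by (subst nn_integral_count_space_finite) (simp, intro sum.cong refl, auto split: split_indicator)
    also have "\<dots> = (\<Sum>i<n. indicator B (shift_pow i x)) / of_nat n"
      by (simp add: sum_distrib_left[symmetric] divide_ennreal_def mult.commute)
    finally show ?thesis using B shift_pow_in[OF x] by (simp add: emeasure_return)
  qed
  have "orbit_measure t n x = measure_of (space D) (sets D) (emeasure D)"
    unfolding orbit_measure_def
  proof (rule trans[OF measure_of_eq])
    show "sets ?S \<subseteq> Pow (markov_shift t)" using sets.space_closed[of ?S] by simp
    show "(\<Sum>i<n. emeasure (return ?S (shift_pow i x)) B) / of_nat n = emeasure D B"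
      if "B \<in> sigma_sets (markov_shift t) (sets ?S)" for B
      using that D[of B] sets.sigma_sets_eq[of ?S] by simp
  qed (simp add: D_def)
  then have "orbit_measure t n x = D" by (simp add: measure_of_of_measure)
  then show ?thesis using D[OF A] A shift_pow_in[OF x] by (simp add: emeasure_return)
qed

lemma infsum_weight:
  assumes "n > 0"
  shows "(\<Sum>\<^sub>\<infinity>x\<in>periodic_points t n. ennreal (exp (S n x)) * g x) =
    ennreal (exp (real n * p)) * (\<integral>\<^sup>+x. weight n x * g x \<partial>count_space (periodic_points t n))"
  unfolding infsum_eq_nn_integral[OF countable_periodic[OF assms]] weight_eq
  by (subst nn_integral_cmult[symmetric]) (auto simp: mult.assoc)

text \<open>The orbit averages collapse because every shifted sum equals the unshifted one, so the
  measure agrees with the normalised point weights \<open>D\<close>. As \<open>D\<close> is given as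
  a push-forward, countable additivity needs no separate argument, and the invariance of
  \<open>W\<close> makes it shift invariant.\<close>

lemma periodic_measure_eq:
  assumes n: "n > 0" and W: "0 < W n X" "W n X < \<infinity>"
  shows "periodic_measure t \<phi> n \<in> invariant_measures t"
    and "A \<in> sets (shift_borel t) \<Longrightarrow> emeasure (periodic_measure t \<phi> n) A = W n A / W n X"
proof -
  let ?S = "shift_borel t" and ?P = "periodic_points t n"
  have PX: "?P \<subseteq> X" by (auto simp: periodic_points_def)
  define D where "D = distr (density (count_space ?P) (\<lambda>x. weight n x / W n X)) ?S (\<lambda>x. x)"
  have m: "(\<lambda>x. x) \<in> measurable (density (count_space ?P) (\<lambda>x. weight n x / W n X)) ?S"
    using PX by (auto simp: measurable_count_space_eq1)
  have D: "emeasure D B = W n B / W n X" if B: "B \<in> sets ?S" for B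
  proof -
    have "emeasure D B = (\<integral>\<^sup>+x. weight n x / W n X * indicator (B \<inter> ?P) x \<partial>count_space ?P)"
      unfolding D_def using B by (subst emeasure_distr[OF m]) (auto simp: emeasure_density)
    also have "\<dots> = (\<integral>\<^sup>+x. (weight n x * indicator B x) / W n X \<partial>count_space ?P)"
      by (intro nn_integral_cong) (auto split: split_indicator)
    also have "\<dots> = W n B / W n X" unfolding W_def by (rule nn_integral_divide) simp
    finally show ?thesis .
  qed
  let ?e = "ennreal (exp (real n * p))"
  have F: "(\<Sum>\<^sub>\<infinity>x\<in>?P. ennreal (exp (S n x)) * emeasure (orbit_measure t n x) B) / (\<Sum>\<^sub>\<infinity>x\<in>?P. ennreal (exp (S n x))) = emeasure D B"
    if B: "B \<in> sets ?S" for B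
  proof -
    have "(\<Sum>\<^sub>\<infinity>x\<in>?P. ennreal (exp (S n x)) * emeasure (orbit_measure t n x) B) =
      ?e * (\<integral>\<^sup>+x. weight n x * emeasure (orbit_measure t n x) B \<partial>count_space ?P)"
      by (rule infsum_weight[OF n])
    also have "(\<integral>\<^sup>+x. weight n x * emeasure (orbit_measure t n x) B \<partial>count_space ?P) =
       (\<integral>\<^sup>+x. (\<Sum>i<n. weight n x * indicator B (shift_pow i x)) / of_nat n \<partial>count_space ?P)"
      using PX by (intro nn_integral_cong) (auto simp: emeasure_orbit_measure[OF B] sum_distrib_left[symmetric] ennreal_times_divide)
    also have "\<dots> = (\<Sum>i<n. \<integral>\<^sup>+x. weight n x * indicator B (shift_pow i x) \<partial>count_space ?P) / of_nat n"
      by (subst nn_integral_divide, simp, subst nn_integral_sum) simp_all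
    also have "\<dots> = (of_nat n * W n B) / of_nat n" by (simp add: W_shift_pow[OF n])
    also have "\<dots> = W n B" using n
      by (metis ennreal_mult_divide_eq mult.commute of_nat_eq_0_iff less_numeral_extra(3) ennreal_of_nat_neq_top)
    finally have 1: "(\<Sum>\<^sub>\<infinity>x\<in>?P. ennreal (exp (S n x)) * emeasure (orbit_measure t n x) B) = ?e * W n B" .
    have "(\<Sum>\<^sub>\<infinity>x\<in>?P. ennreal (exp (S n x))) = ?e * (\<integral>\<^sup>+x. weight n x * 1 \<partial>count_space ?P)"
      using infsum_weight[OF n, of "\<lambda>_. 1"] by simp
    also have "(\<integral>\<^sup>+x. weight n x * 1 \<partial>count_space ?P) = W n X"
      unfolding W_def using PX by (intro nn_integral_cong) auto
    finally have 2: "(\<Sum>\<^sub>\<infinity>x\<in>?P. ennreal (exp (S n x))) = ?e * W n X" .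
    have "?e * W n B / (?e * W n X) = W n B / W n X"
    proof -
      have "inverse (?e * W n X) = inverse ?e * inverse (W n X)"
        using W by (intro ennreal_inverse_mult) auto
      then have "?e * W n B / (?e * W n X) = (?e / ?e) * (W n B / W n X)"
        by (simp add: divide_ennreal_def mult_ac)
      also have "?e / ?e = 1" by (intro ennreal_divide_self) auto
      finally show ?thesis by simp
    qed
    then show ?thesis unfolding 1 2 D[OF B] .
  qed
  have "periodic_measure t \<phi> n = measure_of (space D) (sets D) (emeasure D)"
    unfolding periodic_measure_def
  proof (rule trans[OF measure_of_eq])
    show "sets ?S \<subseteq> Pow (markov_shift t)" using sets.space_closed[of ?S] by simp
    show "(\<Sum>\<^sub>\<infinity>x\<in>?P. ennreal (exp (S n x)) * emeasure (orbit_measure t n x) B) / (\<Sum>\<^sub>\<infinity>x\<in>?P. ennreal (exp (S n x))) = emeasure D B"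
      if "B \<in> sigma_sets (markov_shift t) (sets ?S)" for B
      using that F[of B] sets.sigma_sets_eq[of ?S] by simp
  qed (simp add: D_def)
  then have PD: "periodic_measure t \<phi> n = D" by (simp add: measure_of_of_measure)
  then show "A \<in> sets ?S \<Longrightarrow> emeasure (periodic_measure t \<phi> n) A = W n A / W n X" using D by simp
  have sD: "sets D = sets ?S" "space D = X" by (auto simp: D_def)
  have "emeasure D (space D) = 1" using D[of X] W sets.top[of ?S] by (simp add: sD ennreal_divide_self)
  then have "prob_space D" by (rule prob_spaceI)
  moreover have "emeasure D (left_shift -` A \<inter> space D) = emeasure D A" if A: "A \<in> sets D" for A
  proof -
    have T: "left_shift -` A \<inter> X \<in> sets ?S"
      using measurable_sets[OF measurable_left_shift[OF sD(1)], of A] A sD by simp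
    have "W n (left_shift -` A \<inter> X) = (\<integral>\<^sup>+x. weight n x * indicator A (left_shift x) \<partial>count_space ?P)"
      unfolding W_def using PX by (intro nn_integral_cong) (auto split: split_indicator)
    also have "\<dots> = W n A" by (rule W_shift[OF n])
    finally have "W n (left_shift -` A \<inter> X) = W n A" .
    then show ?thesis using D[OF T] D[of A] A sD by simp
  qed
  ultimately show "periodic_measure t \<phi> n \<in> invariant_measures t"
    unfolding PD by (simp add: invariant_measures_def sD)
qed

text \<open>A point of period \<open>n\<close> is determined by its first \<open>n\<close> letters.
  Inside the cylinder of \<open>w\<close> only the remaining \<open>n - length w\<close> letters are
  free, and summing \<open>rho\<close> over them costs a bounded factor.\<close>

lemma W_upper:
  obtains C where "C \<ge> 1" "\<And>w n. n > 0 \<Longrightarrow> length w \<le> n \<Longrightarrow> W n (cyl w) \<le> ennreal (C * rho w)"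
proof -
  obtain C where C: "C \<ge> 1" "\<And>n. (\<integral>\<^sup>+w. ennreal (rho w) \<partial>count_space (lists_of_length n)) \<le> ennreal C"
    by (rule rho_sum_bounds) blast
  show ?thesis
  proof (rule that[OF C(1)])
    fix w :: "'a list" and n :: nat assume n: "n > 0" and w: "length w \<le> n"
    let ?k = "n - length w" and ?Q = "periodic_points t n \<inter> cyl w"
    let ?g = "\<lambda>x. drop (length w) (prefix_of n x)"
    have wx: "prefix_of n x = w @ ?g x" if "x \<in> cyl w" for x
    proof -
      have "take (length w) (prefix_of n x) = w" using that w by (simp add: take_map cylinder_eq)
      then show ?thesis by (metis append_take_drop_id)
    qed
    have "W n (cyl w) = (\<integral>\<^sup>+x. weight n x \<partial>count_space ?Q)"
      unfolding W_def by (simp add: nn_integral_count_space_indicator indicator_inter_arith mult_ac)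
    also have "\<dots> \<le> (\<integral>\<^sup>+x. ennreal (rho w * rho (?g x)) \<partial>count_space ?Q)"
    proof (intro nn_integral_mono)
      fix x assume "x \<in> space (count_space ?Q)"
      then have x: "x \<in> X" "x \<in> cyl w" by (auto simp: periodic_points_def)
      have "exp (S n x - real n * p) \<le> rho (prefix_of n x)" using rho_ge[OF in_cylinder_prefix[OF x(1), of n]] by simp
      also have "\<dots> \<le> rho w * rho (?g x)" using rho_append_le[of w "?g x"] wx[OF x(2)] by simp
      finally show "weight n x \<le> ennreal (rho w * rho (?g x))" unfolding weight_def by (rule ennreal_leI)
    qed
    also have "\<dots> = ennreal (rho w) * (\<integral>\<^sup>+x. ennreal (rho (?g x)) \<partial>count_space ?Q)"
      by (simp add: nn_integral_cmult[symmetric] ennreal_mult rho_nonneg)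
    also have "\<dots> \<le> ennreal (rho w) * (\<integral>\<^sup>+y. ennreal (rho y) \<partial>count_space (lists_of_length ?k))"
    proof (intro mult_left_mono nn_integral_count_space_inj_le[where g="?g"])
      show "inj_on ?g ?Q"
      proof (rule inj_onI)
        fix x y assume xy: "x \<in> ?Q" "y \<in> ?Q" "?g x = ?g y"
        then have "prefix_of n x = prefix_of n y" using wx[of x] wx[of y] by simp
        then show "x = y" using xy inj_prefix_periodic[OF n, of t] by (auto simp: inj_on_def)
      qed
    qed auto
    also have "\<dots> \<le> ennreal (rho w) * ennreal C" by (intro mult_left_mono C) auto
    finally show "W n (cyl w) \<le> ennreal (C * rho w)" using C(1) by (simp add: ennreal_mult rho_nonneg mult.commute)
  qed
qed

lemma cyclic_word:
  assumes "admissible t (u @ [a])" "u \<noteq> []" "hd u = a"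
  shows "(\<lambda>i. u ! (i mod length u)) \<in> periodic_points t (length u) \<inter> cyl u"
proof -
  let ?n = "length u" and ?x = "\<lambda>i. u ! (i mod length u)"
  have n: "?n > 0" using assms by simp
  have "t (?x i) (?x (Suc i))" for i
  proof -
    have j: "i mod ?n < ?n" using n by simp
    have "t ((u @ [a]) ! (i mod ?n)) ((u @ [a]) ! Suc (i mod ?n))"
      using assms(1) j unfolding admissible_def by auto
    moreover have "(u @ [a]) ! Suc (i mod ?n) = u ! (Suc i mod ?n)"
    proof (cases "Suc (i mod ?n) = ?n")
      case True
      then have "Suc i mod ?n = 0" by (simp add: mod_Suc)
      then show ?thesis using True assms(2,3) by (simp add: hd_conv_nth nth_append)
    next
      case False
      then have "Suc i mod ?n = Suc (i mod ?n)" by (simp add: mod_Suc)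
      then show ?thesis using False j by (simp add: nth_append)
    qed
    ultimately show ?thesis using j by (simp add: nth_append)
  qed
  then have "?x \<in> X" by (simp add: markov_shift_def)
  then show ?thesis by (auto simp: periodic_points_def cylinder_def fun_eq_iff shift_pow_apply)
qed

text \<open>Gluing \<open>w\<close> to itself gives admissible words \<open>w @ y @ w\<close>, and
  repeating the block \<open>w @ y\<close> yields a periodic point. The second copy of
  \<open>w\<close> certifies that the block closes up; its factor \<open>rho w\<close> cancels
  against the square on the left, and distortion leaves \<open>exp K\<close>.\<close>

lemma W_lower:
  obtains c r0 where "c > 0" "r0 \<ge> 1"
    "\<And>w n. admissible t w \<Longrightarrow> n \<ge> length w + r0 \<Longrightarrow> ennreal (c * rho w) \<le> W n (cyl w)"
proof -
  obtain c r0 where c: "c > 0" "r0 \<ge> 1" and glue: "\<And>u v r. admissible t u \<Longrightarrow> admissible t v \<Longrightarrow> r \<ge> r0 \<Longrightarrow>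
      ennreal (c * (rho u * rho v)) \<le> (\<integral>\<^sup>+y. ennreal (rho (u @ y @ v)) \<partial>count_space (lists_of_length r))"
    by (rule rho_gluing) blast
  show ?thesis
  proof (rule that[of "c / exp K" r0])
    fix w n assume w: "admissible t w" and n: "n \<ge> length w + r0"
    have w0: "w \<noteq> []" using w by (simp add: admissible_def)
    define r where "r = n - length w"
    have r: "r \<ge> r0" "n = length w + r" using n by (auto simp: r_def)
    have rw: "rho w > 0" using w by (intro rho_pos) (simp add: cyl_ne)
    define Y where "Y = {y. length y = r \<and> admissible t (w @ y @ w)}"
    define f where "f y = (\<lambda>i. (w @ y) ! (i mod n))" for y
    have f: "f y \<in> periodic_points t n \<inter> cyl (w @ y)" if "y \<in> Y" for y
    proof -
      have len: "length (w @ y) = n" using that r by (simp add: Y_def)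
      have "w = hd w # tl w" using w0 by simp
      then have "admissible t ((w @ y @ [hd w]) @ tl w)" using that by (simp add: Y_def)
      then have "admissible t (w @ y @ [hd w])" by (rule admissible_appendD) simp
      then show ?thesis using cyclic_word[of "w @ y" "hd w", unfolded len] w0 by (simp add: f_def)
    qed
    have "ennreal (c * (rho w * rho w)) \<le> (\<integral>\<^sup>+y. ennreal (rho (w @ y @ w)) \<partial>count_space (lists_of_length r))"
      by (rule glue[OF w w r(1)])
    also have "\<dots> = (\<integral>\<^sup>+y. ennreal (rho (w @ y @ w)) \<partial>count_space Y)"
    proof (rule nn_integral_count_space_eq)
      fix y assume "y \<in> lists_of_length r - Y"
      then have "cyl (w @ y @ w) = {}" using cyl_ne[of "w @ y @ w"] w0 by (auto simp: Y_def)
      then show "ennreal (rho (w @ y @ w)) = 0" by (simp add: rho_empty)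
    qed (auto simp: Y_def)
    also have "\<dots> \<le> (\<integral>\<^sup>+y. ennreal (exp K * rho w) * (weight n (f y) * indicator (cyl w) (f y)) \<partial>count_space Y)"
    proof (intro nn_integral_mono)
      fix y assume "y \<in> space (count_space Y)"
      then have y: "y \<in> Y" by simp
      have fy: "f y \<in> cyl (w @ y)" using f[OF y] by simp
      have len: "length (w @ y) = n" using y r by (simp add: Y_def)
      have "rho (w @ y @ w) \<le> rho (w @ y) * rho w" using rho_append_le[of "w @ y" w] by simp
      also have "\<dots> \<le> (exp K * exp (S n (f y) - real n * p)) * rho w"
        using rho_le[OF fy] unfolding len by (intro mult_right_mono) (auto simp: rho_nonneg)
      also have "\<dots> = exp K * rho w * exp (S n (f y) - real n * p)" by simp
      finally have "ennreal (rho (w @ y @ w)) \<le> ennreal (exp K * rho w * exp (S n (f y) - real n * p))" by (rule ennreal_leI)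
      also have "\<dots> = ennreal (exp K * rho w) * weight n (f y)"
        using rw by (simp add: weight_def ennreal_mult)
      finally show "ennreal (rho (w @ y @ w)) \<le> ennreal (exp K * rho w) * (weight n (f y) * indicator (cyl w) (f y))"
        using fy by (simp add: cylinder_append)
    qed
    also have "\<dots> = ennreal (exp K * rho w) * (\<integral>\<^sup>+y. weight n (f y) * indicator (cyl w) (f y) \<partial>count_space Y)"
      by (simp add: nn_integral_cmult)
    also have "\<dots> \<le> ennreal (exp K * rho w) * W n (cyl w)" unfolding W_def
    proof (intro mult_left_mono nn_integral_count_space_inj_le[where g=f])
      show "inj_on f Y"
      proof (rule inj_onI)
        fix y z assume yz: "y \<in> Y" "z \<in> Y" "f y = f z"
        have pf: "prefix_of n (f y) = w @ y" if "y \<in> Y" for y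
        proof -
          have "length (w @ y) = n" using that r by (simp add: Y_def)
          then show ?thesis using f[OF that] unfolding cylinder_eq by (metis (mono_tags, lifting) IntD2 mem_Collect_eq)
        qed
        have "w @ y = w @ z" unfolding pf[OF yz(1), symmetric] pf[OF yz(2), symmetric] yz(3) ..
        then show "y = z" by simp
      qed
      show "f ` Y \<subseteq> periodic_points t n" using f by auto
    qed simp
    finally have *: "ennreal (c * (rho w * rho w)) \<le> ennreal (exp K * rho w) * W n (cyl w)" .
    have "ennreal (c / exp K * rho w) = ennreal (1 / (exp K * rho w)) * ennreal (c * (rho w * rho w))"
      using c rw by (simp add: ennreal_mult[symmetric])
    also have "\<dots> \<le> ennreal (1 / (exp K * rho w)) * (ennreal (exp K * rho w) * W n (cyl w))"
      by (intro mult_left_mono *) simp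
    also have "\<dots> = W n (cyl w)"
      using rw by (simp add: mult.assoc[symmetric] ennreal_mult[symmetric])
    finally show "ennreal (c / exp K * rho w) \<le> W n (cyl w)" .
  qed (use c in auto)
qed

text \<open>The quotient formula reduces the claim to the bounds on \<open>W\<close> for the
  cylinder and for the whole space; the latter are the bounds for the empty word above and for one
  letter below.\<close>

lemma periodic_gibbs:
  obtains C n0 where "C \<ge> 1" "\<And>n. n \<ge> n0 \<Longrightarrow> periodic_measure t \<phi> n \<in> invariant_measures t"
    "\<And>n w. n \<ge> n0 + length w \<Longrightarrow> measure (periodic_measure t \<phi> n) (cyl w) \<le> C * rho w \<and>
       rho w \<le> C * measure (periodic_measure t \<phi> n) (cyl w)"
proof -
  obtain C1 where C1: "C1 \<ge> 1" "\<And>w n. n > 0 \<Longrightarrow> length w \<le> n \<Longrightarrow> W n (cyl w) \<le> ennreal (C1 * rho w)"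
    by (rule W_upper) blast
  obtain c r0 where c: "c > 0" "r0 \<ge> 1" and low: "\<And>w n. admissible t w \<Longrightarrow> n \<ge> length w + r0 \<Longrightarrow> ennreal (c * rho w) \<le> W n (cyl w)"
    by (rule W_lower) blast
  \<comment> \<open>A lower bound for the normalising sum from a single one-letter cylinder. This
    length 1 is the reason for \<open>Suc\<close> in \<open>n0\<close>.\<close>
  define a0 where "a0 = c * rho [undefined]"
  have adm: "admissible t [undefined]" by (simp add: admissible_def)
  have a0: "a0 > 0" using c rho_pos[of "[undefined]"] adm by (simp add: a0_def cyl_ne)
  define n0 where "n0 = Suc r0"
  have WX: "ennreal a0 \<le> W n X" "W n X \<le> ennreal C1" "n > 0" if "n \<ge> n0" for n
  proof -
    have "ennreal a0 \<le> W n (cyl [undefined])" unfolding a0_def using that by (intro low adm) (simp add: n0_def)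
    also have "\<dots> \<le> W n X" unfolding W_def using cylinder_subset[of t "[undefined]"]
      by (intro nn_integral_mono mult_left_mono) (auto split: split_indicator)
    finally show "ennreal a0 \<le> W n X" .
    show n: "n > 0" using that by (simp add: n0_def)
    show "W n X \<le> ennreal C1" using C1(2)[OF n, of "[]"] by (simp add: cylinder_Nil rho_Nil)
  qed
  have fin: "0 < W n X" "W n X < \<infinity>" if "n \<ge> n0" for n
    using WX[OF that] a0 by (auto simp: order_le_less_trans order_less_le_trans[of 0 "ennreal a0"])
  \<comment> \<open>\<open>C1 / a0\<close> bounds the masses from above and \<open>C1 / c\<close>
    from below. The 1 is required by \<open>gibbs\<close> and serves the empty word.\<close>
  define C where "C = max 1 (max (C1 / a0) (C1 / c))"
  show ?thesis
  proof (rule that[of C n0])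
    show "C \<ge> 1" by (simp add: C_def)
    show "periodic_measure t \<phi> n \<in> invariant_measures t" if "n \<ge> n0" for n
      using WX(3)[OF that] fin[OF that] by (rule periodic_measure_eq(1))
    fix n and w :: "'a list" assume n: "n \<ge> n0 + length w"
    then have n': "n \<ge> n0" by simp
    let ?M = "periodic_measure t \<phi> n"
    have em: "emeasure ?M (cyl w) = W n (cyl w) / W n X"
      using WX(3)[OF n'] fin[OF n'] by (rule periodic_measure_eq(2)) simp
    define v x where "v = enn2real (W n (cyl w))" and "x = enn2real (W n X)"
    have vfin: "W n (cyl w) < \<infinity>" using C1(2)[OF WX(3)[OF n'], of w] n by (auto simp: n0_def intro: order_le_less_trans)
    have v: "W n (cyl w) = ennreal v" "v \<ge> 0" using vfin by (auto simp: v_def)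
    have x: "W n X = ennreal x" "x \<ge> 0" using fin[OF n'] by (auto simp: x_def)
    have x': "a0 \<le> x" "x \<le> C1" using WX(1,2)[OF n'] x C1(1) by (auto simp: ennreal_le_iff)
    have x0: "x > 0" using x' a0 by simp
    have m: "measure ?M (cyl w) = v / x" using em v x x0 by (simp add: measure_def divide_ennreal)
    have vup: "v \<le> C1 * rho w" using C1(2)[OF WX(3)[OF n'], of w] n v C1(1) by (auto simp: n0_def ennreal_le_iff rho_nonneg)
    show "measure ?M (cyl w) \<le> C * rho w \<and> rho w \<le> C * measure ?M (cyl w)"
    proof
      have "v / x \<le> (C1 * rho w) / a0" using vup x' a0 v by (intro frac_le) auto
      also have "\<dots> = (C1 / a0) * rho w" by simp
      also have "\<dots> \<le> C * rho w" by (intro mult_right_mono rho_nonneg) (simp add: C_def)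
      finally show "measure ?M (cyl w) \<le> C * rho w" unfolding m .
      show "rho w \<le> C * measure ?M (cyl w)"
      proof (cases "cyl w = {}")
        case True then show ?thesis by (simp add: rho_empty)
      next
        case False
        then consider "w = []" | "admissible t w" using cyl_ne by auto
        then show ?thesis
        proof cases
          case 1
          then have "v = x" by (simp add: v_def x_def cylinder_Nil)
          then show ?thesis using x0 1 unfolding m by (simp add: rho_Nil C_def)
        next
          case 2
          have "ennreal (c * rho w) \<le> W n (cyl w)" using n by (intro low 2) (simp add: n0_def)
          then have "c * rho w \<le> v" using v by (simp add: ennreal_le_iff)
          then have "rho w \<le> v / c" using c by (simp add: field_simps)
          also have "\<dots> = (C1 / c) * (v / C1)" using C1(1) by simp
          also have "\<dots> \<le> (C1 / c) * (v / x)" using x' x0 v c C1(1) by (intro mult_left_mono divide_left_mono) auto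
          also have "\<dots> \<le> C * (v / x)" using v x by (intro mult_right_mono) (auto simp: C_def)
          finally show ?thesis unfolding m .
        qed
      qed
    qed
  qed
qed

end

section \<open>The variational principle\<close>

text \<open>Young's inequality for the convex function \<open>u * ln (u / v)\<close>, attained at
  \<open>s = 1 + ln (u / v)\<close>. It bounds relative entropy from below by any test
  function.\<close>

lemma log_sum_young:
  fixes u v s :: real
  assumes "u \<ge> 0" "v \<ge> 0" "u > 0 \<Longrightarrow> v > 0"
  shows "u * s - v * exp (s - 1) \<le> u * ln u - u * ln v"
proof (cases "u = 0")
  case False
  then have u: "u > 0" and v: "v > 0" using assms by auto
  have "ln (v * exp (s - 1) / u) \<le> v * exp (s - 1) / u - 1" using u v by (intro ln_le_minus_one) auto
  then have "ln v + s - ln u \<le> v * exp (s - 1) / u" using u v by (simp add: ln_div ln_mult)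
  then have "u * (ln v + s - ln u) \<le> u * (v * exp (s - 1) / u)" using u by (intro mult_left_mono) auto
  then show ?thesis using u by (simp add: algebra_simps)
qed (use assms in auto)

lemma (in prob_space) integral_simple_comp:
  fixes g :: "'c \<Rightarrow> real"
  assumes Y: "simple_function M Y"
  shows "integrable M (\<lambda>x. g (Y x))" "(\<integral>x. g (Y x) \<partial>M) = (\<Sum>v\<in>Y ` space M. pr Y v * g v)"
proof -
  have fin: "finite (Y ` space M)" using Y by (simp add: simple_function_def)
  have eq: "g (Y x) = (\<Sum>v\<in>Y ` space M. indicator (Y -` {v} \<inter> space M) x * g v)" if "x \<in> space M" for x
  proof -
    have "(\<Sum>v\<in>Y ` space M. indicator (Y -` {v} \<inter> space M) x * g v) = (\<Sum>v\<in>Y ` space M. if v = Y x then g v else 0)"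
      using that by (intro sum.cong) (auto split: split_indicator)
    then show ?thesis using fin that by simp
  qed
  have int: "integrable M (\<lambda>x. indicator (Y -` {v} \<inter> space M) x * g v)" for v
    using simple_sets[OF Y, of "{v}"] by (intro integrable_mult_left integrable_real_indicator) (auto simp: emeasure_eq_measure)
  have "integrable M (\<lambda>x. \<Sum>v\<in>Y ` space M. indicator (Y -` {v} \<inter> space M) x * g v)"
    by (intro Bochner_Integration.integrable_sum int)
  then show "integrable M (\<lambda>x. g (Y x))" by (subst Bochner_Integration.integrable_cong[OF refl eq]) auto
  have "(\<integral>x. g (Y x) \<partial>M) = (\<integral>x. (\<Sum>v\<in>Y ` space M. indicator (Y -` {v} \<inter> space M) x * g v) \<partial>M)"
    by (intro Bochner_Integration.integral_cong refl eq)
  also have "\<dots> = (\<Sum>v\<in>Y ` space M. \<integral>x. indicator (Y -` {v} \<inter> space M) x * g v \<partial>M)"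
    by (intro Bochner_Integration.integral_sum int)
  also have "\<dots> = (\<Sum>v\<in>Y ` space M. pr Y v * g v)"
    using simple_sets[OF Y] by (intro sum.cong refl) (simp add: Int_absorb1)
  finally show "(\<integral>x. g (Y x) \<partial>M) = (\<Sum>v\<in>Y ` space M. pr Y v * g v)" .
qed

lemma (in measure_preserving) integral_shifted:
  fixes f :: "'b \<Rightarrow> real"
  assumes f: "integrable M f"
  shows "integrable M (\<lambda>x. f ((T ^^ n) x))" "(\<integral>x. f ((T ^^ n) x) \<partial>M) = (\<integral>x. f x \<partial>M)"
proof -
  have "distr M M (T ^^ n) = M"
    by (rule measure_eqI) (auto simp: emeasure_distr emeasure_eq_measure Tn_invariant)
  then show "integrable M (\<lambda>x. f ((T ^^ n) x))" "(\<integral>x. f ((T ^^ n) x) \<partial>M) = (\<integral>x. f x \<partial>M)"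
    using integrable_distr[of "T ^^ n" M M f] integral_distr[of "T ^^ n" M M f] f by auto
qed

context markov_potential
begin

subsection \<open>Integrability of the potential\<close>

lemma potential_variation_small:
  assumes "e > 0" shows "\<exists>n. \<forall>w x y. length w = Suc n \<longrightarrow> x \<in> cyl w \<longrightarrow> y \<in> cyl w \<longrightarrow> \<bar>\<phi> x - \<phi> y\<bar> < e"
proof -
  have vfin: "var n < \<infinity>" for n
    using sum_var sum_le_suminf[of var "{n}"] by (auto intro: order_le_less_trans)
  define r where "r n = enn2real (var n)" for n
  have r: "var n = ennreal (r n)" "r n \<ge> 0" for n using vfin[of n] by (auto simp: r_def)
  have "summable r"
    using sum_var r by (intro summable_suminf_not_top) auto
  then have "r \<longlonglongrightarrow> 0" by (rule summable_LIMSEQ_zero)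
  then obtain n where n: "r n < e" using assms by (metis (mono_tags, lifting) order_tendstoD(2) eventually_happens' sequentially_bot)
  have "\<phi> x - \<phi> y < e" if "length w = Suc n" "x \<in> cyl w" "y \<in> cyl w" for w x y
  proof -
    have "ennreal (\<phi> x - \<phi> y) \<le> ennreal (r n)" using var_bound[OF that(2,3,1)] r by simp
    then have "\<phi> x - \<phi> y \<le> r n" using r(2)[of n] by (simp add: ennreal_le_iff2) linarith
    then show ?thesis using n by simp
  qed
  then show ?thesis by (intro exI[of _ n]) (metis abs_less_iff minus_diff_eq)
qed

lemma continuous_potential: "continuous_on X \<phi>"
  unfolding continuous_on_def
proof (intro ballI tendstoI)
  fix x and e :: real assume x: "x \<in> X" and e: "e > 0"
  obtain n where n: "\<And>w x y. length w = Suc n \<Longrightarrow> x \<in> cyl w \<Longrightarrow> y \<in> cyl w \<Longrightarrow> \<bar>\<phi> x - \<phi> y\<bar> < e"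
    using potential_variation_small[OF e] by blast
  have op: "open {y. \<forall>i<Suc n. y i = x i}"
  proof -
    have "open (\<Inter>i\<in>{..<Suc n}. {y. y i = x i})"
      by (intro open_INT ballI open_coordinate[of "\<lambda>a. a = x i" i for i]) simp
    also have "(\<Inter>i\<in>{..<Suc n}. {y. y i = x i}) = {y. \<forall>i<Suc n. y i = x i}" by auto
    finally show ?thesis .
  qed
  have "dist (\<phi> y) (\<phi> x) < e" if "y \<in> X" "\<forall>i<Suc n. y i = x i" for y
  proof -
    have "y \<in> cyl (prefix_of (Suc n) x)" using that by (auto simp: cylinder_def simp del: upt_Suc)
    then show ?thesis using n[OF _ _ in_cylinder_prefix[OF x]] by (simp add: dist_real_def del: upt_Suc)
  qed
  then show "\<forall>\<^sub>F y in at x within X. dist (\<phi> y) (\<phi> x) < e"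
    unfolding eventually_at_topological using op by (intro exI[of _ "{y. \<forall>i<Suc n. y i = x i}"]) auto
qed

lemma measurable_continuous:
  fixes f :: "(nat \<Rightarrow> 'a) \<Rightarrow> real"
  assumes "sets M = sets (shift_borel t)" "continuous_on X f"
  shows "f \<in> borel_measurable M"
proof -
  have "f \<in> borel_measurable (shift_borel t)"
    unfolding shift_borel_def by (rule borel_measurable_continuous_on_restrict[OF assms(2)])
  then show ?thesis by (subst measurable_cong_sets[OF assms(1) refl])
qed

text \<open>\<open>exp (\<phi> x - p)\<close> is at most \<open>rho\<close> of the first letter, one
  term of a sum bounded by \<open>C1\<close>.\<close>

lemma potential_bounded_above: "\<exists>B\<ge>0. \<forall>x\<in>X. \<phi> x \<le> B"
proof -
  obtain C1 where C1: "C1 \<ge> 1" "\<And>n. (\<integral>\<^sup>+w. ennreal (rho w) \<partial>count_space (lists_of_length n)) \<le> ennreal C1"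
    by (rule rho_sum_bounds) blast
  have "\<phi> x \<le> ln C1 + p" if x: "x \<in> X" for x
  proof -
    let ?w = "prefix_of 1 x"
    have "ennreal (rho ?w) \<le> (\<integral>\<^sup>+w. ennreal (rho w) \<partial>count_space (lists_of_length 1))"
      by (rule nn_integral_ge_point) simp
    also have "\<dots> \<le> ennreal C1" by (rule C1)
    finally have "rho ?w \<le> C1" using C1(1) by (simp add: ennreal_le_iff)
    then have "exp (\<phi> x - p) \<le> C1" using rho_ge[OF in_cylinder_prefix[OF x, of 1]] by (simp add: birkhoff_sum_def)
    then have "ln (exp (\<phi> x - p)) \<le> ln C1" using C1(1) by (subst ln_le_cancel_iff) auto
    then show ?thesis by simp
  qed
  then show ?thesis by (intro exI[of _ "max 0 (ln C1 + p)"]) (auto simp: le_max_iff_disj)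
qed

text \<open>The potential is bounded above on the shift space, so its positive part has finite
  integral and only the negative part can diverge.\<close>

lemma ereal_integral_potential:
  assumes \<nu>: "\<nu> \<in> invariant_measures t"
  shows "ereal_integral \<nu> \<phi> > -\<infinity> \<longleftrightarrow> integrable \<nu> \<phi>"
    and "integrable \<nu> \<phi> \<Longrightarrow> ereal_integral \<nu> \<phi> = ereal (\<integral>x. \<phi> x \<partial>\<nu>)"
proof -
  have s: "sets \<nu> = sets (shift_borel t)" and "prob_space \<nu>" using \<nu> by (auto simp: invariant_measures_def)
  interpret prob_space \<nu> by fact
  have sp: "space \<nu> = X" using sets_eq_imp_space_eq[OF s] by simp
  have m: "\<phi> \<in> borel_measurable \<nu>" by (rule measurable_continuous[OF s continuous_potential])
  obtain B where B: "B \<ge> 0" "\<And>x. x \<in> X \<Longrightarrow> \<phi> x \<le> B" using potential_bounded_above by auto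
  have "(\<integral>\<^sup>+x. ennreal (\<phi> x) \<partial>\<nu>) \<le> (\<integral>\<^sup>+x. ennreal B \<partial>\<nu>)"
    using B by (intro nn_integral_mono ennreal_leI) (auto simp: sp)
  then have pos: "(\<integral>\<^sup>+x. ennreal (\<phi> x) \<partial>\<nu>) \<noteq> \<infinity>" by (auto simp: emeasure_space_1 top_unique)
  have iff: "integrable \<nu> \<phi> \<longleftrightarrow> (\<integral>\<^sup>+x. ennreal (- \<phi> x) \<partial>\<nu>) \<noteq> \<infinity>"
    using m pos by (simp add: real_integrable_def)
  obtain a where a: "(\<integral>\<^sup>+x. ennreal (\<phi> x) \<partial>\<nu>) = ennreal a" "a \<ge> 0" using pos by (cases "\<integral>\<^sup>+x. ennreal (\<phi> x) \<partial>\<nu>") auto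
  show "ereal_integral \<nu> \<phi> > -\<infinity> \<longleftrightarrow> integrable \<nu> \<phi>"
    unfolding iff ereal_integral_def a using a(2)
    by (cases "\<integral>\<^sup>+x. ennreal (- \<phi> x) \<partial>\<nu>") (auto simp: top_ereal_def)
  assume int: "integrable \<nu> \<phi>"
  then have "(\<integral>\<^sup>+x. ennreal (- \<phi> x) \<partial>\<nu>) \<noteq> \<infinity>" using iff by simp
  then obtain b where b: "(\<integral>\<^sup>+x. ennreal (- \<phi> x) \<partial>\<nu>) = ennreal b" "b \<ge> 0" by (cases "\<integral>\<^sup>+x. ennreal (- \<phi> x) \<partial>\<nu>") auto
  show "ereal_integral \<nu> \<phi> = ereal (\<integral>x. \<phi> x \<partial>\<nu>)"
    unfolding ereal_integral_def real_lebesgue_integral_def[OF int] a b using a(2) b(2) by simp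
qed

lemma integral_birkhoff:
  assumes \<nu>: "\<nu> \<in> invariant_measures t" and int: "integrable \<nu> \<phi>"
  shows "integrable \<nu> (S k)" "(\<integral>x. S k x \<partial>\<nu>) = real k * (\<integral>x. \<phi> x \<partial>\<nu>)"
proof -
  interpret measure_preserving \<nu> left_shift by (rule invariant_measure_preserving[OF \<nu>])
  show "integrable \<nu> (S k)" unfolding birkhoff_sum_def[abs_def]
    by (intro Bochner_Integration.integrable_sum integral_shifted(1)[OF int])
  show "(\<integral>x. S k x \<partial>\<nu>) = real k * (\<integral>x. \<phi> x \<partial>\<nu>)" unfolding birkhoff_sum_def
    by (subst Bochner_Integration.integral_sum) (auto intro: integral_shifted(1)[OF int] simp: integral_shifted(2)[OF int])
qed

text \<open>The mass of a letter is comparable to \<open>exp (\<phi> - p)\<close>, so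
  \<open>\<bar>\<phi>\<bar> * exp \<phi>\<close> has to be summable over letters. For very negative
  \<open>\<phi>\<close> the factor \<open>\<bar>\<phi>\<bar>\<close> is absorbed by passing to
  \<open>exp (\<beta> * \<phi>)\<close> with some \<open>\<beta> < 1\<close>, and this is where the
  assumption on \<open>beta_infinity\<close> enters.\<close>

lemma gibbs_integrable:
  assumes \<mu>: "\<mu> \<in> invariant_measures t" and gb: "gibbs C \<mu>"
  shows "integrable \<mu> \<phi>"
proof -
  have s: "sets \<mu> = sets (shift_borel t)" and "prob_space \<mu>" using \<mu> by (auto simp: invariant_measures_def)
  interpret prob_space \<mu> by fact
  have sp: "space \<mu> = X" using sets_eq_imp_space_eq[OF s] by simp
  have C: "C \<ge> 1" and up: "\<And>w. prob (cyl w) \<le> C * rho w" using gb by (auto simp: gibbs_def)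
  obtain \<beta> where b1: "\<beta> < 1" and bs: "summable_potential t (\<lambda>x. \<beta> * \<phi> x)"
    using beta unfolding beta_infinity_def INF_less_iff by auto
  obtain B where B: "B \<ge> 0" "\<And>x. x \<in> X \<Longrightarrow> \<phi> x \<le> B" using potential_bounded_above by auto
  \<comment> \<open>From \<open>u \<le> exp u\<close> at
    \<open>u = (1 - \<beta>) * (- \<phi> x)\<close>.\<close>
  define D where "D = 1 / (1 - \<beta>)"
  have D: "D > 0" using b1 by (simp add: D_def)
  have bound: "\<bar>\<phi> x\<bar> * exp (\<phi> x) \<le> B * exp (\<phi> x) + D * exp (\<beta> * \<phi> x)" if x: "x \<in> X" for x
  proof (cases "\<phi> x \<ge> 0")
    case True
    then have "\<bar>\<phi> x\<bar> * exp (\<phi> x) \<le> B * exp (\<phi> x)" using B(2)[OF x] by (intro mult_right_mono) auto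
    then show ?thesis using D by (simp add: add_increasing2)
  next
    case False
    let ?u = "(1 - \<beta>) * (- \<phi> x)"
    have "?u \<le> exp ?u" using exp_ge_add_one_self[of ?u] by linarith
    then have "- \<phi> x \<le> D * exp ?u" using b1 by (simp add: D_def field_simps)
    then have "- \<phi> x * exp (\<phi> x) \<le> D * exp ?u * exp (\<phi> x)" by (intro mult_right_mono) auto
    also have "\<dots> = D * exp (\<beta> * \<phi> x)" by (simp add: mult.assoc exp_add[symmetric] algebra_simps)
    finally show ?thesis using False B(1) by (simp add: add_increasing)
  qed
  define H where "H a = (SUP x\<in>cyl [a]. ennreal (exp (\<beta> * \<phi> x)))" for a
  have Hfin: "(\<integral>\<^sup>+a. H a \<partial>count_space UNIV) < \<infinity>"
  proof -
    have c: "countable (words t 1)" by (rule countableI_type)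
    have "(\<integral>\<^sup>+a. H a \<partial>count_space UNIV) =
      (\<integral>\<^sup>+a. (SUP x\<in>cyl [a]. ennreal (exp (birkhoff_sum (\<lambda>x. \<beta> * \<phi> x) 1 x))) \<partial>count_space UNIV)"
      by (simp add: H_def birkhoff_sum_def)
    also have "\<dots> \<le> (\<integral>\<^sup>+w. (SUP x\<in>cyl w. ennreal (exp (birkhoff_sum (\<lambda>x. \<beta> * \<phi> x) 1 x))) \<partial>count_space (words t 1))"
      by (rule nn_integral_count_space_inj_le[where g="\<lambda>a. [a]"]) (auto simp: inj_on_def words_def admissible_def)
    also have "\<dots> = partition_function t (\<lambda>x. \<beta> * \<phi> x) 1"
      unfolding partition_function_def infsum_eq_nn_integral[OF c] ..
    finally show ?thesis using bs unfolding summable_potential_def by (rule order_le_less_trans)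
  qed
  \<comment> \<open>\<open>C\<close> from the Gibbs bound, \<open>exp K\<close> from distortion and
    \<open>exp (- p)\<close> from the normalisation of a single letter.\<close>
  define E where "E = C * exp (K - p)"
  have E: "E > 0" using C by (simp add: E_def)
  have letter: "(\<integral>\<^sup>+x. ennreal \<bar>\<phi> x\<bar> * indicator (cyl [a]) x \<partial>\<mu>) \<le>
      ennreal (C * (B + K) * exp K) * ennreal (rho [a]) + ennreal (E * D) * H a" for a
  proof (cases "cyl [a] = {}")
    case True then show ?thesis by simp
  next
    case False
    then obtain y where y: "y \<in> cyl [a]" by auto
    have yX: "y \<in> X" using y cylinder_subset by blast
    have osc: "\<bar>\<phi> x\<bar> \<le> \<bar>\<phi> y\<bar> + K" if "x \<in> cyl [a]" for x
      using distortion[OF that y] distortion[OF y that] by (simp add: birkhoff_sum_def)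
    have "(\<integral>\<^sup>+x. ennreal \<bar>\<phi> x\<bar> * indicator (cyl [a]) x \<partial>\<mu>) \<le> (\<integral>\<^sup>+x. ennreal (\<bar>\<phi> y\<bar> + K) * indicator (cyl [a]) x \<partial>\<mu>)"
      using osc by (intro nn_integral_mono) (auto split: split_indicator intro: ennreal_leI)
    also have "\<dots> = ennreal ((\<bar>\<phi> y\<bar> + K) * prob (cyl [a]))"
      using K_nonneg by (simp add: nn_integral_cmult_indicator s emeasure_eq_measure ennreal_mult)
    also have "\<dots> \<le> ennreal (C * (B + K) * exp K * rho [a] + E * D * exp (\<beta> * \<phi> y))"
    proof (rule ennreal_leI)
      have lo: "exp (\<phi> y - p) \<le> rho [a]" using rho_ge[OF y] by (simp add: birkhoff_sum_def)
      have "prob (cyl [a]) \<le> C * (exp K * exp (\<phi> y - p))"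
        using order_trans[OF up[of "[a]"] mult_left_mono[OF rho_le[OF y]]] C by (simp add: birkhoff_sum_def)
      then have "(\<bar>\<phi> y\<bar> + K) * prob (cyl [a]) \<le> (\<bar>\<phi> y\<bar> + K) * (C * (exp K * exp (\<phi> y - p)))"
        using K_nonneg by (intro mult_left_mono) auto
      also have "\<dots> = E * (\<bar>\<phi> y\<bar> * exp (\<phi> y)) + C * K * exp K * exp (\<phi> y - p)"
        by (simp add: E_def exp_diff field_simps)
      also have "\<dots> \<le> E * (B * exp (\<phi> y) + D * exp (\<beta> * \<phi> y)) + C * K * exp K * exp (\<phi> y - p)"
        using E by (intro add_right_mono mult_left_mono bound yX) auto
      also have "\<dots> = C * (B + K) * exp K * exp (\<phi> y - p) + E * D * exp (\<beta> * \<phi> y)"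
        by (simp add: E_def exp_diff field_simps)
      also have "\<dots> \<le> C * (B + K) * exp K * rho [a] + E * D * exp (\<beta> * \<phi> y)"
        using lo C B(1) K_nonneg by (intro add_right_mono mult_left_mono) auto
      finally show "(\<bar>\<phi> y\<bar> + K) * prob (cyl [a]) \<le> C * (B + K) * exp K * rho [a] + E * D * exp (\<beta> * \<phi> y)" .
    qed
    also have "\<dots> = ennreal (C * (B + K) * exp K) * ennreal (rho [a]) + ennreal (E * D) * ennreal (exp (\<beta> * \<phi> y))"
      using C B(1) K_nonneg E D by (simp add: ennreal_mult[symmetric] rho_nonneg)
    also have "\<dots> \<le> ennreal (C * (B + K) * exp K) * ennreal (rho [a]) + ennreal (E * D) * H a"
      unfolding H_def using y by (intro add_left_mono mult_left_mono SUP_upper) auto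
    finally show ?thesis .
  qed
  have "(\<integral>\<^sup>+x. ennreal (norm (\<phi> x)) \<partial>\<mu>) = (\<integral>\<^sup>+x. \<integral>\<^sup>+a. ennreal \<bar>\<phi> x\<bar> * indicator (cyl [a]) x \<partial>count_space UNIV \<partial>\<mu>)"
  proof (intro nn_integral_cong)
    fix x assume "x \<in> space \<mu>"
    then have "indicator (cyl [a]) x = (indicator {x 0} a :: ennreal)" for a
      by (auto simp: sp cylinder_def split: split_indicator)
    then show "ennreal (norm (\<phi> x)) = (\<integral>\<^sup>+a. ennreal \<bar>\<phi> x\<bar> * indicator (cyl [a]) x \<partial>count_space UNIV)"
      by (simp add: nn_integral_cmult)
  qed
  also have "\<dots> = (\<integral>\<^sup>+a. \<integral>\<^sup>+x. ennreal \<bar>\<phi> x\<bar> * indicator (cyl [a]) x \<partial>\<mu> \<partial>count_space UNIV)"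
  proof (intro nn_integral_count_space_nn_integral countableI_type)
    have [measurable]: "\<phi> \<in> borel_measurable \<mu>" "cyl w \<in> sets \<mu>" for w
      using measurable_continuous[OF s continuous_potential] by (auto simp: s)
    show "(\<lambda>x. ennreal \<bar>\<phi> x\<bar> * indicator (cyl [a]) x) \<in> borel_measurable \<mu>" for a by measurable
  qed
  also have "\<dots> \<le> (\<integral>\<^sup>+a. ennreal (C * (B + K) * exp K) * ennreal (rho [a]) + ennreal (E * D) * H a \<partial>count_space UNIV)"
    by (intro nn_integral_mono letter)
  also have "\<dots> = ennreal (C * (B + K) * exp K) * (\<integral>\<^sup>+a. ennreal (rho [a]) \<partial>count_space UNIV) + ennreal (E * D) * (\<integral>\<^sup>+a. H a \<partial>count_space UNIV)"
    by (simp add: nn_integral_add nn_integral_cmult)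
  also have "\<dots> < \<infinity>" using rho_letters_finite Hfin by (simp add: ennreal_mult_less_top)
  finally show ?thesis
    using measurable_continuous[OF s continuous_potential] by (intro integrableI_bounded) auto
qed


subsection \<open>Comparison with a Gibbs measure\<close>

lemma simple_code:
  assumes s: "sets M = sets (shift_borel t)"
  shows "simple_function M (itin left_shift (lab m) k)"
proof (induction k)
  case 0 then show ?case by simp
next
  case (Suc k)
  have "shift_pow k \<in> measurable M M"
    by (induction k) (simp, simp only: funpow.simps, rule measurable_comp[OF _ measurable_left_shift[OF s]])
  from simple_function_comp[OF this simple_lab[OF s]]
  have "simple_function M (\<lambda>x. lab m (shift_pow k x))" .
  from simple_function_compose2[OF Suc.IH this, of "\<lambda>a b. a @ [b]"]
  show ?case by (simp add: itin_Suc[abs_def])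
qed

text \<open>A cell of the coding contains the whole cylinder of each of its points, so its
  \<open>\<mu>\<close>-mass is at least \<open>exp (S k x - k * p) / C\<close>; merging letters only
  helps. Integrating the logarithm against \<open>\<nu>\<close> and using invariance of
  \<open>\<nu>\<close> turns the Birkhoff sum into \<open>k\<close> times the integral of the
  potential.\<close>

lemma cross_entropy_le:
  fixes m k :: nat
  assumes \<mu>: "\<mu> \<in> invariant_measures t" and gb: "gibbs C \<mu>"
    and \<nu>: "\<nu> \<in> invariant_measures t" and int: "integrable \<nu> \<phi>"
  defines "Y \<equiv> itin left_shift (lab m) k"
  shows "(\<Sum>v\<in>Y ` X. - (measure \<nu> (Y -` {v} \<inter> X) * ln (measure \<mu> (Y -` {v} \<inter> X))))
     \<le> real k * (p - (\<integral>x. \<phi> x \<partial>\<nu>)) + ln C"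
    and "x \<in> X \<Longrightarrow> measure \<mu> (Y -` {Y x} \<inter> X) > 0"
proof -
  have s: "sets \<nu> = sets (shift_borel t)" "sets \<mu> = sets (shift_borel t)" and "prob_space \<nu>" "prob_space \<mu>"
    using \<nu> \<mu> by (auto simp: invariant_measures_def)
  interpret N: prob_space \<nu> by fact
  interpret M: prob_space \<mu> by fact
  have sp: "space \<nu> = X" "space \<mu> = X" using sets_eq_imp_space_eq[OF s(1)] sets_eq_imp_space_eq[OF s(2)] by auto
  have C: "C \<ge> 1" and lo: "\<And>w. rho w \<le> C * M.prob (cyl w)" using gb by (auto simp: gibbs_def)
  have Y: "simple_function \<nu> Y" "simple_function \<mu> Y" unfolding Y_def using s by (auto intro: simple_code)
  have low: "exp (S k x - real k * p) / C \<le> M.prob (Y -` {Y x} \<inter> X)" if x: "x \<in> X" for x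
  proof -
    have "exp (S k x - real k * p) \<le> rho (prefix_of k x)"
      using rho_ge[OF in_cylinder_prefix[OF x, of k]] by simp
    also have "\<dots> \<le> C * M.prob (cyl (prefix_of k x))" by (rule lo)
    also have "\<dots> \<le> C * M.prob (Y -` {Y x} \<inter> X)"
    proof (intro mult_left_mono M.finite_measure_mono)
      show "cyl (prefix_of k x) \<subseteq> Y -` {Y x} \<inter> X"
        unfolding Y_def itin_lab by (auto simp: cylinder_def)
      show "Y -` {Y x} \<inter> X \<in> M.events" using M.simple_sets[OF Y(2)] sp by simp
    qed (use C in auto)
    finally show ?thesis using C by (simp add: field_simps)
  qed
  then show pos: "M.prob (Y -` {Y x} \<inter> X) > 0" if "x \<in> X" for x
    using C by (intro order_less_le_trans[OF _ low[OF that]]) simp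
  have "(\<Sum>v\<in>Y ` X. - (N.prob (Y -` {v} \<inter> X) * ln (M.prob (Y -` {v} \<inter> X)))) =
     (\<integral>x. - ln (M.prob (Y -` {Y x} \<inter> X)) \<partial>\<nu>)"
    using N.integral_simple_comp(2)[OF Y(1), of "\<lambda>v. - ln (M.prob (Y -` {v} \<inter> X))"] by (simp add: sp)
  also have "\<dots> \<le> (\<integral>x. real k * p + ln C - S k x \<partial>\<nu>)"
  proof (rule integral_mono)
    show "integrable \<nu> (\<lambda>x. - ln (M.prob (Y -` {Y x} \<inter> X)))" by (rule N.integral_simple_comp(1)[OF Y(1)])
    show "integrable \<nu> (\<lambda>x. real k * p + ln C - S k x)"
      using integral_birkhoff(1)[OF \<nu> int] by (intro Bochner_Integration.integrable_diff) auto
    fix x assume "x \<in> space \<nu>"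
    then have x: "x \<in> X" using sp by simp
    have "ln (exp (S k x - real k * p) / C) \<le> ln (M.prob (Y -` {Y x} \<inter> X))"
      using low[OF x] pos[OF x] C by (subst ln_le_cancel_iff) auto
    then show "- ln (M.prob (Y -` {Y x} \<inter> X)) \<le> real k * p + ln C - S k x" using C by (simp add: ln_div)
  qed
  also have "\<dots> = real k * (p - (\<integral>x. \<phi> x \<partial>\<nu>)) + ln C"
    using integral_birkhoff[OF \<nu> int] by (subst Bochner_Integration.integral_diff) (auto simp: N.prob_space algebra_simps)
  finally show "(\<Sum>v\<in>Y ` X. - (N.prob (Y -` {v} \<inter> X) * ln (M.prob (Y -` {v} \<inter> X))))
     \<le> real k * (p - (\<integral>x. \<phi> x \<partial>\<nu>)) + ln C" .
qed

text \<open>For \<open>f = 1\<close> this is the nonnegativity of relative entropy; for \<open>f\<close> large on an event and zero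
  elsewhere it bounds the \<open>\<nu>\<close>-measure of the event by its \<open>\<mu>\<close>-measure.\<close>

lemma relative_entropy_bound:
  fixes m k :: nat
  assumes \<mu>: "\<mu> \<in> invariant_measures t" and gb: "gibbs C \<mu>"
    and \<nu>: "\<nu> \<in> invariant_measures t" and int: "integrable \<nu> \<phi>"
  defines "Y \<equiv> itin left_shift (lab m) k"
  shows "(\<Sum>v\<in>Y ` X. measure \<nu> (Y -` {v} \<inter> X) * f v - measure \<mu> (Y -` {v} \<inter> X) * exp (f v - 1))
    \<le> real k * (p - (\<integral>x. \<phi> x \<partial>\<nu>)) + ln C - ent \<nu> Y"
proof -
  have s: "sets \<nu> = sets (shift_borel t)" using \<nu> by (auto simp: invariant_measures_def)
  have sp: "space \<nu> = X" using sets_eq_imp_space_eq[OF s] by simp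
  let ?n = "\<lambda>v. measure \<nu> (Y -` {v} \<inter> X)" and ?m = "\<lambda>v. measure \<mu> (Y -` {v} \<inter> X)"
  have "(\<Sum>v\<in>Y ` X. ?n v * f v - ?m v * exp (f v - 1)) \<le> (\<Sum>v\<in>Y ` X. ?n v * ln (?n v) - ?n v * ln (?m v))"
    using cross_entropy_le(2)[OF \<mu> gb \<nu> int] unfolding Y_def by (intro sum_mono log_sum_young) auto
  also have "\<dots> = (\<Sum>v\<in>Y ` X. - (?n v * ln (?m v))) - ent \<nu> Y"
    by (simp add: ent_def eta_def sp sum_subtractf sum_negf)
  also have "\<dots> \<le> real k * (p - (\<integral>x. \<phi> x \<partial>\<nu>)) + ln C - ent \<nu> Y"
    using cross_entropy_le(1)[OF \<mu> gb \<nu> int, of m k] unfolding Y_def by simp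
  finally show ?thesis .
qed

lemma ent_code_le:
  assumes \<mu>: "\<mu> \<in> invariant_measures t" and gb: "gibbs C \<mu>"
    and \<nu>: "\<nu> \<in> invariant_measures t" and int: "integrable \<nu> \<phi>"
  shows "ent \<nu> (itin left_shift (lab m) k) \<le> real k * (p - (\<integral>x. \<phi> x \<partial>\<nu>)) + ln C"
proof -
  let ?Y = "itin left_shift (lab m) k :: (nat \<Rightarrow> 'a) \<Rightarrow> _"
  have s: "sets \<nu> = sets (shift_borel t)" "sets \<mu> = sets (shift_borel t)" and "prob_space \<nu>" "prob_space \<mu>"
    using \<nu> \<mu> by (auto simp: invariant_measures_def)
  interpret N: prob_space \<nu> by fact
  interpret M: prob_space \<mu> by fact
  have sp: "space \<nu> = X" "space \<mu> = X" using sets_eq_imp_space_eq[OF s(1)] sets_eq_imp_space_eq[OF s(2)] by auto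
  have "(\<Sum>v\<in>?Y ` X. measure \<nu> (?Y -` {v} \<inter> X)) = 1" "(\<Sum>v\<in>?Y ` X. measure \<mu> (?Y -` {v} \<inter> X)) = 1"
    using N.sum_pr[OF simple_code[OF s(1)], of m k] M.sum_pr[OF simple_code[OF s(2)], of m k] by (auto simp: sp)
  then show ?thesis
    using relative_entropy_bound[OF \<mu> gb \<nu> int, of m k "\<lambda>_. 1"] by (simp add: sum_subtractf)
qed

lemma ent_rate_lab_le:
  assumes \<mu>: "\<mu> \<in> invariant_measures t" and gb: "gibbs C \<mu>"
    and \<nu>: "\<nu> \<in> invariant_measures t" and int: "integrable \<nu> \<phi>"
  shows "ent_rate \<nu> left_shift (lab m) \<le> p - (\<integral>x. \<phi> x \<partial>\<nu>)"
proof -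
  have s: "sets \<nu> = sets (shift_borel t)" using \<nu> by (auto simp: invariant_measures_def)
  interpret measure_preserving \<nu> left_shift by (rule invariant_measure_preserving[OF \<nu>])
  let ?q = "p - (\<integral>x. \<phi> x \<partial>\<nu>)"
  have lim: "(\<lambda>k. ?q + ln C / real k) \<longlonglongrightarrow> ?q"
    using tendsto_add[OF tendsto_const lim_const_over_n] by simp
  have "ent \<nu> (itin left_shift (lab m) k) / real k \<le> ?q + ln C / real k" if "k \<ge> 1" for k
    using ent_code_le[OF \<mu> gb \<nu> int, of m k] that by (simp add: field_simps)
  then show ?thesis by (intro LIMSEQ_le[OF ent_rate_LIMSEQ[OF simple_lab[OF s]] lim]) blast
qed

subsection \<open>The codings generate\<close>

text \<open>Each of the finitely many level sets of \<open>Q\<close> is approximated by coded sets,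
  at a common level. Then \<open>Q\<close> is nearly determined by \<open>code m\<close>, whose rate
  does not exceed that of the single label \<open>lab m\<close>.\<close>

lemma ent_rate_approx:
  assumes \<nu>: "\<nu> \<in> invariant_measures t" and Q: "simple_function \<nu> Q" and e: "e > 0"
  shows "\<exists>m. ent_rate \<nu> left_shift Q \<le> ent_rate \<nu> left_shift (lab m) + e"
proof -
  have s: "sets \<nu> = sets (shift_borel t)" using \<nu> by (auto simp: invariant_measures_def)
  interpret measure_preserving \<nu> left_shift by (rule invariant_measure_preserving[OF \<nu>])
  have sp: "space \<nu> = X" using sets_eq_imp_space_eq[OF s] by simp
  have fin: "finite (Q ` space \<nu>)" using Q by (simp add: simple_function_def)
  let ?N = "real (card (Q ` space \<nu>))"
  \<comment> \<open>With error \<open>d^2\<close> and parameter \<open>d\<close> the conditional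
    entropy is at most \<open>?N * (d + d^2 / d)\<close>; the choice of \<open>d\<close> makes this
    at most \<open>e\<close>, and the 1 in the denominator avoids division by 0.\<close>
  define d where "d = min 1 (e / (2 * (?N + 1)))"
  have d: "0 < d" "d \<le> 1" using e by (auto simp: d_def)
  have "\<exists>n. \<forall>m\<ge>n. \<exists>B. prob ((Q -` {q} \<inter> space \<nu>) - (code m -` B \<inter> space \<nu>)) + prob ((code m -` B \<inter> space \<nu>) - (Q -` {q} \<inter> space \<nu>)) \<le> d^2" for q
  proof -
    have "Q -` {q} \<inter> space \<nu> \<in> events" using simple_sets[OF Q] .
    from approximation_by_algebra[OF finite_measure_axioms finite_measure_axioms refl _ algebra_coded_sets this, of t "d^2"]
    obtain R where R: "R \<in> coded_sets t" "prob ((Q -` {q} \<inter> space \<nu>) - R) + prob (R - (Q -` {q} \<inter> space \<nu>)) < d^2"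
      using s sets_coded[of t] d by auto
    obtain n where "\<And>m. m \<ge> n \<Longrightarrow> \<exists>B. R = code m -` B \<inter> X" by (rule coded_sets_level[OF R(1)]) blast
    then show ?thesis using R(2) unfolding sp by (metis less_imp_le)
  qed
  then obtain n where n: "\<And>q m. m \<ge> n q \<Longrightarrow> \<exists>B. prob ((Q -` {q} \<inter> space \<nu>) - (code m -` B \<inter> space \<nu>)) + prob ((code m -` B \<inter> space \<nu>) - (Q -` {q} \<inter> space \<nu>)) \<le> d^2"
    by metis
  define m where "m = Max (insert 0 (n ` Q ` space \<nu>))"
  have m: "n q \<le> m" if "q \<in> Q ` space \<nu>" for q using fin that unfolding m_def by (intro Max_ge) auto
  then have "\<forall>q\<in>Q ` space \<nu>. \<exists>B.
    prob ((Q -` {q} \<inter> space \<nu>) - (code m -` B \<inter> space \<nu>)) + prob ((code m -` B \<inter> space \<nu>) - (Q -` {q} \<inter> space \<nu>)) \<le> d^2"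
    using n by auto
  from bchoice[OF this] obtain B where B: "\<And>q. q \<in> Q ` space \<nu> \<Longrightarrow>
    prob ((Q -` {q} \<inter> space \<nu>) - (code m -` B q \<inter> space \<nu>)) + prob ((code m -` B q \<inter> space \<nu>) - (Q -` {q} \<inter> space \<nu>)) \<le> d^2"
    by auto
  have "ent \<nu> (\<lambda>x. (Q x, code m x)) - ent \<nu> (code m) \<le> ?N * (d + d^2 / d)"
    by (rule conditional_ent_le[OF Q simple_code[OF s] d B])
  also have "\<dots> = 2 * ?N * d" using d by (simp add: power2_eq_square)
  also have "\<dots> \<le> 2 * ?N * (e / (2 * (?N + 1)))" by (intro mult_left_mono) (auto simp: d_def)
  also have "\<dots> \<le> e" using e by (simp add: field_simps)
  finally have "ent \<nu> (\<lambda>x. (Q x, code m x)) - ent \<nu> (code m) \<le> e" .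
  moreover have "ent_rate \<nu> left_shift Q \<le> ent_rate \<nu> left_shift (code m) + (ent \<nu> (\<lambda>x. (Q x, code m x)) - ent \<nu> (code m))"
    by (rule ent_rate_le_conditional[OF Q simple_code[OF s]])
  moreover have "ent_rate \<nu> left_shift (code m) \<le> ent_rate \<nu> left_shift (lab m)"
    by (rule ent_rate_itin_le[OF simple_lab[OF s]])
  ultimately show ?thesis by (intro exI[of _ m]) linarith
qed

text \<open>A form of the Kolmogorov-Sinai generator theorem: no finite coding need generate, but
  the increasing family of them does.\<close>

lemma ks_entropy_le_lab:
  assumes \<nu>: "\<nu> \<in> invariant_measures t" and c: "\<And>m. ent_rate \<nu> left_shift (lab m) \<le> c"
  shows "ks_entropy \<nu> left_shift \<le> ereal c"
proof -
  interpret measure_preserving \<nu> left_shift by (rule invariant_measure_preserving[OF \<nu>])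
  show ?thesis
  proof (rule ks_entropy_le)
    fix Q :: "(nat \<Rightarrow> 'a) \<Rightarrow> (nat \<Rightarrow> 'a) set" assume Q: "simple_function \<nu> Q"
    have "ent_rate \<nu> left_shift Q \<le> c"
    proof (rule field_le_epsilon)
      fix e :: real assume "e > 0"
      from ent_rate_approx[OF \<nu> Q this] show "ent_rate \<nu> left_shift Q \<le> c + e"
        using c by (meson add_right_mono order_trans)
    qed
    then show "ereal (ent_rate \<nu> left_shift Q) \<le> ereal c" by simp
  qed
qed

subsection \<open>Entropy of Gibbs measures\<close>

lemma lab_coarsen: "m \<le> n \<Longrightarrow> lab m x = min (lab n x) m"
  by (simp add: lab_def)

lemma ent_rate_lab_mono:
  assumes \<nu>: "\<nu> \<in> invariant_measures t" and mn: "m \<le> n"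
  shows "ent_rate \<nu> left_shift (lab m) \<le> ent_rate \<nu> left_shift (lab n)"
proof -
  have s: "sets \<nu> = sets (shift_borel t)" using \<nu> by (auto simp: invariant_measures_def)
  interpret measure_preserving \<nu> left_shift by (rule invariant_measure_preserving[OF \<nu>])
  have "ent \<nu> (\<lambda>x. (lab m x, lab n x)) \<le> ent \<nu> (lab n)"
    using lab_coarsen[OF mn] by (intro ent_mono[OF simple_lab[OF s], where g="\<lambda>a. (min a m, a)"]) simp
  then show ?thesis
    using ent_rate_le_conditional[OF simple_lab[OF s, of m] simple_lab[OF s, of n]] by linarith
qed

text \<open>Only cells without merged letters are single cylinders, where the upper Gibbs bound
  applies. On the remaining cells \<open>- ln\<close> of the mass is merely nonnegative, but their
  share of the integral vanishes as \<open>M\<close> grows by dominated convergence, which rests on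
  integrability of the potential. The loss of 1 pays for the truncation, \<open>K + ln C\<close> for
  distortion and the Gibbs constant.\<close>

lemma gibbs_ent_code_ge:
  assumes \<mu>: "\<mu> \<in> invariant_measures t" and gb: "gibbs C \<mu>"
  shows "\<exists>M0. \<forall>M\<ge>M0. real k * (p - (\<integral>x. \<phi> x \<partial>\<mu>)) - K - ln C - 1 \<le> ent \<mu> (itin left_shift (lab M) k)"
proof -
  note int = gibbs_integrable[OF \<mu> gb]
  have s: "sets \<mu> = sets (shift_borel t)" and "prob_space \<mu>" using \<mu> by (auto simp: invariant_measures_def)
  interpret prob_space \<mu> by fact
  have sp: "space \<mu> = X" using sets_eq_imp_space_eq[OF s] by simp
  have C: "C \<ge> 1" and up: "\<And>w. prob (cyl w) \<le> C * rho w" using gb by (auto simp: gibbs_def)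
  define h where "h x = real k * p - K - ln C - S k x" for x
  have hint: "integrable \<mu> h" unfolding h_def
    using integral_birkhoff(1)[OF \<mu> int] by (intro Bochner_Integration.integrable_diff) auto
  have hval: "(\<integral>x. h x \<partial>\<mu>) = real k * (p - (\<integral>x. \<phi> x \<partial>\<mu>)) - K - ln C"
    unfolding h_def using integral_birkhoff[OF \<mu> int]
    by (subst Bochner_Integration.integral_diff) (auto simp: prob_space algebra_simps)
  \<comment> \<open>The points whose first \<open>k\<close> letters are all unmerged at level
    \<open>M\<close>.\<close>
  define U where "U M = {x \<in> X. \<forall>i<k. to_nat (x i) < M}" for M
  have U: "U M = itin left_shift (lab M) k -` {l. \<forall>i<k. l ! i < M} \<inter> X" for M
    by (auto simp: U_def itin_lab min_less_iff_disj)
  have Us: "U M \<in> events" for M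
    unfolding U sp[symmetric] by (rule simple_sets[OF simple_code[OF s]])
  have lim: "(\<lambda>M. \<integral>x. indicator (U M) x * h x \<partial>\<mu>) \<longlonglongrightarrow> (\<integral>x. h x \<partial>\<mu>)"
  proof (rule integral_dominated_convergence[where w="\<lambda>x. \<bar>h x\<bar>"])
    show "AE x in \<mu>. (\<lambda>M. indicator (U M) x * h x) \<longlonglongrightarrow> h x"
    proof (intro AE_I2)
      fix x assume "x \<in> space \<mu>"
      then have x: "x \<in> X" using sp by simp
      define M0 where "M0 = Suc (Max (insert 0 ((\<lambda>i. to_nat (x i)) ` {..<k})))"
      have "x \<in> U M" if "M \<ge> M0" for M
      proof -
        have "to_nat (x i) < M" if "i < k" for i
        proof -
          have "to_nat (x i) \<le> Max (insert 0 ((\<lambda>i. to_nat (x i)) ` {..<k}))" using that by (intro Max_ge) auto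
          then show ?thesis using \<open>M \<ge> M0\<close> by (simp add: M0_def)
        qed
        then show ?thesis using x by (simp add: U_def)
      qed
      then have "eventually (\<lambda>M. indicator (U M) x * h x = h x) sequentially"
        by (intro eventually_sequentiallyI[of M0]) simp
      then show "(\<lambda>M. indicator (U M) x * h x) \<longlonglongrightarrow> h x" by (rule tendsto_eventually)
    qed
    show "AE x in \<mu>. norm (indicator (U M) x * h x) \<le> \<bar>h x\<bar>" for M
      by (auto split: split_indicator)
    show "(\<lambda>x. indicator (U M) x * h x) \<in> borel_measurable \<mu>" for M
      using Us borel_measurable_integrable[OF hint] by simp
  qed (use hint in auto)
  have ent_ge: "(\<integral>x. indicator (U M) x * h x \<partial>\<mu>) \<le> ent \<mu> (itin left_shift (lab M) k)" for M
  proof -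
    let ?Y = "itin left_shift (lab M) k :: (nat \<Rightarrow> 'a) \<Rightarrow> _"
    have Y: "simple_function \<mu> ?Y" by (rule simple_code[OF s])
    have "ent \<mu> ?Y = (\<integral>x. - ln (prob (?Y -` {?Y x} \<inter> X)) \<partial>\<mu>)"
      using integral_simple_comp(2)[OF Y, of "\<lambda>v. - ln (prob (?Y -` {v} \<inter> X))"]
      by (simp add: ent_def eta_def sp)
    moreover have "(\<integral>x. indicator (U M) x * h x \<partial>\<mu>) \<le> (\<integral>x. - ln (prob (?Y -` {?Y x} \<inter> X)) \<partial>\<mu>)"
    proof (rule integral_mono)
      show "integrable \<mu> (\<lambda>x. indicator (U M) x * h x)"
        using integrable_mult_indicator[OF Us hint] by simp
      show "integrable \<mu> (\<lambda>x. - ln (prob (?Y -` {?Y x} \<inter> X)))" by (rule integral_simple_comp(1)[OF Y])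
      fix x assume "x \<in> space \<mu>"
      then have x: "x \<in> X" using sp by simp
      have pos: "prob (?Y -` {?Y x} \<inter> X) > 0" by (rule cross_entropy_le(2)[OF \<mu> gb \<mu> int x])
      show "indicator (U M) x * h x \<le> - ln (prob (?Y -` {?Y x} \<inter> X))"
      proof (cases "x \<in> U M")
        case False
        have "ln (prob (?Y -` {?Y x} \<inter> X)) \<le> 0" using pos by simp
        then show ?thesis using False by simp
      next
        case True
        let ?w = "prefix_of k x"
        have "?Y -` {?Y x} \<inter> X \<subseteq> cyl ?w"
        proof
          fix y assume "y \<in> ?Y -` {?Y x} \<inter> X"
          then have y: "?Y y = ?Y x" "y \<in> X" by auto
          have "y i = x i" if "i < k" for i
          proof -
            have "min (to_nat (y i)) M = min (to_nat (x i)) M"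
              using arg_cong[OF y(1), of "\<lambda>l. l ! i"] that by (simp add: itin_lab)
            moreover have "to_nat (x i) < M" using True that by (simp add: U_def)
            ultimately have "to_nat (y i) = to_nat (x i)" by (simp add: min_def split: if_splits)
            then show ?thesis by simp
          qed
          then show "y \<in> cyl ?w" using y by (auto simp: cylinder_def)
        qed
        then have "prob (?Y -` {?Y x} \<inter> X) \<le> prob (cyl ?w)" by (intro finite_measure_mono) (simp_all add: s)
        also have "\<dots> \<le> C * rho ?w" by (rule up)
        also have "\<dots> \<le> C * (exp K * exp (S k x - real k * p))"
          using rho_le[OF in_cylinder_prefix[OF x, of k]] C by (intro mult_left_mono) auto
        finally have "ln (prob (?Y -` {?Y x} \<inter> X)) \<le> ln (C * (exp K * exp (S k x - real k * p)))"
          using pos C by (subst ln_le_cancel_iff) auto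
        also have "\<dots> = ln C + K + S k x - real k * p" using C by (simp add: ln_mult)
        finally show ?thesis using True by (simp add: h_def)
      qed
    qed
    ultimately show ?thesis by simp
  qed
  have "eventually (\<lambda>M. (\<integral>x. h x \<partial>\<mu>) - 1 < (\<integral>x. indicator (U M) x * h x \<partial>\<mu>)) sequentially"
    by (rule order_tendstoD(1)[OF lim]) simp
  then obtain M0 where "\<And>M. M \<ge> M0 \<Longrightarrow> (\<integral>x. h x \<partial>\<mu>) - 1 < (\<integral>x. indicator (U M) x * h x \<partial>\<mu>)"
    unfolding eventually_sequentially by blast
  then show ?thesis using ent_ge unfolding hval by (meson less_imp_le order_trans)
qed

text \<open>The truncation level in the preceding estimate depends on the word length
  \<open>k\<close>, whereas an entropy rate needs a fixed label. The one-step entropies of all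
  labels are bounded, so some \<open>m\<close> is within \<open>e\<close> of their supremum;
  refining it further then costs at most \<open>e\<close> per coordinate, uniformly in
  \<open>k\<close>.\<close>

lemma gibbs_ent_rate_ge:
  assumes \<mu>: "\<mu> \<in> invariant_measures t" and gb: "gibbs C \<mu>" and e: "e > 0"
  shows "\<exists>m. p - (\<integral>x. \<phi> x \<partial>\<mu>) - e \<le> ent_rate \<mu> left_shift (lab m)"
proof -
  note int = gibbs_integrable[OF \<mu> gb]
  have s: "sets \<mu> = sets (shift_borel t)" using \<mu> by (auto simp: invariant_measures_def)
  interpret measure_preserving \<mu> left_shift by (rule invariant_measure_preserving[OF \<mu>])
  let ?q = "p - (\<integral>x. \<phi> x \<partial>\<mu>)"
  note sl = simple_lab[OF s]
  have bdd: "ent \<mu> (lab m) \<le> ?q + ln C" for m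
  proof -
    have "ent \<mu> (lab m) \<le> ent \<mu> (itin left_shift (lab m) 1)"
      by (rule ent_mono[OF simple_code[OF s], where g=hd]) (simp add: itin_def)
    then show ?thesis using ent_code_le[OF \<mu> gb \<mu> int, of m 1] by simp
  qed
  have "\<exists>m. \<forall>n\<ge>m. ent \<mu> (lab n) - ent \<mu> (lab m) \<le> e"
  proof -
    have "bdd_above (range (\<lambda>m. ent \<mu> (lab m)))" using bdd by (intro bdd_aboveI[of _ "?q + ln C"]) auto
    then have sup: "ent \<mu> (lab n) \<le> (SUP m. ent \<mu> (lab m))" for n by (intro cSUP_upper) auto
    obtain m where m: "(SUP m. ent \<mu> (lab m)) - e < ent \<mu> (lab m)"
      using less_cSupD[of "range (\<lambda>m. ent \<mu> (lab m))" "(SUP m. ent \<mu> (lab m)) - e"] e by auto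
    have "ent \<mu> (lab n) - ent \<mu> (lab m) \<le> e" for n using sup[of n] m by linarith
    then show ?thesis by blast
  qed
  then obtain m where m: "\<And>n. n \<ge> m \<Longrightarrow> ent \<mu> (lab n) - ent \<mu> (lab m) \<le> e" by blast
  \<comment> \<open>\<open>M\<close> may depend on \<open>k\<close>: it occurs only as an
    intermediate level, compared with the fixed \<open>m\<close> coordinate by coordinate.\<close>
  have key: "real k * (?q - e) - (K + ln C + 1) \<le> ent \<mu> (itin left_shift (lab m) k)" for k
  proof -
    obtain M0 where M0: "\<And>M. M \<ge> M0 \<Longrightarrow> real k * ?q - K - ln C - 1 \<le> ent \<mu> (itin left_shift (lab M) k)"
      using gibbs_ent_code_ge[OF \<mu> gb, of k] by blast
    define M where "M = max M0 m"
    have "ent \<mu> (itin left_shift (lab M) k) \<le> ent \<mu> (\<lambda>x. (itin left_shift (lab M) k x, itin left_shift (lab m) k x))"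
      using simple_code[OF s] by (intro ent_mono[where g=fst] simple_function_Pair) auto
    also have "\<dots> \<le> ent \<mu> (itin left_shift (lab m) k) + real k * (ent \<mu> (\<lambda>x. (lab M x, lab m x)) - ent \<mu> (lab m))"
      by (rule ent_itin_Pair_le[OF sl sl])
    also have "\<dots> \<le> ent \<mu> (itin left_shift (lab m) k) + real k * e"
    proof (intro add_left_mono mult_left_mono)
      have "ent \<mu> (\<lambda>x. (lab M x, lab m x)) \<le> ent \<mu> (lab M)"
        using lab_coarsen[of m M] by (intro ent_mono[OF sl, where g="\<lambda>a. (a, min a m)"]) (simp add: M_def)
      then show "ent \<mu> (\<lambda>x. (lab M x, lab m x)) - ent \<mu> (lab m) \<le> e" using m[of M] by (simp add: M_def)
    qed simp
    finally show ?thesis using M0[of M] by (simp add: M_def algebra_simps)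
  qed
  have "?q - e \<le> ent_rate \<mu> left_shift (lab m)"
  proof (rule LIMSEQ_le[OF _ ent_rate_LIMSEQ[OF sl]])
    show "(\<lambda>k. (?q - e) - (K + ln C + 1) / real k) \<longlonglongrightarrow> ?q - e"
      using tendsto_diff[OF tendsto_const lim_const_over_n] by simp
    have "(?q - e) - (K + ln C + 1) / real k \<le> ent \<mu> (itin left_shift (lab m) k) / real k" if "k \<ge> 1" for k
      using divide_right_mono[OF key[of k], of "real k"] that by (simp add: diff_divide_distrib)
    then show "\<exists>N. \<forall>n\<ge>N. (?q - e) - (K + ln C + 1) / real n \<le> ent \<mu> (itin left_shift (lab m) n) / real n" by blast
  qed
  then show ?thesis by blast
qed


subsection \<open>Gibbs measures are the unique equilibrium states\<close>

lemma variational_le: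
  assumes \<mu>: "\<mu> \<in> invariant_measures t" and gb: "gibbs C \<mu>" and \<nu>: "\<nu> \<in> invariant_measures_for t \<phi>"
  shows "ks_entropy \<nu> left_shift + ereal_integral \<nu> \<phi> \<le> ereal p"
proof -
  have inv: "\<nu> \<in> invariant_measures t" and int: "integrable \<nu> \<phi>"
    using \<nu> ereal_integral_potential(1)[of \<nu>] by (auto simp: invariant_measures_for_def)
  have "ks_entropy \<nu> left_shift \<le> ereal (p - (\<integral>x. \<phi> x \<partial>\<nu>))"
    by (rule ks_entropy_le_lab[OF inv ent_rate_lab_le[OF \<mu> gb inv int]])
  then have "ks_entropy \<nu> left_shift + ereal (\<integral>x. \<phi> x \<partial>\<nu>) \<le> ereal (p - (\<integral>x. \<phi> x \<partial>\<nu>)) + ereal (\<integral>x. \<phi> x \<partial>\<nu>)"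
    by (rule add_right_mono)
  then show ?thesis using ereal_integral_potential(2)[OF inv int] by simp
qed

lemma gibbs_variational_eq:
  assumes \<mu>: "\<mu> \<in> invariant_measures t" and gb: "gibbs C \<mu>"
  shows "\<mu> \<in> invariant_measures_for t \<phi>" "ks_entropy \<mu> left_shift + ereal_integral \<mu> \<phi> = ereal p"
proof -
  note int = gibbs_integrable[OF \<mu> gb]
  have s: "sets \<mu> = sets (shift_borel t)" using \<mu> by (auto simp: invariant_measures_def)
  interpret measure_preserving \<mu> left_shift by (rule invariant_measure_preserving[OF \<mu>])
  show mem: "\<mu> \<in> invariant_measures_for t \<phi>"
    using \<mu> int ereal_integral_potential(1)[OF \<mu>] by (simp add: invariant_measures_for_def)
  have "ereal (p - (\<integral>x. \<phi> x \<partial>\<mu>)) \<le> ks_entropy \<mu> left_shift"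
  proof (rule ereal_le_epsilon2)
    fix e :: real assume "e > 0"
    from gibbs_ent_rate_ge[OF \<mu> gb this] obtain m where m: "p - (\<integral>x. \<phi> x \<partial>\<mu>) - e \<le> ent_rate \<mu> left_shift (lab m)" ..
    have "ereal (p - (\<integral>x. \<phi> x \<partial>\<mu>)) \<le> ereal (ent_rate \<mu> left_shift (lab m)) + ereal e" using m by simp
    also have "\<dots> \<le> ks_entropy \<mu> left_shift + ereal e"
      by (intro add_right_mono ks_entropy_ge simple_lab[OF s])
    finally show "ereal (p - (\<integral>x. \<phi> x \<partial>\<mu>)) \<le> ks_entropy \<mu> left_shift + ereal e" .
  qed
  then have "ereal (p - (\<integral>x. \<phi> x \<partial>\<mu>)) + ereal (\<integral>x. \<phi> x \<partial>\<mu>) \<le> ks_entropy \<mu> left_shift + ereal (\<integral>x. \<phi> x \<partial>\<mu>)"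
    by (rule add_right_mono)
  then have "ereal p \<le> ks_entropy \<mu> left_shift + ereal_integral \<mu> \<phi>"
    using ereal_integral_potential(2)[OF \<mu> int] by simp
  then show "ks_entropy \<mu> left_shift + ereal_integral \<mu> \<phi> = ereal p"
    using variational_le[OF \<mu> gb mem] by (rule antisym[rotated])
qed

lemma pressure_eq:
  assumes \<mu>: "\<mu> \<in> invariant_measures t" and gb: "gibbs C \<mu>"
  shows "pressure t \<phi> = ereal p"
  unfolding pressure_def
proof (rule antisym)
  show "(SUP \<nu>\<in>invariant_measures_for t \<phi>. ks_entropy \<nu> left_shift + ereal_integral \<nu> \<phi>) \<le> ereal p"
    by (intro SUP_least variational_le[OF \<mu> gb])
  show "ereal p \<le> (SUP \<nu>\<in>invariant_measures_for t \<phi>. ks_entropy \<nu> left_shift + ereal_integral \<nu> \<phi>)"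
    unfolding gibbs_variational_eq(2)[OF \<mu> gb, symmetric] by (rule SUP_upper[OF gibbs_variational_eq(1)[OF \<mu> gb]])
qed

lemma log_partition_LIMSEQ: "(\<lambda>n. ennreal_log (partition_function t \<phi> n) / ereal (real n)) \<longlonglongrightarrow> ereal p"
proof (rule Lim_transform_eventually)
  show "(\<lambda>n. ereal (ln (enn2real (Z n)) / real n)) \<longlonglongrightarrow> ereal p"
    using p_LIMSEQ by simp
  show "\<forall>\<^sub>F n in sequentially. ereal (ln (enn2real (Z n)) / real n) = ennreal_log (partition_function t \<phi> n) / ereal (real n)"
  proof (rule eventually_sequentiallyI[of 1])
    fix n :: nat assume n: "1 \<le> n"
    have "ennreal_log (Z n) = ereal (ln (enn2real (Z n)))"
      using Z_pos[of n] Z_finite[of n] by (auto simp: ennreal_log_def)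
    then show "ereal (ln (enn2real (Z n)) / real n) = ennreal_log (partition_function t \<phi> n) / ereal (real n)"
      using n by (simp add: partition_function_eq)
  qed
qed

lemma gibbs_equilibrium:
  assumes \<mu>: "\<mu> \<in> invariant_measures t" and gb: "gibbs C \<mu>"
  shows "equilibrium_state t \<phi> \<mu>"
  unfolding equilibrium_state_def pressure_eq[OF \<mu> gb]
  using log_partition_LIMSEQ gibbs_variational_eq[OF \<mu> gb] by simp

text \<open>For an equilibrium state the relative entropy with respect to \<open>\<mu>\<close> is
  bounded by \<open>ln C + 1\<close> at suitably fine codings of every length. Testing it with
  \<open>r\<close> on \<open>A\<close> and 0 elsewhere gives a bound whose constant depends neither
  on \<open>A\<close> nor on \<open>r\<close>.\<close>

lemma equilibrium_bound_coded:
  assumes \<mu>: "\<mu> \<in> invariant_measures t" and gb: "gibbs C \<mu>"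
    and eq: "equilibrium_state t \<phi> \<nu>" and A: "A \<in> coded_sets t" and r: "r \<ge> 0"
  shows "r * measure \<nu> A \<le> ln C + 2 + exp r * measure \<mu> A"
proof -
  have mem: "\<nu> \<in> invariant_measures_for t \<phi>" and veq: "ks_entropy \<nu> left_shift + ereal_integral \<nu> \<phi> = ereal p"
    using eq unfolding equilibrium_state_def pressure_eq[OF \<mu> gb] by auto
  have \<nu>: "\<nu> \<in> invariant_measures t" and int: "integrable \<nu> \<phi>"
    using mem ereal_integral_potential(1)[of \<nu>] by (auto simp: invariant_measures_for_def)
  have s: "sets \<nu> = sets (shift_borel t)" "sets \<mu> = sets (shift_borel t)" and "prob_space \<mu>" using \<mu> \<nu> by (auto simp: invariant_measures_def)
  interpret measure_preserving \<nu> left_shift by (rule invariant_measure_preserving[OF \<nu>])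
  interpret M: prob_space \<mu> by fact
  have sp: "space \<nu> = X" "space \<mu> = X" using sets_eq_imp_space_eq[OF s(1)] sets_eq_imp_space_eq[OF s(2)] by auto
  let ?q = "p - (\<integral>x. \<phi> x \<partial>\<nu>)"
  have ks: "ks_entropy \<nu> left_shift = ereal ?q"
    using veq unfolding ereal_integral_potential(2)[OF \<nu> int] by (cases "ks_entropy \<nu> left_shift") auto
  have near: "\<exists>m. ?q - e < ent_rate \<nu> left_shift (lab m)" if "e > 0" for e
  proof (rule ccontr)
    assume "\<nexists>m. ?q - e < ent_rate \<nu> left_shift (lab m)"
    then have "ent_rate \<nu> left_shift (lab m) \<le> ?q - e" for m by (simp add: not_less)
    from ks_entropy_le_lab[OF \<nu> this] show False using that unfolding ks by simp
  qed
  obtain n0 where n0: "\<And>m. m \<ge> n0 \<Longrightarrow> \<exists>B. A = code m -` B \<inter> X" by (rule coded_sets_level[OF A]) blast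
  define n where "n = Suc n0"
  obtain B where B: "A = code n -` B \<inter> X" using n0[of n] by (auto simp: n_def)
  \<comment> \<open>The tolerance \<open>1 / n\<close> becomes the constant 1 after multiplication
    by the word length \<open>n\<close>.\<close>
  obtain m0 where m0: "?q - 1 / real n < ent_rate \<nu> left_shift (lab m0)" using near[of "1 / real n"] by (auto simp: n_def)
  define m where "m = max m0 n"
  have "?q - 1 / real n \<le> ent_rate \<nu> left_shift (lab m)"
    using m0 ent_rate_lab_mono[OF \<nu>, of m0 m] by (simp add: m_def)
  then have "real n * (?q - 1 / real n) \<le> real n * ent_rate \<nu> left_shift (lab m)" by (intro mult_left_mono) auto
  then have ent_lo: "real n * ?q - 1 \<le> ent \<nu> (itin left_shift (lab m) n)"
    using ent_rate_le[OF simple_lab[OF s(1)], of n m] by (simp add: algebra_simps n_def)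
  let ?Y = "itin left_shift (lab m) n :: (nat \<Rightarrow> 'a) \<Rightarrow> _"
  \<comment> \<open>The label level is raised to \<open>m\<close> for the entropy while the length
    stays \<open>n\<close>; truncating labels back to \<open>n\<close> recovers the description of
    \<open>A\<close>.\<close>
  define B' where "B' = {l. map (\<lambda>a. min a n) l \<in> B}"
  have AB: "A = ?Y -` B' \<inter> X"
  proof -
    have "code n x = map (\<lambda>a. min a n) (?Y x)" for x :: "nat \<Rightarrow> 'a"
      by (auto simp: itin_lab m_def)
    then show ?thesis unfolding B B'_def by auto
  qed
  note Y = simple_code[OF s(1), of m n] simple_code[OF s(2), of m n]
  have fin: "finite (?Y ` X)" using Y(1) sp by (simp add: simple_function_def)
  define f where "f v = (if v \<in> B' then r else 0)" for v
  have nA: "measure \<nu> A = (\<Sum>v\<in>?Y ` X. if v \<in> B' then measure \<nu> (?Y -` {v} \<inter> X) else 0)"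
    using pr_sum[OF Y(1), of id B'] fin by (simp add: AB sp sum.inter_filter)
  have mA: "measure \<mu> A = (\<Sum>v\<in>?Y ` X. if v \<in> B' then measure \<mu> (?Y -` {v} \<inter> X) else 0)"
    using M.pr_sum[OF Y(2), of id B'] fin by (simp add: AB sp sum.inter_filter)
  have m1: "(\<Sum>v\<in>?Y ` X. measure \<mu> (?Y -` {v} \<inter> X)) = 1" using M.sum_pr[OF Y(2)] by (simp add: sp)
  \<comment> \<open>The values \<open>exp (r - 1)\<close> and \<open>exp (- 1)\<close> are estimated
    crudely by \<open>exp r\<close> and 1. The total \<open>\<mu>\<close>-mass subtracted on the
    left covers the cells outside \<open>A\<close> and accounts for the second unit in
    \<open>ln C + 2\<close>.\<close>
  have "r * measure \<nu> A - exp r * measure \<mu> A - (\<Sum>v\<in>?Y ` X. measure \<mu> (?Y -` {v} \<inter> X)) \<le>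
    (\<Sum>v\<in>?Y ` X. measure \<nu> (?Y -` {v} \<inter> X) * f v - measure \<mu> (?Y -` {v} \<inter> X) * exp (f v - 1))"
    unfolding nA mA sum_distrib_left sum_subtractf[symmetric]
  proof (intro sum_mono)
    fix v
    let ?b = "measure \<mu> (?Y -` {v} \<inter> X)"
    have 1: "?b * exp (r - 1) \<le> exp r * ?b + ?b"
      using mult_left_mono[of "exp (r - 1)" "exp r" ?b] by (simp add: mult.commute add_increasing2)
    have 2: "?b * exp (0 - 1) \<le> ?b"
      using mult_left_mono[of "exp (0 - 1)" "1::real" ?b] by simp
    show "r * (if v \<in> B' then measure \<nu> (?Y -` {v} \<inter> X) else 0) - exp r * (if v \<in> B' then ?b else 0) - ?b
      \<le> measure \<nu> (?Y -` {v} \<inter> X) * f v - ?b * exp (f v - 1)"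
    proof (cases "v \<in> B'")
      case True
      then show ?thesis using 1 by (simp only: f_def if_True mult.commute[of r])
    next
      case False
      then show ?thesis using 2 by (simp only: f_def if_False)
    qed
  qed
  also have "\<dots> \<le> real n * ?q + ln C - ent \<nu> ?Y" by (rule relative_entropy_bound[OF \<mu> gb \<nu> int])
  also have "\<dots> \<le> ln C + 1" using ent_lo by simp
  finally show ?thesis unfolding m1 by simp
qed

text \<open>On a \<open>\<mu>\<close>-null set, approximated by coded sets for both measures at
  once, the term with \<open>exp r\<close> disappears. What remains is
  \<open>r * N.prob A \<le> ln C + 2\<close> for every \<open>r > 0\<close>, so the
  \<open>\<nu>\<close>-mass is 0 and rigidity under absolute continuity applies.\<close>

lemma equilibrium_eq_gibbs:
  assumes \<mu>: "\<mu> \<in> invariant_measures t" and gb: "gibbs C \<mu>" and eq: "equilibrium_state t \<phi> \<nu>"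
  shows "\<nu> = \<mu>"
proof (rule gibbs_absolutely_continuous_eq[OF \<mu> gb])
  show \<nu>: "\<nu> \<in> invariant_measures t" using eq by (simp add: equilibrium_state_def invariant_measures_for_def)
  have s: "sets \<nu> = sets \<mu>" "sets \<mu> = sets (shift_borel t)" and ps: "prob_space \<mu>" "prob_space \<nu>" using \<mu> \<nu> by (auto simp: invariant_measures_def)
  interpret M: prob_space \<mu> by fact
  interpret N: prob_space \<nu> by fact
  show "absolutely_continuous \<mu> \<nu>"
    unfolding absolutely_continuous_def
  proof
    fix A assume A: "A \<in> null_sets \<mu>"
    then have As: "A \<in> sets \<mu>" and A0: "M.prob A = 0" by (auto simp: measure_def null_setsD1)
    have bound: "r * N.prob A \<le> ln C + 2" if r: "r > 0" for r
    proof (rule field_le_epsilon)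
      fix e :: real assume e: "e > 0"
      \<comment> \<open>The approximation error enters with factor \<open>r\<close> through
        \<open>\<nu>\<close> and with factor \<open>exp r\<close> through \<open>\<mu>\<close>; this
        choice makes the total \<open>e\<close>.\<close>
      define d where "d = e / (r + exp r)"
      have re: "r + exp r > 0" using r by (simp add: add_pos_pos)
      have d: "d > 0" using e re by (simp add: d_def)
      obtain R where R: "R \<in> coded_sets t" "M.prob (A - R) + M.prob (R - A) < d" "N.prob (A - R) + N.prob (R - A) < d"
        using approximation_by_algebra[OF M.finite_measure_axioms N.finite_measure_axioms s(1) _ algebra_coded_sets As d, of t]
          s(2) sets_coded[of t] by auto
      have Rs: "R \<in> sets \<mu>" using R(1) s(2) sets_coded[of t] by auto
      have "N.prob A \<le> N.prob (R \<union> (A - R))" using As Rs s by (intro N.finite_measure_mono) auto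
      also have "\<dots> \<le> N.prob R + N.prob (A - R)" using As Rs s by (intro measure_Un_le) auto
      finally have n: "N.prob A \<le> N.prob R + d" using R(3) measure_nonneg[of \<nu> "R - A"] by linarith
      have "M.prob R \<le> M.prob (A \<union> (R - A))" using As Rs by (intro M.finite_measure_mono) auto
      also have "\<dots> \<le> M.prob A + M.prob (R - A)" using As Rs by (intro measure_Un_le) auto
      finally have m: "M.prob R \<le> d" using R(2) A0 measure_nonneg[of \<mu> "A - R"] by linarith
      have "r * N.prob A \<le> r * (N.prob R + d)" using n r by (intro mult_left_mono) auto
      also have "\<dots> = r * N.prob R + r * d" by (simp add: algebra_simps)
      also have "r * N.prob R \<le> ln C + 2 + exp r * M.prob R"
        using r by (intro equilibrium_bound_coded[OF \<mu> gb eq R(1)]) simp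
      also have "exp r * M.prob R \<le> exp r * d" using m by (intro mult_left_mono) auto
      finally have "r * N.prob A \<le> ln C + 2 + (r + exp r) * d" by (simp add: algebra_simps)
      also have "(r + exp r) * d = e" using re by (simp add: d_def)
      finally show "r * N.prob A \<le> ln C + 2 + e" .
    qed
    have "N.prob A = 0"
    proof (rule ccontr)
      assume "N.prob A \<noteq> 0"
      then have a: "N.prob A > 0" by (simp add: zero_less_measure_iff)
      have C: "C \<ge> 1" using gb by (simp add: gibbs_def)
      \<comment> \<open>Makes the left side of \<open>bound\<close> equal to
        \<open>ln C + 3\<close>.\<close>
      define r where "r = (ln C + 3) / N.prob A"
      have "r > 0" using a C by (simp add: r_def add_nonneg_pos)
      from bound[OF this] show False using a by (simp add: r_def)
    qed
    then show "A \<in> null_sets \<nu>" using As s by (simp add: null_sets_def N.emeasure_eq_measure)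
  qed
qed

end

section \<open>Weak convergence from cylinders\<close>

text \<open>Because the limit is a probability measure, no separate tightness is needed: finitely
  many cylinders on which \<open>f\<close> hardly varies carry almost all of its mass, and
  convergence on these finitely many sets forces the approximating measures to have almost all of
  their mass there too.\<close>

lemma weak_star_from_cylinders:
  fixes t :: "'a::{countable, discrete_topology} \<Rightarrow> 'a \<Rightarrow> bool"
  assumes \<mu>: "prob_space \<mu>" "sets \<mu> = sets (shift_borel t)"
    and M: "\<forall>\<^sub>F n in sequentially. prob_space (M n) \<and> sets (M n) = sets (shift_borel t)"
    and cyl: "\<And>w. (\<lambda>n. measure (M n) (cylinder t w)) \<longlonglongrightarrow> measure \<mu> (cylinder t w)"
  shows "weak_star_converges t M \<mu>"
  unfolding weak_star_converges_def
proof (intro allI impI)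
  fix f :: "(nat \<Rightarrow> 'a) \<Rightarrow> real"
  let ?X = "markov_shift t"
  assume cont: "continuous_on ?X f" and bdd: "bounded (f ` ?X)"
  interpret \<mu>: prob_space \<mu> by fact
  have sp: "space \<mu> = ?X" using sets_eq_imp_space_eq[OF \<mu>(2)] by simp
  obtain B where B: "B > 0" "\<And>x. x \<in> ?X \<Longrightarrow> \<bar>f x\<bar> \<le> B" using bdd unfolding bounded_pos by auto
  show "(\<lambda>n. \<integral>x. f x \<partial>M n) \<longlonglongrightarrow> (\<integral>x. f x \<partial>\<mu>)"
  proof (rule tendstoI)
    fix e0 :: real assume e0: "e0 > 0"
    \<comment> \<open>Two step-function approximations cost \<open>e + B * e\<close> each and the
      comparison of the step integrals costs \<open>e\<close>; \<open>c\<close> leaves room for a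
      strict inequality.\<close>
    define c where "c = 3 + 3 * B"
    have c: "c > 0" using B by (simp add: c_def)
    define e where "e = e0 / (2 * c)"
    have e: "e > 0" using e0 c by (simp add: e_def)
    define osc where "osc w \<longleftrightarrow> (\<forall>x\<in>cylinder t w. \<forall>y\<in>cylinder t w. \<bar>f x - f y\<bar> \<le> e)" for w
    have ex: "\<exists>n. osc (prefix_of n x)" if x: "x \<in> ?X" for x
    proof -
      have "(f \<longlongrightarrow> f x) (at x within ?X)" using cont x by (simp add: continuous_on_def)
      then have "\<forall>\<^sub>F y in at x within ?X. dist (f y) (f x) < e / 2" using e by (intro tendstoD) auto
      then obtain U where U: "open U" "x \<in> U" "\<And>y. y \<in> U \<Longrightarrow> y \<noteq> x \<Longrightarrow> y \<in> ?X \<Longrightarrow> dist (f y) (f x) < e / 2"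
        unfolding eventually_at_topological by auto
      obtain n where n: "\<forall>y. (\<forall>i<n. y i = x i) \<longrightarrow> y \<in> U" using open_contains_cylinder[OF U(1,2)] by auto
      have near: "\<bar>f y - f x\<bar> \<le> e / 2" if "y \<in> cylinder t (prefix_of n x)" for y
        using that n U(3)[of y] e by (cases "y = x") (auto simp: cylinder_def dist_real_def)
      have "osc (prefix_of n x)" unfolding osc_def
      proof (intro ballI)
        fix y z assume "y \<in> cylinder t (prefix_of n x)" "z \<in> cylinder t (prefix_of n x)"
        from near[OF this(1)] near[OF this(2)] show "\<bar>f y - f z\<bar> \<le> e" by linarith
      qed
      then show ?thesis ..
    qed
    have osc_mono: "osc (prefix_of n x)" if "osc (prefix_of k x)" "k \<le> n" for k n x
    proof -
      have "cylinder t (prefix_of n x) \<subseteq> cylinder t (prefix_of k x)" using that(2) by (auto simp: cylinder_def)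
      then show ?thesis using that(1) unfolding osc_def by blast
    qed
    \<comment> \<open>The points at which depth \<open>k\<close> already controls the oscillation of
      \<open>f\<close>. By continuity these sets exhaust the shift space, although no uniform depth
      need exist.\<close>
    define A where "A k = (\<Union>w\<in>{w. length w = k \<and> osc w}. cylinder t w)" for k
    have As: "A k \<in> sets \<mu>" for k unfolding A_def by (rule emeasure_prefix_sets[OF \<mu>(2)])
    have Aiff: "x \<in> A k \<longleftrightarrow> x \<in> ?X \<and> osc (prefix_of k x)" for x k
      unfolding A_def using in_cylinder_prefix[of x t k] by (auto simp: cylinder_eq)
    have "incseq A" unfolding incseq_def using osc_mono by (auto simp: Aiff)
    moreover have "(\<Union>k. A k) = space \<mu>" using ex by (auto simp: Aiff sp)
    ultimately have "(\<lambda>k. \<mu>.prob (A k)) \<longlonglongrightarrow> 1"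
      using \<mu>.finite_Lim_measure_incseq[of A] As \<mu>.prob_space by auto
    then have "\<forall>\<^sub>F k in sequentially. 1 - e / 2 < \<mu>.prob (A k)" using e by (intro order_tendstoD) auto
    then obtain k where k: "1 - e / 2 < \<mu>.prob (A k)" using eventually_happens' sequentially_bot by blast
    let ?W = "{w. length w = k \<and> osc w}"
    have disW: "disjoint_family_on (cylinder t) ?W" by (auto simp: disjoint_family_on_def cylinder_eq)
    \<comment> \<open>Good cylinders of depth \<open>k\<close> may be infinitely many; they are
      exhausted by finite families along the enumeration of words.\<close>
    obtain F where F: "finite F" "F \<subseteq> ?W" "1 - e < (\<Sum>w\<in>F. \<mu>.prob (cylinder t w))"
    proof -
      define F where "F N = {w \<in> ?W. to_nat w < N}" for N
      have finF: "finite (F N)" for N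
        by (rule finite_subset[of _ "from_nat ` {..<N}"]) (auto simp: F_def intro!: image_eqI[where x="to_nat w" for w])
      define V where "V N = (\<Union>w\<in>F N. cylinder t w)" for N
      have Vs: "V N \<in> sets \<mu>" for N unfolding V_def by (rule emeasure_prefix_sets[OF \<mu>(2)])
      have "incseq V" by (auto simp: incseq_def V_def F_def intro: less_le_trans)
      moreover have "(\<Union>N. V N) = A k" by (auto simp: V_def F_def A_def)
      ultimately have "(\<lambda>N. \<mu>.prob (V N)) \<longlonglongrightarrow> \<mu>.prob (A k)"
        using \<mu>.finite_Lim_measure_incseq[of V] Vs by auto
      moreover have "1 - e < \<mu>.prob (A k)" using k e by simp
      ultimately have "\<forall>\<^sub>F N in sequentially. 1 - e < \<mu>.prob (V N)" by (intro order_tendstoD) auto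
      then obtain N where N: "1 - e < \<mu>.prob (V N)" using eventually_happens' sequentially_bot by blast
      have "\<mu>.prob (V N) = (\<Sum>w\<in>F N. \<mu>.prob (cylinder t w))"
        unfolding V_def using finF disW by (intro \<mu>.finite_measure_finite_Union) (auto simp: \<mu>(2) F_def disjoint_family_on_def)
      then show ?thesis using that[of "F N"] finF N by (auto simp: F_def)
    qed
    define g where "g w = (if cylinder t w = {} then 0 else f (SOME x. x \<in> cylinder t w))" for w
    have gf: "\<bar>f x - g w\<bar> \<le> e" if "w \<in> F" "x \<in> cylinder t w" for w x
    proof -
      have "(SOME x. x \<in> cylinder t w) \<in> cylinder t w" 
        using someI_ex[of "\<lambda>x. x \<in> cylinder t w"] that(2) by blast
      moreover have "osc w" using that(1) F(2) by auto
      ultimately show ?thesis using that(2) unfolding osc_def g_def by auto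
    qed
    \<comment> \<open>Stated for an arbitrary probability measure, so that it applies to the limit
      and to the approximating measures with the same cylinders. Off these cylinders the step
      function is 0 and \<open>f\<close> is bounded by \<open>B\<close>.\<close>
    have approx: "\<bar>(\<integral>x. f x \<partial>N) - (\<Sum>w\<in>F. g w * measure N (cylinder t w))\<bar> \<le> e + B * (1 - (\<Sum>w\<in>F. measure N (cylinder t w)))"
      if N: "prob_space N" "sets N = sets (shift_borel t)" for N
    proof -
      interpret N: prob_space N by fact
      have spN: "space N = ?X" using sets_eq_imp_space_eq[OF N(2)] by simp
      have fm: "f \<in> borel_measurable N"
        using borel_measurable_continuous_on_restrict[OF cont] by (subst measurable_cong_sets[OF N(2) refl]) (simp add: shift_borel_def)
      have fi: "integrable N f" using B by (intro N.integrable_const_bound[of _ B] AE_I2 fm) (auto simp: spN)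
      have ci: "integrable N (\<lambda>x. c * indicator (cylinder t w) x)" for c :: real and w
        by (intro integrable_mult_right integrable_real_indicator) (auto simp: N(2) N.emeasure_eq_measure)
      let ?h = "\<lambda>x. \<Sum>w\<in>F. g w * indicator (cylinder t w) x" and ?k = "\<lambda>x. \<Sum>w\<in>F. 1 * indicator (cylinder t w) x :: real"
      have hi: "integrable N ?h" "integrable N ?k" by (intro Bochner_Integration.integrable_sum ci)+
      have cylint: "(\<integral>x. c * indicator (cylinder t w) x \<partial>N) = c * N.prob (cylinder t w)" for c :: real and w
        by (simp add: N(2) spN cylinder_subset Int_absorb2)
      have hv: "(\<integral>x. (\<Sum>w\<in>F. c w * indicator (cylinder t w) x) \<partial>N) = (\<Sum>w\<in>F. c w * N.prob (cylinder t w))" for c :: "'a list \<Rightarrow> real"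
        by (subst Bochner_Integration.integral_sum, rule ci, simp only: cylint)
      have pt: "\<bar>f x - ?h x\<bar> \<le> e + B * (1 - ?k x)" if x: "x \<in> ?X" for x
      proof (cases "\<exists>w\<in>F. x \<in> cylinder t w")
        case True
        then obtain w where w: "w \<in> F" "x \<in> cylinder t w" by auto
        have ind: "indicator (cylinder t v) x = (if v = w then 1 else 0 :: real)" if "v \<in> F" for v
          using that w disW F(2) by (auto simp: disjoint_family_on_def split: split_indicator)
        have "?h x = (\<Sum>v\<in>F. if v = w then g w else 0)" "?k x = (\<Sum>v\<in>F. if v = w then 1 else 0)"
          by (intro sum.cong refl; simp add: ind)+
        then have "?h x = g w" "?k x = 1" using F(1) w(1) by auto
        then show ?thesis using gf[OF w] by simp
      next
        case False
        then have "?h x = 0" "?k x = 0" by (auto intro!: sum.neutral)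
        then show ?thesis using B(2)[OF x] e by simp
      qed
      have "\<bar>(\<integral>x. f x \<partial>N) - (\<integral>x. ?h x \<partial>N)\<bar> = \<bar>\<integral>x. f x - ?h x \<partial>N\<bar>"
        using fi hi by simp
      also have "\<dots> \<le> (\<integral>x. \<bar>f x - ?h x\<bar> \<partial>N)" using integral_norm_bound[of N "\<lambda>x. f x - ?h x"] by simp
      also have "\<dots> \<le> (\<integral>x. e + B * (1 - ?k x) \<partial>N)"
        using fi hi pt by (intro integral_mono integrable_abs Bochner_Integration.integrable_diff Bochner_Integration.integrable_add integrable_mult_right) (auto simp: spN)
      also have "\<dots> = e + B * (1 - (\<integral>x. ?k x \<partial>N))"
        using hi(2) by (simp add: N.prob_space del: mult_1)
      finally show ?thesis using hv[of "\<lambda>_. 1"] unfolding hv mult_1 by (simp only:)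
    qed
    have l1: "(\<lambda>n. \<Sum>w\<in>F. measure (M n) (cylinder t w)) \<longlonglongrightarrow> (\<Sum>w\<in>F. \<mu>.prob (cylinder t w))"
      by (intro tendsto_sum cyl)
    have l2: "(\<lambda>n. \<Sum>w\<in>F. g w * measure (M n) (cylinder t w)) \<longlonglongrightarrow> (\<Sum>w\<in>F. g w * \<mu>.prob (cylinder t w))"
      by (intro tendsto_sum tendsto_mult_left cyl)
    have "\<forall>\<^sub>F n in sequentially. 1 - e < (\<Sum>w\<in>F. measure (M n) (cylinder t w))"
      by (rule order_tendstoD(1)[OF l1 F(3)])
    moreover have "\<forall>\<^sub>F n in sequentially. dist (\<Sum>w\<in>F. g w * measure (M n) (cylinder t w)) (\<Sum>w\<in>F. g w * \<mu>.prob (cylinder t w)) < e"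
      by (rule tendstoD[OF l2 e])
    ultimately show "\<forall>\<^sub>F n in sequentially. dist (\<integral>x. f x \<partial>M n) (\<integral>x. f x \<partial>\<mu>) < e0"
      using M
    proof eventually_elim
      case (elim n)
      have 1: "B * (1 - (\<Sum>w\<in>F. measure (M n) (cylinder t w))) \<le> B * e" "B * (1 - (\<Sum>w\<in>F. \<mu>.prob (cylinder t w))) \<le> B * e"
        using elim(1) F(3) B(1) by (intro mult_left_mono; simp)+
      have "\<bar>(\<integral>x. f x \<partial>M n) - (\<integral>x. f x \<partial>\<mu>)\<bar> \<le> 3 * e + 2 * (B * e)"
        using approx[of "M n"] approx[OF \<mu>] elim 1 unfolding dist_real_def by linarith
      also have "\<dots> < 2 * (c * e)" using e B by (simp add: c_def algebra_simps add_pos_pos)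
      also have "\<dots> = e0" using c by (simp add: e_def)
      finally show ?case by (simp add: dist_real_def)
    qed
  qed
qed

section \<open>Convergence along the full sequence of periods\<close>

context markov_potential
begin

text \<open>The subsequence principle: a subsequence staying away from the limit on some cylinder
  would have a further limit that is again a Gibbs measure, hence an equilibrium state and equal to
  \<open>\<mu>\<close>. The index shift by \<open>n0\<close> skips the small periods, at which there
  may be no periodic points.\<close>

lemma periodic_cylinder_limit:
  obtains \<mu> C where "\<mu> \<in> invariant_measures t" "gibbs C \<mu>"
    "\<And>w. (\<lambda>n. measure (periodic_measure t \<phi> n) (cyl w)) \<longlonglongrightarrow> measure \<mu> (cyl w)"
proof -
  let ?P = "periodic_measure t \<phi>"
  obtain C n0 where C: "C \<ge> 1" and inv: "\<And>n. n \<ge> n0 \<Longrightarrow> ?P n \<in> invariant_measures t"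
    and gb: "\<And>n w. n \<ge> n0 + length w \<Longrightarrow> measure (?P n) (cyl w) \<le> C * rho w \<and> rho w \<le> C * measure (?P n) (cyl w)"
    by (rule periodic_gibbs) blast
  have sub: "\<exists>s \<mu>. strict_mono s \<and> \<mu> \<in> invariant_measures t \<and> gibbs C \<mu> \<and>
    (\<forall>w. (\<lambda>n. measure (?P (r (s n) + n0)) (cyl w)) \<longlonglongrightarrow> measure \<mu> (cyl w))" if r: "strict_mono r" for r :: "nat \<Rightarrow> nat"
  proof -
    obtain s \<mu> where "strict_mono s" "\<mu> \<in> invariant_measures t" "gibbs C \<mu>"
      "\<And>w. (\<lambda>n. measure (?P (r (s n) + n0)) (cyl w)) \<longlonglongrightarrow> measure \<mu> (cyl w)"
    proof (rule gibbs_limit[of "\<lambda>n. ?P (r n + n0)" C])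
      show "?P (r n + n0) \<in> invariant_measures t" for n by (rule inv) simp
      show "\<forall>\<^sub>F n in sequentially. \<forall>w. length w = k \<longrightarrow> measure (?P (r n + n0)) (cyl w) \<le> C * rho w \<and>
        rho w \<le> C * measure (?P (r n + n0)) (cyl w)" for k
      proof (rule eventually_sequentiallyI[of k], intro allI impI)
        fix n and w :: "'a list" assume "k \<le> n" "length w = k"
        then show "measure (?P (r n + n0)) (cyl w) \<le> C * rho w \<and> rho w \<le> C * measure (?P (r n + n0)) (cyl w)"
          using seq_suble[OF r, of n] by (intro gb) simp
      qed
    qed (use C in auto)
    then show ?thesis by blast
  qed
  obtain \<mu> where \<mu>: "\<mu> \<in> invariant_measures t" "gibbs C \<mu>" using sub[OF strict_mono_id] by auto
  have "(\<lambda>n. measure (?P (n + n0)) (cyl w)) \<longlonglongrightarrow> measure \<mu> (cyl w)" for w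
  proof (rule ccontr)
    assume "\<not> ?thesis"
    then obtain e where e: "e > 0" "\<And>N. \<exists>n\<ge>N. e \<le> \<bar>measure (?P (n + n0)) (cyl w) - measure \<mu> (cyl w)\<bar>"
      unfolding LIMSEQ_iff by (auto simp: not_less)
    then have "infinite {n. e \<le> \<bar>measure (?P (n + n0)) (cyl w) - measure \<mu> (cyl w)\<bar>}"
      unfolding infinite_nat_iff_unbounded_le by auto
    from infinite_enumerate[OF this] obtain r :: "nat \<Rightarrow> nat" where r: "strict_mono r"
      "\<And>n. e \<le> \<bar>measure (?P (r n + n0)) (cyl w) - measure \<mu> (cyl w)\<bar>" by auto
    from sub[OF r(1)] obtain s \<mu>' where s: "\<mu>' \<in> invariant_measures t" "gibbs C \<mu>'"
      "(\<lambda>n. measure (?P (r (s n) + n0)) (cyl w)) \<longlonglongrightarrow> measure \<mu>' (cyl w)" by blast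
    have "\<mu>' = \<mu>" by (rule equilibrium_eq_gibbs[OF \<mu> gibbs_equilibrium[OF s(1,2)]])
    with s(3) have "\<forall>\<^sub>F n in sequentially. dist (measure (?P (r (s n) + n0)) (cyl w)) (measure \<mu> (cyl w)) < e"
      using e(1) by (auto dest: tendstoD)
    then have "\<exists>n. dist (measure (?P (r (s n) + n0)) (cyl w)) (measure \<mu> (cyl w)) < e"
      using eventually_happens' sequentially_bot by blast
    then show False using r(2) by (auto simp: dist_real_def not_less[symmetric])
  qed
  then have "(\<lambda>n. measure (?P n) (cyl w)) \<longlonglongrightarrow> measure \<mu> (cyl w)" for w by (rule LIMSEQ_offset)
  then show ?thesis using that[OF \<mu>] by blast
qed

lemma periodic_measures_converge:
  "(\<exists>!\<mu>. equilibrium_state t \<phi> \<mu>) \<and>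
    (\<forall>\<mu>. equilibrium_state t \<phi> \<mu> \<longrightarrow> weak_star_converges t (periodic_measure t \<phi>) \<mu>)"
proof -
  obtain \<mu> C where \<mu>: "\<mu> \<in> invariant_measures t" "gibbs C \<mu>"
    "\<And>w. (\<lambda>n. measure (periodic_measure t \<phi> n) (cyl w)) \<longlonglongrightarrow> measure \<mu> (cyl w)"
    by (rule periodic_cylinder_limit) blast
  obtain n0 where n0: "\<And>n. n \<ge> n0 \<Longrightarrow> periodic_measure t \<phi> n \<in> invariant_measures t"
    by (rule periodic_gibbs) blast
  have "weak_star_converges t (periodic_measure t \<phi>) \<mu>"
  proof (rule weak_star_from_cylinders)
    show "\<forall>\<^sub>F n in sequentially. prob_space (periodic_measure t \<phi> n) \<and> sets (periodic_measure t \<phi> n) = sets (shift_borel t)"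
      using n0 by (intro eventually_sequentiallyI[of n0]) (auto simp: invariant_measures_def)
  qed (use \<mu> in \<open>auto simp: invariant_measures_def\<close>)
  moreover have "equilibrium_state t \<phi> \<nu> \<longleftrightarrow> \<nu> = \<mu>" for \<nu>
    using gibbs_equilibrium[OF \<mu>(1,2)] equilibrium_eq_gibbs[OF \<mu>(1,2)] by blast
  ultimately show ?thesis by auto
qed

end

theorem theorem1p3:
  fixes t :: "'a::{countable, discrete_topology} \<Rightarrow> 'a \<Rightarrow> bool"
    and \<phi> :: "(nat \<Rightarrow> 'a) \<Rightarrow> real"
  assumes "infinite (UNIV :: 'a set)"
    and "transition_matrix t"
    and "finitely_primitive t"
    and "summable_potential t \<phi>"
    and "summable_variations t \<phi>"
    and "beta_infinity t \<phi> < 1"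
  shows "(\<exists>!\<mu>. equilibrium_state t \<phi> \<mu>) \<and>
    (\<forall>\<mu>. equilibrium_state t \<phi> \<mu> \<longrightarrow> weak_star_converges t (periodic_measure t \<phi>) \<mu>)"
proof -
  interpret markov_potential t \<phi>
    by (rule markov_potential.intro[OF assms(2-6)])
  show ?thesis by (rule periodic_measures_converge)
qed

end
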